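(* Let $(M,J,h)$ be an almost Hermitian manifold of complex dimension $n$ (real dimension $2n$), let $t\in\mathbb{R}$, and let $\hat h=e^{2f}h$ be a conformal change of $h$, where $f\in C^\infty(M)$. Let $s(t)$ and $s_2(t)$ (resp. $\hat s(t)$ and $\hat s_2(t)$) be the two Hermitian scalar curvatures of the Gauduchon connection $D^t$ of $h$ (resp. $\hat D^t$ of $\hat h$). Then $$e^{2f}\hat s(t)=s(t)+(nt-t+1)\bigl(\Delta_df+\langle\alpha_F,df\rangle\bigr),$$ $$e^{2f}\hat s_2(t)=s_2(t)+\bigl(n(1-t)+t\bigr)\Delta_df+\frac{(1-t)^2(1-n^2)}{2}\langle df,df\rangle+\Bigl(n(1-t)+t-(n+1)\frac{(1-t)^2}{2}\Bigr)\langle\alpha_F,df\rangle,$$ where $\alpha_F$, $\Delta_d$ and $\langle\cdot,\cdot\rangle$ are the Lee form, the Hodge Laplacian and the inner product on forms of $h$.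
   Context: An almost Hermitian manifold $(M,J,h)$ consists of a smooth manifold with an almost complex structure $J$ and a Riemannian metric $h$ with $h(J\cdot,J\cdot)=h$. Its fundamental form is $F(X,Y)=h(JX,Y)$, $\delta^h$ is the codifferential, $\Delta_d=d\delta^h+\delta^hd$ is the (nonnegative) Hodge Laplacian, and the Lee form is $\alpha_F=J\delta^hF$ (sign convention such that $dF^{n-1}=\alpha_F\wedge F^{n-1}$). Let $\nabla$ be the Levi-Civita connection of $h$. For $t\in\mathbb{R}$ the Gauduchon connection $D^t$ is defined by $$h(D^t_XY,Z)=h\bigl(\nabla_XY-\tfrac12J(\nabla_XJ)Y,Z\bigr)+\tfrac t4h((\nabla_{JY}J)Z+J(\nabla_YJ)Z,X)-\tfrac t4h((\nabla_{JZ}J)Y+J(\nabla_ZJ)Y,X)$$ for vector fields $X,Y,Z$. Let $R^t(X,Y)=[D^t_X,D^t_Y]-D^t_{[X,Y]}$, extended complex-multilinearly, and $K^t(\bar W,Z,X,Y)=h(R^t(X,Y)Z,\bar W)$ ($h$ extended complex-bilinearly). For a local orthonormal frame $\{e_i,e_{n+i}=Je_i\}_{i=1,\dots,n}$ put $u_i=\frac1{\sqrt2}(e_i-\sqrt{-1}\,e_{n+i})$, $u_{\bar i}=\overline{u_i}$. The two Hermitian scalar curvatures are $$s(t)=\sum_{i,j}K^t(u_{\bar i},u_i,u_j,u_{\bar j}),\qquad s_2(t)=\sum_{i,j}K^t(u_{\bar i},u_j,u_i,u_{\bar j}).$$ $\hat D^t$, $\hat s(t)$, $\hat s_2(t)$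 are defined in the same way from $(M,J,\hat h)$. *)

theory Defs
  imports "HOL-Analysis.Analysis"
begin

section \<open>Smooth manifolds\<close>

text \<open>For open \<^term>\<open>S\<close>, \<open>Ck_on k g S\<close> says that \<open>g\<close> is of class \<open>C\<^sup>k\<close> on \<open>S\<close>.\<close>

fun Ck_on :: "nat \<Rightarrow> ('a::real_normed_vector \<Rightarrow> 'b::real_normed_vector) \<Rightarrow> 'a set \<Rightarrow> bool" where
  "Ck_on 0 g S \<longleftrightarrow> continuous_on S g"
| "Ck_on (Suc k) g S \<longleftrightarrow> (\<forall>x\<in>S. g differentiable at x) \<and>
     (\<forall>v. Ck_on k (\<lambda>x. frechet_derivative g (at x) v) S)"

definition smooth_on :: "('a::real_normed_vector \<Rightarrow> 'b::real_normed_vector) \<Rightarrow> 'a set \<Rightarrow> bool" where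
  "smooth_on g S \<longleftrightarrow> (\<forall>k. Ck_on k g S)"

text \<open>The manifold is the whole type \<open>'m\<close>. An atlas, not necessarily maximal, is a set of charts
  \<open>(U, \<phi>)\<close>; the values of \<open>\<phi>\<close> outside \<open>U\<close> are irrelevant.\<close>

type_synonym ('m, 'e) atlas = "('m set \<times> ('m \<Rightarrow> 'e)) set"

definition smooth_atlas ::
  "('m::{t2_space,second_countable_topology}, 'e::euclidean_space) atlas \<Rightarrow> bool" where
  "smooth_atlas A \<longleftrightarrow>
     (\<forall>(U, \<phi>)\<in>A. open U \<and> open (\<phi> ` U) \<and> homeomorphism U (\<phi> ` U) \<phi> (inv_into U \<phi>)) \<and>
     (\<Union>(U, \<phi>)\<in>A. U) = UNIV \<and>
     (\<forall>(U, \<phi>)\<in>A. \<forall>(V, \<psi>)\<in>A. smooth_on (\<psi> \<circ> inv_into U \<phi>) (\<phi> ` (U \<inter> V)))"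

text \<open>Smoothness in some neighbourhood of \<open>p\<close>. Functions, vector fields and frames that are only
  locally defined are represented by total functions with arbitrary values elsewhere.\<close>

definition smooth_at ::
  "('m::{t2_space,second_countable_topology}, 'e::euclidean_space) atlas \<Rightarrow> 'm \<Rightarrow> ('m \<Rightarrow> real) \<Rightarrow> bool" where
  "smooth_at A p g \<longleftrightarrow>
     (\<exists>W. open W \<and> p \<in> W \<and> (\<forall>(U, \<phi>)\<in>A. smooth_on (g \<circ> inv_into U \<phi>) (\<phi> ` (U \<inter> W))))"

definition smooth_function ::
  "('m::{t2_space,second_countable_topology}, 'e::euclidean_space) atlas \<Rightarrow> ('m \<Rightarrow> real) \<Rightarrow> bool" where
  "smooth_function A g \<longleftrightarrow> (\<forall>p. smooth_at A p g)"

section \<open>Tangent vectors and vector fields\<close>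

text \<open>A tangent vector at \<open>p\<close> is a derivation of the algebra of functions that are smooth near \<open>p\<close>,
  set to \<open>0\<close> on all other functions. Such a derivation automatically depends only on germs:
  the indicator function \<open>\<chi>\<close> of a neighbourhood of \<open>p\<close> is smooth near \<open>p\<close>, and if \<open>g = k\<close> on that
  neighbourhood then \<open>\<chi> g = \<chi> k\<close>, while \<open>v(\<chi>) = 0\<close> because \<open>\<chi>\<^sup>2 = \<chi>\<close>.\<close>

type_synonym 'm tangent = "('m \<Rightarrow> real) \<Rightarrow> real"
type_synonym 'm vfield = "'m \<Rightarrow> 'm tangent"

definition tangent_space ::
  "('m::{t2_space,second_countable_topology}, 'e::euclidean_space) atlas \<Rightarrow> 'm \<Rightarrow> 'm tangent set" where
  "tangent_space A p = {v.
     (\<forall>g k a b. smooth_at A p g \<longrightarrow> smooth_at A p k \<longrightarrow>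
        v (\<lambda>q. a * g q + b * k q) = a * v g + b * v k) \<and>
     (\<forall>g k. smooth_at A p g \<longrightarrow> smooth_at A p k \<longrightarrow>
        v (\<lambda>q. g q * k q) = v g * k p + g p * v k) \<and>
     (\<forall>g. \<not> smooth_at A p g \<longrightarrow> v g = 0)}"

definition vfield_at ::
  "('m::{t2_space,second_countable_topology}, 'e::euclidean_space) atlas \<Rightarrow> 'm \<Rightarrow> 'm vfield \<Rightarrow> bool" where
  "vfield_at A p X \<longleftrightarrow>
     (\<exists>W. open W \<and> p \<in> W \<and>
        (\<forall>q\<in>W. X q \<in> tangent_space A q \<and>
           (\<forall>g. smooth_at A q g \<longrightarrow> smooth_at A q (\<lambda>r. X r g))))"

definition lie_bracket ::
  "('m::{t2_space,second_countable_topology}, 'e::euclidean_space) atlas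
    \<Rightarrow> 'm vfield \<Rightarrow> 'm vfield \<Rightarrow> 'm vfield" where
  "lie_bracket A X Y = (\<lambda>q g. if smooth_at A q g
     then X q (\<lambda>r. Y r g) - Y q (\<lambda>r. X r g) else 0)"

section \<open>Almost Hermitian manifolds\<close>

type_synonym 'm metric = "'m \<Rightarrow> 'm tangent \<Rightarrow> 'm tangent \<Rightarrow> real"
type_synonym 'm endo = "'m \<Rightarrow> 'm tangent \<Rightarrow> 'm tangent"

definition riemannian_metric ::
  "('m::{t2_space,second_countable_topology}, 'e::euclidean_space) atlas \<Rightarrow> 'm metric \<Rightarrow> bool" where
  "riemannian_metric A h \<longleftrightarrow>
     (\<forall>p. \<forall>v\<in>tangent_space A p. \<forall>w\<in>tangent_space A p. h p v w = h p w v) \<and>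
     (\<forall>p. \<forall>v\<in>tangent_space A p. \<forall>w\<in>tangent_space A p. \<forall>z\<in>tangent_space A p. \<forall>a b.
        h p (\<lambda>g. a * v g + b * w g) z = a * h p v z + b * h p w z) \<and>
     (\<forall>p. \<forall>v\<in>tangent_space A p. v \<noteq> (\<lambda>g. 0) \<longrightarrow> h p v v > 0) \<and>
     (\<forall>p X Y. vfield_at A p X \<longrightarrow> vfield_at A p Y \<longrightarrow> smooth_at A p (\<lambda>q. h q (X q) (Y q)))"

definition almost_complex_structure ::
  "('m::{t2_space,second_countable_topology}, 'e::euclidean_space) atlas \<Rightarrow> 'm endo \<Rightarrow> bool" where
  "almost_complex_structure A J \<longleftrightarrow>
     (\<forall>p. \<forall>v\<in>tangent_space A p. J p v \<in> tangent_space A p \<and> J p (J p v) = (\<lambda>g. - v g)) \<and>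
     (\<forall>p. \<forall>v\<in>tangent_space A p. \<forall>w\<in>tangent_space A p. \<forall>a b.
        J p (\<lambda>g. a * v g + b * w g) = (\<lambda>g. a * J p v g + b * J p w g)) \<and>
     (\<forall>p X. vfield_at A p X \<longrightarrow> vfield_at A p (\<lambda>q. J q (X q)))"

definition almost_hermitian_manifold ::
  "('m::{t2_space,second_countable_topology}, 'e::euclidean_space) atlas
    \<Rightarrow> nat \<Rightarrow> 'm endo \<Rightarrow> 'm metric \<Rightarrow> bool" where
  "almost_hermitian_manifold A n J h \<longleftrightarrow>
     smooth_atlas A \<and> DIM('e) = 2 * n \<and> almost_complex_structure A J \<and> riemannian_metric A h \<and>
     (\<forall>p. \<forall>v\<in>tangent_space A p. \<forall>w\<in>tangent_space A p. h p (J p v) (J p w) = h p v w)"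

definition conformal_metric :: "('m \<Rightarrow> real) \<Rightarrow> 'm metric \<Rightarrow> 'm metric" where
  "conformal_metric f h = (\<lambda>p v w. exp (2 * f p) * h p v w)"

text \<open>A frame \<open>e 0, \<dots>, e (2n - 1)\<close> near \<open>p\<close> with \<open>e (n + i) = J (e i)\<close>.\<close>

definition local_unitary_frame ::
  "('m::{t2_space,second_countable_topology}, 'e::euclidean_space) atlas
    \<Rightarrow> nat \<Rightarrow> 'm endo \<Rightarrow> 'm metric \<Rightarrow> 'm \<Rightarrow> (nat \<Rightarrow> 'm vfield) \<Rightarrow> bool" where
  "local_unitary_frame A n J h p e \<longleftrightarrow>
     (\<forall>i<2 * n. vfield_at A p (e i)) \<and>
     (\<exists>W. open W \<and> p \<in> W \<and> (\<forall>q\<in>W.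
        (\<forall>i<2 * n. \<forall>j<2 * n. h q (e i q) (e j q) = (if i = j then 1 else 0)) \<and>
        (\<forall>i<n. e (n + i) q = J q (e i q)) \<and>
        (\<forall>v\<in>tangent_space A q. \<exists>c. v = (\<lambda>g. \<Sum>i<2 * n. c i * e i q g))))"

section \<open>Connections\<close>

text \<open>\<open>D p v Y\<close> is the derivative at \<open>p\<close> of the vector field \<open>Y\<close> in the direction \<open>v\<close>; it is
  meaningful if \<open>v\<close> is tangent at \<open>p\<close> and \<open>Y\<close> is smooth near \<open>p\<close>, and then depends only on the
  germ of \<open>Y\<close> at \<open>p\<close>, for the same reason as in the case of tangent vectors.\<close>

type_synonym 'm connection = "'m \<Rightarrow> 'm tangent \<Rightarrow> 'm vfield \<Rightarrow> 'm tangent"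

definition cov :: "'m connection \<Rightarrow> 'm vfield \<Rightarrow> 'm vfield \<Rightarrow> 'm vfield" where
  "cov D X Y = (\<lambda>q. D q (X q) Y)"

definition is_connection ::
  "('m::{t2_space,second_countable_topology}, 'e::euclidean_space) atlas \<Rightarrow> 'm connection \<Rightarrow> bool" where
  "is_connection A D \<longleftrightarrow>
     (\<forall>p Y. \<forall>v\<in>tangent_space A p. vfield_at A p Y \<longrightarrow> D p v Y \<in> tangent_space A p) \<and>
     (\<forall>p Y a b. \<forall>v\<in>tangent_space A p. \<forall>w\<in>tangent_space A p. vfield_at A p Y \<longrightarrow>
        D p (\<lambda>g. a * v g + b * w g) Y = (\<lambda>g. a * D p v Y g + b * D p w Y g)) \<and>
     (\<forall>p Y Z. \<forall>v\<in>tangent_space A p. vfield_at A p Y \<longrightarrow> vfield_at A p Z \<longrightarrow>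
        D p v (\<lambda>q g. Y q g + Z q g) = (\<lambda>g. D p v Y g + D p v Z g)) \<and>
     (\<forall>p Y k. \<forall>v\<in>tangent_space A p. vfield_at A p Y \<longrightarrow> smooth_at A p k \<longrightarrow>
        D p v (\<lambda>q g. k q * Y q g) = (\<lambda>g. v k * Y p g + k p * D p v Y g)) \<and>
     (\<forall>p X Y. vfield_at A p X \<longrightarrow> vfield_at A p Y \<longrightarrow> vfield_at A p (cov D X Y))"

definition levi_civita ::
  "('m::{t2_space,second_countable_topology}, 'e::euclidean_space) atlas
    \<Rightarrow> 'm metric \<Rightarrow> 'm connection \<Rightarrow> bool" where
  "levi_civita A h D \<longleftrightarrow>
     is_connection A D \<and>
     (\<forall>p X Y. vfield_at A p X \<longrightarrow> vfield_at A p Y \<longrightarrow>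
        (\<lambda>g. D p (X p) Y g - D p (Y p) X g) = lie_bracket A X Y p) \<and>
     (\<forall>p Y Z. \<forall>v\<in>tangent_space A p. vfield_at A p Y \<longrightarrow> vfield_at A p Z \<longrightarrow>
        v (\<lambda>q. h q (Y q) (Z q)) = h p (D p v Y) (Z p) + h p (Y p) (D p v Z))"

text \<open>\<open>(\<nabla>\<^sub>v J) Z\<close> at \<open>p\<close>.\<close>

definition nabla_J :: "'m endo \<Rightarrow> 'm connection \<Rightarrow> 'm connection" where
  "nabla_J J nabla = (\<lambda>p v Z g. nabla p v (\<lambda>q. J q (Z q)) g - J p (nabla p v Z) g)"

text \<open>The Gauduchon connection \<open>D\<^sup>t\<close> of \<open>(J, h)\<close>, where \<open>nabla\<close> is the Levi-Civita connection of \<open>h\<close>.\<close>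

definition gauduchon ::
  "('m::{t2_space,second_countable_topology}, 'e::euclidean_space) atlas
    \<Rightarrow> 'm endo \<Rightarrow> 'm metric \<Rightarrow> 'm connection \<Rightarrow> real \<Rightarrow> 'm connection" where
  "gauduchon A J h nabla t = (\<lambda>p v Y. THE w. w \<in> tangent_space A p \<and>
     (\<forall>Z. vfield_at A p Z \<longrightarrow>
        h p w (Z p) =
          h p (\<lambda>g. nabla p v Y g - 1/2 * J p (nabla_J J nabla p v Y) g) (Z p)
          + t/4 * h p (\<lambda>g. nabla_J J nabla p (J p (Y p)) Z g + J p (nabla_J J nabla p (Y p) Z) g) v
          - t/4 * h p (\<lambda>g. nabla_J J nabla p (J p (Z p)) Y g + J p (nabla_J J nabla p (Z p) Y) g) v))"

definition curvature ::
  "('m::{t2_space,second_countable_topology}, 'e::euclidean_space) atlas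
    \<Rightarrow> 'm connection \<Rightarrow> 'm vfield \<Rightarrow> 'm vfield \<Rightarrow> 'm vfield \<Rightarrow> 'm vfield" where
  "curvature A D X Y Z = (\<lambda>p g.
     cov D X (cov D Y Z) p g - cov D Y (cov D X Z) p g - cov D (lie_bracket A X Y) Z p g)"

section \<open>Hermitian scalar curvatures\<close>

text \<open>A complex vector field \<open>X + \<i>Y\<close> is the pair \<open>(X, Y)\<close>; \<open>complexify\<close> extends a real-linear
  function of vector fields complex-linearly.\<close>

type_synonym 'm cvfield = "'m vfield \<times> 'm vfield"

definition complexify :: "('m vfield \<Rightarrow> complex) \<Rightarrow> 'm cvfield \<Rightarrow> complex" where
  "complexify B Z = B (fst Z) + \<i> * B (snd Z)"

definition conj_field :: "'m cvfield \<Rightarrow> 'm cvfield" where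
  "conj_field Z = (fst Z, \<lambda>q g. - snd Z q g)"

text \<open>\<open>curv4 \<dots> W Z X Y p\<close> is the complex-multilinear extension of \<open>h(R(X,Y)Z, W)\<close> at \<open>p\<close>.\<close>

definition curv4 ::
  "('m::{t2_space,second_countable_topology}, 'e::euclidean_space) atlas
    \<Rightarrow> 'm metric \<Rightarrow> 'm connection
    \<Rightarrow> 'm cvfield \<Rightarrow> 'm cvfield \<Rightarrow> 'm cvfield \<Rightarrow> 'm cvfield \<Rightarrow> 'm \<Rightarrow> complex" where
  "curv4 A h D W Z X Y p =
     complexify (\<lambda>W'. complexify (\<lambda>Z'. complexify (\<lambda>X'. complexify (\<lambda>Y'.
       complex_of_real (h p (curvature A D X' Y' Z' p) (W' p))) Y) X) Z) W"

definition unitary_field :: "nat \<Rightarrow> (nat \<Rightarrow> 'm vfield) \<Rightarrow> nat \<Rightarrow> 'm cvfield" where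
  "unitary_field n e i = (\<lambda>q g. 1 / sqrt 2 * e i q g, \<lambda>q g. - (1 / sqrt 2 * e (n + i) q g))"

text \<open>The two scalar curvatures of \<open>D\<^sup>t\<close> at \<open>p\<close>, computed in a local unitary frame \<open>e\<close> near \<open>p\<close>.
  Their values do not depend on the choice of \<open>e\<close>.\<close>

definition scal1 ::
  "('m::{t2_space,second_countable_topology}, 'e::euclidean_space) atlas
    \<Rightarrow> nat \<Rightarrow> 'm endo \<Rightarrow> 'm metric \<Rightarrow> 'm connection \<Rightarrow> (nat \<Rightarrow> 'm vfield) \<Rightarrow> real \<Rightarrow> 'm \<Rightarrow> complex" where
  "scal1 A n J h nabla e t p = (let u = unitary_field n e; K = curv4 A h (gauduchon A J h nabla t) in
     \<Sum>i<n. \<Sum>j<n. K (conj_field (u i)) (u i) (u j) (conj_field (u j)) p)"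

definition scal2 ::
  "('m::{t2_space,second_countable_topology}, 'e::euclidean_space) atlas
    \<Rightarrow> nat \<Rightarrow> 'm endo \<Rightarrow> 'm metric \<Rightarrow> 'm connection \<Rightarrow> (nat \<Rightarrow> 'm vfield) \<Rightarrow> real \<Rightarrow> 'm \<Rightarrow> complex" where
  "scal2 A n J h nabla e t p = (let u = unitary_field n e; K = curv4 A h (gauduchon A J h nabla t) in
     \<Sum>i<n. \<Sum>j<n. K (conj_field (u i)) (u j) (u i) (conj_field (u j)) p)"

section \<open>Forms, codifferential, Hodge Laplacian, Lee form\<close>

text \<open>A \<open>k\<close>-form is evaluated on lists of \<open>k\<close> vector fields (values on lists of other lengths
  are irrelevant); a function is a 0-form.\<close>

type_synonym 'm form = "'m vfield list \<Rightarrow> 'm \<Rightarrow> real"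

definition zero_form :: "('m \<Rightarrow> real) \<Rightarrow> 'm form" where
  "zero_form g = (\<lambda>Xs. g)"

definition omit :: "nat \<Rightarrow> 'a list \<Rightarrow> 'a list" where
  "omit i xs = take i xs @ drop (Suc i) xs"

definition ext_deriv ::
  "('m::{t2_space,second_countable_topology}, 'e::euclidean_space) atlas \<Rightarrow> 'm form \<Rightarrow> 'm form" where
  "ext_deriv A \<omega> Xs p =
     (\<Sum>i<length Xs. (-1) ^ i * (Xs ! i) p (\<omega> (omit i Xs))) +
     (\<Sum>j<length Xs. \<Sum>i<j. (-1) ^ (i + j) *
        \<omega> (lie_bracket A (Xs ! i) (Xs ! j) # omit i (omit j Xs)) p)"

definition cov_form :: "'m connection \<Rightarrow> 'm vfield \<Rightarrow> 'm form \<Rightarrow> 'm form" where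
  "cov_form nabla X \<omega> Ys p =
     X p (\<omega> Ys) - (\<Sum>i<length Ys. \<omega> (Ys[i := cov nabla X (Ys ! i)]) p)"

text \<open>\<open>\<delta>\<omega> = - \<Sum>\<^sub>i (\<nabla>\<^bsub>e i\<^esub> \<omega>)(e i, \<dots>)\<close> for an orthonormal frame \<open>e\<close>, with \<open>nabla\<close> the Levi-Civita
  connection.\<close>

definition codiff :: "nat \<Rightarrow> 'm connection \<Rightarrow> (nat \<Rightarrow> 'm vfield) \<Rightarrow> 'm form \<Rightarrow> 'm form" where
  "codiff n nabla e \<omega> Ys p = - (\<Sum>i<2 * n. cov_form nabla (e i) \<omega> (e i # Ys) p)"

text \<open>On 0-forms the summand \<open>d\<delta>\<close> vanishes, as it must: \<open>ext_deriv A \<omega> []\<close> is an empty sum.\<close>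

definition hodge_laplacian ::
  "('m::{t2_space,second_countable_topology}, 'e::euclidean_space) atlas
    \<Rightarrow> nat \<Rightarrow> 'm connection \<Rightarrow> (nat \<Rightarrow> 'm vfield) \<Rightarrow> 'm form \<Rightarrow> 'm form" where
  "hodge_laplacian A n nabla e \<omega> Xs p =
     ext_deriv A (codiff n nabla e \<omega>) Xs p + codiff n nabla e (ext_deriv A \<omega>) Xs p"

definition fundamental_form :: "'m endo \<Rightarrow> 'm metric \<Rightarrow> 'm form" where
  "fundamental_form J h Xs p = h p (J p ((Xs ! 0) p)) ((Xs ! 1) p)"

text \<open>\<open>J\<close> acts on a 1-form through the metric duality, \<open>J\<alpha> = - \<alpha> \<circ> J\<close>; this is the sign for which
  \<open>d(F\<^bsup>n-1\<^esup>) = \<alpha>\<^sub>F \<and> F\<^bsup>n-1\<^esup>\<close>.\<close>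

definition J_form :: "'m endo \<Rightarrow> 'm form \<Rightarrow> 'm form" where
  "J_form J \<alpha> Xs p = - \<alpha> [\<lambda>q. J q ((Xs ! 0) q)] p"

definition lee_form ::
  "nat \<Rightarrow> 'm endo \<Rightarrow> 'm metric \<Rightarrow> 'm connection \<Rightarrow> (nat \<Rightarrow> 'm vfield) \<Rightarrow> 'm form" where
  "lee_form n J h nabla e = J_form J (codiff n nabla e (fundamental_form J h))"

text \<open>The inner product of 1-forms, in an orthonormal frame \<open>e\<close>.\<close>

definition inner1 :: "nat \<Rightarrow> (nat \<Rightarrow> 'm vfield) \<Rightarrow> 'm form \<Rightarrow> 'm form \<Rightarrow> 'm \<Rightarrow> real" where
  "inner1 n e \<alpha> \<beta> p = (\<Sum>i<2 * n. \<alpha> [e i] p * \<beta> [e i] p)"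

end

theory Submission
  imports Defs
begin

text \<open>Near \<open>p\<close> a unitary frame identifies the tangent spaces with the fixed Euclidean space
  \<open>'e\<close>, on which \<open>J\<close> becomes a constant orthogonal map \<open>j\<close> and each connection becomes \<open>d + \<Gamma>\<close>
  for a smooth field \<open>\<Gamma>\<close> of bilinear maps. With \<open>u = grad f\<close>, the two Gauduchon connections differ
  by \<open>S(u; x, y) = \<langle>u, x\<rangle> y + S'(u; x, y)\<close>, where \<open>S'(u; x, _)\<close> is skew and commutes with \<open>j\<close>.
  Since \<open>D = D\<^sup>t\<close> preserves the metric and \<open>j\<close>, the difference of the curvatures at \<open>(x, y)\<close> is
  \<open>S'(D\<^sub>x u; y, _) - S'(D\<^sub>y u; x, _) + S'(u; T(x, y), _) + [S'(u; x, _), S'(u; y, _)]\<close>,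
  where \<open>T\<close> is the torsion of \<open>D\<close>; the scalar part of \<open>S\<close> drops out because \<open>df\<close> is closed.
  Both scalar curvatures are traces of the curvature that do not depend on the unitary frame, and
  tracing this difference over an orthonormal basis gives the two formulas.\<close>

section \<open>Calculus of iterated differentiability\<close>

text \<open>The frame is orthonormal for \<open>h\<close> and serves both metrics. Constancy of
  \<open>j\<close> makes \<nabla>J, hence D^t, algebraic in the Levi-Civita coefficients, so the
  difference tensor arises by substituting the classical conformal change of \<nabla> into the
  definition of D^t. The price is that the frame fields do not commute: their bracket
  \<open>\<tau>\<close> enters both curvature and torsion. The two scalar curvatures come with
  unrelated unitary frames, one for each metric, so each must first become a basis-free trace. The
  weight exp(2f) is what this costs: lowering an index with the new metric gives one factor exp(2f),
  each of the two contractions gives exp(-2f). No symmetry of either curvature is established. The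
  traces are additive, and only the difference, visibly skew and commuting with \<open>j\<close>, is
  reduced to real traces. The first formula has no term in \<langle>df,df\<rangle> because a
  commutator of skew-Hermitian maps is traceless; in the second that term is what survives when the
  square of a trace is subtracted from a trace of products.\<close>

lemma Ck_on_cong:
  assumes "open S" "\<And>x. x \<in> S \<Longrightarrow> g x = k x" "Ck_on m g S"
  shows "Ck_on m k S"
  using assms(2,3)
proof (induction m arbitrary: g k)
  case 0
  then show ?case by (simp cong: continuous_on_cong)
next
  case (Suc m)
  \<comment> \<open>On an open set agreement passes to derivatives, since a Frechet derivative at a
    point sees only a neighbourhood.\<close>
  have d: "(k has_derivative frechet_derivative g (at x)) (at x)" if "x \<in> S" for x
    by (rule has_derivative_transform_within_open[OF _ \<open>open S\<close> that, of g])
      (use Suc.prems that in \<open>auto simp: frechet_derivative_works\<close>)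
  then have eq: "frechet_derivative g (at x) = frechet_derivative k (at x)" if "x \<in> S" for x
    using frechet_derivative_at that by blast
  show ?case
    using d Suc.IH[of "\<lambda>x. frechet_derivative g (at x) v" "\<lambda>x. frechet_derivative k (at x) v" for v]
      Suc.prems(2) eq by (auto simp: differentiable_def)
qed

lemma Ck_on_subset: "Ck_on m g S \<Longrightarrow> T \<subseteq> S \<Longrightarrow> Ck_on m g T"
  by (induction m arbitrary: g) (auto intro: continuous_on_subset)

text \<open>Product and chain rule multiply a derivative by an undifferentiated factor, so their
  inductions use that factor in a class one lower. Differentiability gives continuity at the bottom;
  above it the claim descends to directional derivatives.\<close>

lemma Ck_on_SucD: "Ck_on (Suc m) g S \<Longrightarrow> Ck_on m g S"
proof (induction m arbitrary: g)
  case 0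
  then have "\<forall>x\<in>S. g differentiable (at x)" by simp
  then show ?case
    by (simp add: continuous_at_imp_continuous_on differentiable_imp_continuous_within)
next
  case (Suc m)
  from Suc.prems have "\<forall>x\<in>S. g differentiable (at x)"
    "\<And>v. Ck_on (Suc m) (\<lambda>x. frechet_derivative g (at x) v) S"
    by (subst (asm) Ck_on.simps(2), blast)+
  then show ?case
    using Suc.IH by (subst Ck_on.simps(2)) blast
qed

lemma Ck_on_const: "Ck_on m (\<lambda>x. c) S"
  by (induction m arbitrary: c) (auto simp: frechet_derivative_const)

lemma Ck_on_add:
  assumes "open S" "Ck_on m g S" "Ck_on m k S"
  shows "Ck_on m (\<lambda>x. g x + k x) S"
  using assms(2,3)
proof (induction m arbitrary: g k)
  case 0
  then show ?case by (auto intro: continuous_on_add)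
next
  case (Suc m)
  have d: "((\<lambda>x. g x + k x) has_derivative
      (\<lambda>v. frechet_derivative g (at x) v + frechet_derivative k (at x) v)) (at x)"
    if "x \<in> S" for x
    by (rule has_derivative_add) (use Suc.prems that in \<open>auto simp: frechet_derivative_works\<close>)
  have h: "Ck_on m (\<lambda>x. frechet_derivative g (at x) v + frechet_derivative k (at x) v) S" for v
    using Suc.prems by (auto intro!: Suc.IH)
  have "Ck_on m (\<lambda>x. frechet_derivative (\<lambda>x. g x + k x) (at x) v) S" for v
    by (rule Ck_on_cong[OF assms(1) _ h[of v]]) (simp add: frechet_derivative_at[OF d, symmetric])
  then show ?case
    using d by (auto simp: differentiable_def)
qed

lemma Ck_on_mult:
  fixes g k :: "'a::real_normed_vector \<Rightarrow> real"
  assumes "open S" "Ck_on m g S" "Ck_on m k S"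
  shows "Ck_on m (\<lambda>x. g x * k x) S"
  using assms(2,3)
proof (induction m arbitrary: g k)
  case 0
  then show ?case by (auto intro: continuous_on_mult)
next
  case (Suc m)
  have d: "((\<lambda>x. g x * k x) has_derivative
      (\<lambda>v. g x * frechet_derivative k (at x) v + frechet_derivative g (at x) v * k x)) (at x)"
    if "x \<in> S" for x
    by (rule has_derivative_mult) (use Suc.prems that in \<open>auto simp: frechet_derivative_works\<close>)
  have h: "Ck_on m (\<lambda>x. g x * frechet_derivative k (at x) v + frechet_derivative g (at x) v * k x)
      S"
    for v
    using Suc.prems Ck_on_SucD[OF Suc.prems(1)] Ck_on_SucD[OF Suc.prems(2)]
    by (auto intro!: Ck_on_add[OF assms(1)] Suc.IH)
  have "Ck_on m (\<lambda>x. frechet_derivative (\<lambda>x. g x * k x) (at x) v) S" for v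
    by (rule Ck_on_cong[OF assms(1) _ h[of v]]) (simp add: frechet_derivative_at[OF d, symmetric])
  then show ?case
    using d by (auto simp: differentiable_def)
qed

text \<open>Differentiation turns \<open>F i\<close> into \<open>F (Suc i)\<close>, so a whole tower
  of derivatives is carried and the induction on \<open>m\<close> treats all \<open>i\<close> at
  once.\<close>

lemma Ck_on_compose_real:
  fixes g :: "'a::real_normed_vector \<Rightarrow> real" and F :: "nat \<Rightarrow> real \<Rightarrow> real"
  assumes "open S" and F: "\<And>i y. (F i has_real_derivative F (Suc i) y) (at y)"
    and "Ck_on m g S"
  shows "Ck_on m (\<lambda>x. F i (g x)) S"
  using assms(3)
proof (induction m arbitrary: i)
  case 0
  have "continuous_on UNIV (F i)"
    using F by (meson DERIV_continuous continuous_at_imp_continuous_on)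
  with 0 show ?case
    by (auto intro: continuous_on_compose2)
next
  case (Suc m)
  have d: "((\<lambda>x. F i (g x)) has_derivative
      (\<lambda>v. F (Suc i) (g x) * frechet_derivative g (at x) v)) (at x)"
    if "x \<in> S" for x
    using has_derivative_compose[of g "frechet_derivative g (at x)" x UNIV "F i" "(*) (F (Suc i)
        (g x))"]
      F[of i "g x"] Suc.prems that
    by (auto simp: frechet_derivative_works has_field_derivative_def)
  have h: "Ck_on m (\<lambda>x. F (Suc i) (g x) * frechet_derivative g (at x) v) S" for v
    using Suc.prems Suc.IH[OF Ck_on_SucD[OF Suc.prems]]
    by (auto intro!: Ck_on_mult[OF assms(1)])
  have "Ck_on m (\<lambda>x. frechet_derivative (\<lambda>x. F i (g x)) (at x) v) S" for v
    by (rule Ck_on_cong[OF assms(1) _ h[of v]]) (simp add: frechet_derivative_at[OF d, symmetric])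
  then show ?case
    using d by (auto simp: differentiable_def)
qed

text \<open>\<open>F 0\<close> is (exp y - 1 - y)/y^2 with the singularity at 0 removed by taking
  the power series with coefficients 1/(n+2)!, and \<open>F i\<close> is its i-th termwise
  derivative. The full tower is what makes composites with \<open>F 0\<close> smooth.\<close>

lemma exp_remainder:
  obtains F :: "nat \<Rightarrow> real \<Rightarrow> real"
  where "\<forall>i y. (F i has_real_derivative F (Suc i) y) (at y)"
    "\<forall>y. exp y = 1 + y + y * y * F 0 y"
proof -
  define c :: "nat \<Rightarrow> real" where "c = (\<lambda>n. inverse (fact (n + 2)))"
  define F where "F = (\<lambda>i y. \<Sum>n. (diffs ^^ i) c n * y ^ n)"
  have exp: "(\<lambda>n. y ^ n /\<^sub>R fact n) sums exp y" for y :: real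
    by (rule exp_converges)
  have summ0: "summable (\<lambda>n. c n * y ^ n)" for y
  proof (cases "y = 0")
    case True
    then show ?thesis
      by (simp add: summable_finite)
  next
    case False
    have "summable (\<lambda>n. y ^ (n + 2) /\<^sub>R fact (n + 2))"
      using sums_summable[OF exp[of y]] by (subst summable_iff_shift)
    then have "summable (\<lambda>n. inverse (y * y) * (y ^ (n + 2) /\<^sub>R fact (n + 2)))"
      by (rule summable_mult)
    moreover have "inverse (y * y) * (y ^ (n + 2) /\<^sub>R fact (n + 2)) = c n * y ^ n" for n
    proof -
      have "inverse (y * y) * y ^ (n + 2) = y ^ n"
        using False by (simp add: field_simps)
      then show ?thesis by (metis c_def mult.assoc mult.commute real_scaleR_def)
    qed
    ultimately show ?thesis by (simp only:)
  qed
  have summ: "summable (\<lambda>n. (diffs ^^ i) c n * y ^ n)" for i y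
  proof (induction i arbitrary: y)
    case (Suc i)
    then show ?case using termdiff_converges_all[of "(diffs ^^ i) c"] by simp
  qed (simp add: summ0)
  have "(F i has_real_derivative F (Suc i) y) (at y)" for i y
    unfolding F_def using termdiffs_strong[OF summ[of i "norm y + 1"], of y] by simp
  moreover have "exp y = 1 + y + y * y * F 0 y" for y
  proof -
    have "exp y = (\<Sum>n. y ^ (n + 2) /\<^sub>R fact (n + 2)) + (\<Sum>n<2. y ^ n /\<^sub>R fact n)"
      using suminf_split_initial_segment[OF sums_summable[OF exp[of y]], of 2] sums_unique[OF
          exp[of y]]
      by simp
    also have "(\<Sum>n. y ^ (n + 2) /\<^sub>R fact (n + 2)) = (\<Sum>n. (y * y) * (c n * y ^ n))"
      by (rule arg_cong[of _ _ suminf]) (simp add: c_def power_add power2_eq_square mult_ac)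
    also have "\<dots> = y * y * F 0 y"
      using suminf_mult[OF summ0[of y], of "y * y"] by (simp add: F_def)
    finally show ?thesis by (simp add: numeral_2_eq_2)
  qed
  ultimately show ?thesis using that by blast
qed

section \<open>Hermitian linear algebra\<close>

lemma sum_Basis_contract:
  fixes f :: "'e::euclidean_space \<Rightarrow> 'b::real_vector"
  assumes "linear f"
  shows "(\<Sum>b\<in>Basis. (x \<bullet> b) *\<^sub>R f b) = f x"
  using linear_sum[OF assms, of "\<lambda>b. (x \<bullet> b) *\<^sub>R b" Basis]
  by (simp add: euclidean_representation linear_scale[OF assms])

lemma sum_Basis_contract_real:
  fixes f :: "'e::euclidean_space \<Rightarrow> real"
  assumes "linear f"
  shows "(\<Sum>b\<in>Basis. (x \<bullet> b) * f b) = f x"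
  using sum_Basis_contract[OF assms] by simp

text \<open>Expanding one argument of each diagonal term in the \<open>u i\<close> and contracting
  the other against \<open>Basis\<close> leaves the diagonal sum over the \<open>u i\<close>. It is
  applied to the image of the basis under \<open>j\<close> and to rescaled unitary frames.\<close>

lemma trace_invariant:
  fixes G :: "'e::euclidean_space \<Rightarrow> 'e \<Rightarrow> 'b::real_vector"
  assumes G: "bilinear G" and u: "\<And>x. x = (\<Sum>i\<in>I. (x \<bullet> u i) *\<^sub>R u i)"
  shows "(\<Sum>i\<in>I. G (u i) (u i)) = (\<Sum>b\<in>Basis. G b b)"
proof -
  have l: "linear (G x)" "linear (\<lambda>x. G x y)" for x y
    using G by (auto simp: bilinear_def)
  have "(\<Sum>b\<in>Basis. G b b) = (\<Sum>b\<in>Basis. G (\<Sum>i\<in>I. (b \<bullet> u i) *\<^sub>R u i) b)"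
    using u by (intro sum.cong) auto
  also have "\<dots> = (\<Sum>b\<in>Basis. \<Sum>i\<in>I. (b \<bullet> u i) *\<^sub>R G (u i) b)"
    using l(2) by (simp add: linear_sum[OF l(2)] linear_scale[OF l(2)])
  also have "\<dots> = (\<Sum>i\<in>I. \<Sum>b\<in>Basis. (u i \<bullet> b) *\<^sub>R G (u i) b)"
    by (subst sum.swap) (simp add: inner_commute)
  also have "\<dots> = (\<Sum>i\<in>I. G (u i) (u i))"
    by (simp add: sum_Basis_contract[OF l(1)])
  finally show ?thesis ..
qed

text \<open>Counterpart of \<open>complexify\<close> for vectors of the fixed space: a complex
  vector is the pair of its real and imaginary parts.\<close>

definition cext :: "('v \<Rightarrow> complex) \<Rightarrow> 'v \<times> 'v \<Rightarrow> complex" where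
  "cext B Z = B (fst Z) + \<i> * B (snd Z)"

lemma cext_sum: "cext (\<lambda>x. \<Sum>i\<in>I. B i x) Z = (\<Sum>i\<in>I. cext (B i) Z)"
  by (simp add: cext_def sum.distrib sum_distrib_left)

lemma cext_cmult: "cext (\<lambda>x. c * B x) Z = c * cext B Z"
  by (simp add: cext_def algebra_simps)

lemma cext_swap: "cext (\<lambda>x. cext (\<lambda>y. B x y) Y) X = cext (\<lambda>y. cext (\<lambda>x. B x y) X) Y"
  by (simp add: cext_def algebra_simps)

lemma sum_lessThan_add: "(\<Sum>i<n + m. f i) = (\<Sum>i<n. f i) + (\<Sum>i<m. f (n + i :: nat))"
  for f :: "nat \<Rightarrow> 'a::comm_monoid_add"
  by (induction m) (simp_all add: add_ac)

locale hermitian_space =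
  fixes j :: "'e::euclidean_space \<Rightarrow> 'e" and n :: nat and t :: real
  assumes linear_j: "linear j" and jj: "j (j x) = - x" and j_iso: "j x \<bullet> j y = x \<bullet> y"
    and dim: "DIM('e) = 2 * n"
begin

lemmas j_simps = linear_add[OF linear_j] linear_diff[OF linear_j] linear_scale[OF linear_j]
  linear_neg[OF linear_j] linear_0[OF linear_j] linear_sum[OF linear_j]

lemma j_skew: "j x \<bullet> y = - (x \<bullet> j y)"
  using j_iso[of x "j y"] by (simp add: jj)

lemma j_anti: "x \<bullet> j y = - (y \<bullet> j x)"
  using j_skew[of x y] by (simp add: inner_commute)

lemma j_self [simp]: "x \<bullet> j x = 0" "j x \<bullet> x = 0"
  using j_skew[of x x] by (auto simp: inner_commute)

lemma trace_j:
  fixes G :: "'e \<Rightarrow> 'e \<Rightarrow> 'b::real_vector"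
  assumes G: "bilinear G"
  shows "(\<Sum>b\<in>Basis. G (j b) (j b)) = (\<Sum>b\<in>Basis. G b b)"
proof (rule trace_invariant[OF G])
  fix x
  have "(\<Sum>b\<in>Basis. (x \<bullet> j b) *\<^sub>R j b) = - (\<Sum>b\<in>Basis. (j x \<bullet> b) *\<^sub>R j b)"
    by (simp add: j_skew sum_negf)
  then show "x = (\<Sum>b\<in>Basis. (x \<bullet> j b) *\<^sub>R j b)"
    by (simp add: sum_Basis_contract[OF linear_j] jj)
qed

text \<open>Invariance of the trace under \<open>j\<close>, applied to G(x, j y), together with j j
  = -1.\<close>

lemma trace_j_skew:
  fixes G :: "'e \<Rightarrow> 'e \<Rightarrow> 'b::real_vector"
  assumes G: "bilinear G"
  shows "(\<Sum>b\<in>Basis. G (j b) b) = - (\<Sum>b\<in>Basis. G b (j b))"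
proof -
  have l: "linear (G x)" "linear (\<lambda>x. G x y)" for x y
    using G by (auto simp: bilinear_def)
  have "bilinear (\<lambda>x y. G x (j y))"
    using l linear_compose[OF linear_j l(1)] by (auto simp: bilinear_def o_def)
  from trace_j[OF this] show ?thesis
    by (simp add: jj linear_neg[OF l(1)] sum_negf) (metis minus_equation_iff)
qed

section \<open>The conformal difference tensor and its traces\<close>

text \<open>The part of \<open>S(u; x, z)\<close> (the difference of the two Gauduchon connections, \<open>u = grad f\<close>)
  that is skew in \<open>z\<close>; the remaining part is \<open>\<langle>u, x\<rangle> z\<close>.\<close>

definition cskew :: "'e \<Rightarrow> 'e \<Rightarrow> 'e \<Rightarrow> 'e" where
  "cskew u x z = - (t * (u \<bullet> j x)) *\<^sub>R j z
    + ((1 - t) / 2) *\<^sub>R ((u \<bullet> z) *\<^sub>R x - (x \<bullet> z) *\<^sub>R u - (u \<bullet> j z) *\<^sub>R j x + (x \<bullet> j z) *\<^sub>R j u)"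

lemma cskew_lin1: "linear (\<lambda>u. cskew u x z)"
  by (rule linearI) (simp_all add: cskew_def j_simps inner_simps algebra_simps)

lemma cskew_lin2: "linear (\<lambda>x. cskew u x z)"
  by (rule linearI) (simp_all add: cskew_def j_simps inner_simps algebra_simps)

lemma cskew_lin3: "linear (\<lambda>z. cskew u x z)"
  by (rule linearI) (simp_all add: cskew_def j_simps inner_simps algebra_simps)

lemmas cskew_simps =
  linear_add[OF cskew_lin1] linear_diff[OF cskew_lin1] linear_scale[OF cskew_lin1] linear_neg[OF
      cskew_lin1]
  linear_add[OF cskew_lin2] linear_diff[OF cskew_lin2] linear_scale[OF cskew_lin2] linear_neg[OF
      cskew_lin2]
  linear_add[OF cskew_lin3] linear_diff[OF cskew_lin3] linear_scale[OF cskew_lin3] linear_neg[OF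
      cskew_lin3]

text \<open>The bracket with factor (1 - t)/2 is A - jAj for the skew map A z =
  \<langle>u,z\<rangle> x - \<langle>x,z\<rangle> u, so half of it is the part of A commuting with
  \<open>j\<close>; the other summand is a multiple of \<open>j\<close>. Hence
  \<open>cskew u x\<close> lies in the unitary Lie algebra.\<close>

lemma cskew_skew: "cskew u x y \<bullet> z = - (y \<bullet> cskew u x z)"
  using j_anti[of z u] j_anti[of z y] j_anti[of z x] j_anti[of y x] j_anti[of y u]
  by (simp add: cskew_def inner_simps j_skew inner_commute[of _ z] inner_commute[of _ y])
    (simp add: field_simps)

lemma cskew_self [simp]: "cskew u x y \<bullet> y = 0"
  using cskew_skew[of u x y y] by (simp add: inner_commute)

lemma cskew_j: "cskew u x (j z) = j (cskew u x z)"
  by (simp add: cskew_def j_simps jj algebra_simps j_skew)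

lemma sum_inner_Basis: "(\<Sum>b\<in>(Basis :: 'e set). b \<bullet> b) = 2 * real n"
  by (simp add: dim inner_same_Basis)

text \<open>The bracket sums to (1 - 2n - 1) u, which with (1 - t)/2 gives -n(1 - t); the multiple
  of \<open>j\<close> gives -t. The constant t + n(1 - t) becomes the Laplacian coefficient of the
  second formula.\<close>

lemma sum_cskew_diag: "(\<Sum>b\<in>Basis. cskew u b b) = - (t + real n * (1 - t)) *\<^sub>R u"
proof -
  have 1: "(\<Sum>b\<in>Basis. (u \<bullet> j b) *\<^sub>R j b) = u"
    using sum_Basis_contract[OF linear_j, of "j u"] by (simp add: jj j_skew sum_negf)
  have "(\<Sum>b\<in>Basis. cskew u b b) = - t *\<^sub>R (\<Sum>b\<in>Basis. (u \<bullet> j b) *\<^sub>R j b) +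
      ((1 - t) / 2) *\<^sub>R ((\<Sum>b\<in>Basis. (u \<bullet> b) *\<^sub>R b) - (\<Sum>b\<in>(Basis :: 'e set). b \<bullet> b) *\<^sub>R u
        - (\<Sum>b\<in>Basis. (u \<bullet> j b) *\<^sub>R j b))"
    unfolding scaleR_sum_right scaleR_sum_left sum.distrib[symmetric] sum_subtractf[symmetric]
    by (simp add: cskew_def)
  also have "\<dots> = (- t + (1 - t) / 2 * (1 - 2 * real n - 1)) *\<^sub>R u"
    unfolding 1 sum_inner_Basis euclidean_representation
    by (simp only: scaleR_left_distrib scaleR_left_diff_distrib scaleR_one flip: scaleR_scaleR)
  also have "- t + (1 - t) / 2 * (1 - 2 * real n - 1) = - (t + real n * (1 - t))"
    by (simp add: field_simps)
  finally show ?thesis .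
qed

text \<open>The multiple of \<open>j\<close>, traced over 2n vectors, contributes 2nt; the four
  terms of the bracket contribute equally and give 2(1 - t). This is the origin of the coefficient
  nt - t + 1 of the first formula.\<close>

lemma trace_cskew_j: "(\<Sum>a\<in>Basis. cskew u x (j a) \<bullet> a) = 2 * (real n * t + (1 - t)) * (u \<bullet> j x)"
proof -
  have l: "linear (\<lambda>a. u \<bullet> j a)" "linear (\<lambda>a. x \<bullet> j a)" for u x :: 'e
    by (auto intro!: linearI simp: j_simps inner_simps)
  have S3: "(\<Sum>a\<in>Basis. (j x \<bullet> a) * (u \<bullet> a)) = j x \<bullet> u" for x u
    by (rule euclidean_inner[symmetric])
  have "(\<Sum>a\<in>Basis. cskew u x (j a) \<bullet> a) = t * (u \<bullet> j x) * (\<Sum>a\<in>(Basis :: 'e set). a \<bullet> a)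
     + ((1 - t) / 2) * ((\<Sum>a\<in>Basis. (x \<bullet> a) * (u \<bullet> j a)) - (\<Sum>a\<in>Basis. (u \<bullet> a) * (x \<bullet> j a))
       + (\<Sum>a\<in>Basis. (j x \<bullet> a) * (u \<bullet> a)) - (\<Sum>a\<in>Basis. (j u \<bullet> a) * (x \<bullet> a)))"
    by (simp add: cskew_def jj inner_simps sum.distrib sum_subtractf sum_distrib_left algebra_simps)
  also have "\<dots> = 2 * (real n * t + (1 - t)) * (u \<bullet> j x)"
    unfolding sum_inner_Basis sum_Basis_contract_real[OF l(1)] sum_Basis_contract_real[OF l(2)]
      S3
    by (simp add: j_skew j_anti[of x u] field_simps)
  finally show ?thesis .
qed

text \<open>One of the two quadratic terms of the second trace. Expanding only the first factor and
  summing over \<open>a\<close> contracts it against the single map \<open>cskew u b\<close>, so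
  just the two traces already computed remain.\<close>

lemma sum_cskew_cskew:
  "(\<Sum>a\<in>Basis. \<Sum>b\<in>Basis. cskew u a b \<bullet> cskew u b a) = (t\<^sup>2 + 2 * n * t * (1 - t) + (1 - t)\<^sup>2) * (u
      \<bullet> u)"
proof -
  let ?s = "1 - t"
  have l: "linear (\<lambda>a. w \<bullet> cskew u b a)" for w b
    by (auto intro!: linearI simp: cskew_simps inner_simps)
  have tr: "(\<Sum>a\<in>Basis. j a \<bullet> cskew u b a) = - (2 * (real n * t + ?s) * (u \<bullet> j b))" for b
    using trace_cskew_j[of u b] by (simp only: cskew_skew sum_negf)
  have inner: "(\<Sum>a\<in>Basis. cskew u a b \<bullet> cskew u b a) =
      t * (j b \<bullet> cskew u b (j u)) - ?s / 2 * (u \<bullet> cskew u b b) + ?s / 2 * (j u \<bullet> cskew u b (j b))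
      + ?s * (real n * t + ?s) * (u \<bullet> j b)\<^sup>2" for b
  proof -
    have "(\<Sum>a\<in>Basis. cskew u a b \<bullet> cskew u b a) =
        t * (\<Sum>a\<in>Basis. (j u \<bullet> a) * (j b \<bullet> cskew u b a))
        + ?s / 2 * (u \<bullet> b) * (\<Sum>a\<in>Basis. cskew u b a \<bullet> a) - ?s / 2 * (\<Sum>a\<in>Basis. (b \<bullet> a) * (u \<bullet>
            cskew u b a))
        - ?s / 2 * (u \<bullet> j b) * (\<Sum>a\<in>Basis. j a \<bullet> cskew u b a)
        + ?s / 2 * (\<Sum>a\<in>Basis. (j b \<bullet> a) * (j u \<bullet> cskew u b a))"
      unfolding sum_distrib_left sum.distrib[symmetric] sum_subtractf[symmetric]
    proof (rule sum.cong[OF refl])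
      fix a
      define w where "w = cskew u b a"
      show "cskew u a b \<bullet> cskew u b a = t * ((j u \<bullet> a) * (j b \<bullet> cskew u b a))
        + ?s / 2 * (u \<bullet> b) * (cskew u b a \<bullet> a) - ?s / 2 * ((b \<bullet> a) * (u \<bullet> cskew u b a))
        - ?s / 2 * (u \<bullet> j b) * (j a \<bullet> cskew u b a) + ?s / 2 * ((j b \<bullet> a) * (j u \<bullet> cskew u b a))"
        unfolding w_def[symmetric] cskew_def[of u a b] j_skew[of u a] inner_commute[of b a]
          inner_commute[of "j b" a] inner_commute[of w a]
        by (simp add: inner_simps algebra_simps)
    qed
    then show ?thesis
      by (simp add: sum_Basis_contract_real[OF l] tr power2_eq_square field_simps)
  qed
  have V: "(\<Sum>b\<in>Basis. w \<bullet> cskew u b b) = - (t + n * ?s) * (w \<bullet> u)" for w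
    using arg_cong[OF sum_cskew_diag, of "inner w"] by (simp add: inner_sum_right)
  have *: "j b \<bullet> cskew u b (j u) = - (u \<bullet> cskew u b b)" "j u \<bullet> cskew u b (j b) = u \<bullet> cskew u b b"
      for b
    using cskew_skew[of u b u b] by (simp_all add: cskew_j j_iso inner_commute)
  have sq: "(\<Sum>b\<in>Basis. (u \<bullet> j b)\<^sup>2) = u \<bullet> u"
    using euclidean_inner[of "j u" "j u"] by (simp add: j_skew[of u] power2_eq_square j_iso)
  have "(\<Sum>a\<in>Basis. \<Sum>b\<in>Basis. cskew u a b \<bullet> cskew u b a) = (\<Sum>b\<in>Basis. \<Sum>a\<in>Basis. cskew u a b \<bullet> cskew
      u b a)"
    by (rule sum.swap)
  also have "\<dots> = - t * (\<Sum>b\<in>Basis. u \<bullet> cskew u b b) + ?s * (real n * t + ?s) * (\<Sum>b\<in>Basis. (u \<bullet> j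
      b)\<^sup>2)"
    unfolding inner * sum_distrib_left sum.distrib[symmetric]
    by (rule sum.cong[OF refl]) (simp add: algebra_simps)
  also have "\<dots> = (t\<^sup>2 + 2 * n * t * (1 - t) + (1 - t)\<^sup>2) * (u \<bullet> u)"
    unfolding V sq by (simp add: algebra_simps power2_eq_square)
  finally show ?thesis .
qed

text \<open>\<open>B\<close> stands for D^t - \<nabla>, a difference of metric connections and
  therefore skew. The torsion is B(a,b) - B(b,a), and this is the contribution of its first half.
  The three traces of \<open>B\<close> that survive are later multiples of the Lee form.\<close>

lemma trace_cskew_torsion:
  assumes B: "bilinear B" and skew: "\<And>x y z. B x y \<bullet> z = - (y \<bullet> B x z)"
  shows "(\<Sum>a\<in>Basis. \<Sum>b\<in>Basis. cskew u (B a b) b \<bullet> a) =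
    - t * (j u \<bullet> (\<Sum>b\<in>Basis. B b (j b))) + (1 - t) / 2 * (- (u \<bullet> (\<Sum>b\<in>Basis. B b b))
      + j u \<bullet> (\<Sum>b\<in>Basis. B b (j b)) + (\<Sum>b\<in>Basis. B (j u) b \<bullet> j b))"
proof -
  have l: "linear (B x)" "linear (\<lambda>x. B x y)" for x y
    using B by (auto simp: bilinear_def)
  have B0: "B x y \<bullet> y = 0" for x y
    using skew[of x y y] by (simp add: inner_commute)
  have l1: "linear (\<lambda>a. u \<bullet> j (B a b))" "linear (\<lambda>a. B a c \<bullet> w)" "linear (\<lambda>b. B a b \<bullet> w)" for b a
      w c
    by (auto intro!: linearI simp: linear_add[OF l(1)] linear_scale[OF l(1)] j_simps
      linear_add[OF l(2)] linear_scale[OF l(2)] inner_simps)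
  have bil: "bilinear (\<lambda>x y. u \<bullet> j (B x y))"
    by (auto intro!: linearI simp: bilinear_def linear_add[OF l(1)] linear_scale[OF l(1)] j_simps
      linear_add[OF l(2)] linear_scale[OF l(2)] inner_simps)
  have T1: "(\<Sum>b\<in>Basis. \<Sum>a\<in>Basis. (j b \<bullet> a) * (u \<bullet> j (B a b))) = j u \<bullet> (\<Sum>b\<in>Basis. B b (j b))"
    unfolding sum_Basis_contract_real[OF l1(1)]
    using trace_j_skew[OF bil] by (simp add: j_skew[of u] inner_sum_right sum_negf)
  have T2: "(\<Sum>a\<in>Basis. \<Sum>b\<in>Basis. (u \<bullet> b) * (B a b \<bullet> a)) = - (u \<bullet> (\<Sum>b\<in>Basis. B b b))"
    unfolding sum_Basis_contract_real[OF l1(3)] by (simp add: skew[of _ u] inner_sum_right sum_negf)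
  have T4: "(\<Sum>a\<in>Basis. \<Sum>b\<in>Basis. (j u \<bullet> b) * (B a b \<bullet> j a)) = - (j u \<bullet> (\<Sum>b\<in>Basis. B b (j b)))"
    unfolding sum_Basis_contract_real[OF l1(3)] by (simp add: skew[of _ "j u"] inner_sum_right
        sum_negf)
  have T5: "(\<Sum>b\<in>Basis. \<Sum>a\<in>Basis. (j u \<bullet> a) * (B a b \<bullet> j b)) = (\<Sum>b\<in>Basis. B (j u) b \<bullet> j b)"
    unfolding sum_Basis_contract_real[OF l1(2)] ..
  have "(\<Sum>a\<in>Basis. \<Sum>b\<in>Basis. cskew u (B a b) b \<bullet> a) =
     - t * (\<Sum>a\<in>Basis. \<Sum>b\<in>Basis. (j b \<bullet> a) * (u \<bullet> j (B a b)))
     + (1 - t) / 2 * ((\<Sum>a\<in>Basis. \<Sum>b\<in>Basis. (u \<bullet> b) * (B a b \<bullet> a))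
      - (\<Sum>a\<in>Basis. \<Sum>b\<in>Basis. (j u \<bullet> b) * (B a b \<bullet> j a))
      + (\<Sum>a\<in>Basis. \<Sum>b\<in>Basis. (j u \<bullet> a) * (B a b \<bullet> j b)))"
    unfolding sum_distrib_left sum.distrib[symmetric] sum_subtractf[symmetric]
    by (intro sum.cong refl) (simp add: cskew_def inner_simps B0 j_skew[of u] j_skew[of "B _ _"]
        field_simps)
  also have "(\<Sum>a\<in>Basis. \<Sum>b\<in>Basis. (j b \<bullet> a) * (u \<bullet> j (B a b)))
      = (\<Sum>b\<in>Basis. \<Sum>a\<in>Basis. (j b \<bullet> a) * (u \<bullet> j (B a b)))"
    by (rule sum.swap)
  also have "(\<Sum>a\<in>Basis. \<Sum>b\<in>Basis. (j u \<bullet> a) * (B a b \<bullet> j b))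
      = (\<Sum>b\<in>Basis. \<Sum>a\<in>Basis. (j u \<bullet> a) * (B a b \<bullet> j b))"
    by (rule sum.swap)
  finally show ?thesis
    unfolding T1 T2 T4 T5 by (simp add: algebra_simps)
qed

section \<open>D^t as an algebraic function of the Levi-Civita coefficients\<close>

text \<open>\<open>(\<nabla>\<^sub>x J) y\<close> for \<open>\<nabla> = d + \<Gamma>\<close>, the derivative terms cancelling because \<open>j\<close> is constant.
  Likewise \<open>gaud \<Gamma>\<close> represents \<open>D\<^sup>t\<close>, with \<open>gaud_shift \<Gamma> = D\<^sup>t - \<nabla>\<close>.\<close>

definition nabJ :: "('e \<Rightarrow> 'e \<Rightarrow> 'e) \<Rightarrow> 'e \<Rightarrow> 'e \<Rightarrow> 'e" where
  "nabJ \<Gamma> x y = \<Gamma> x (j y) - j (\<Gamma> x y)"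

definition gaud_shift :: "('e \<Rightarrow> 'e \<Rightarrow> 'e) \<Rightarrow> 'e \<Rightarrow> 'e \<Rightarrow> 'e" where
  "gaud_shift \<Gamma> x y = - (1/2) *\<^sub>R j (nabJ \<Gamma> x y) + (t/4) *\<^sub>R (\<Sum>b\<in>Basis.
     ((nabJ \<Gamma> (j y) b + j (nabJ \<Gamma> y b)) \<bullet> x - (nabJ \<Gamma> (j b) y + j (nabJ \<Gamma> b y)) \<bullet> x) *\<^sub>R b)"

definition gaud :: "('e \<Rightarrow> 'e \<Rightarrow> 'e) \<Rightarrow> 'e \<Rightarrow> 'e \<Rightarrow> 'e" where
  "gaud \<Gamma> x y = \<Gamma> x y + gaud_shift \<Gamma> x y"

lemma bilinear_simps:
  assumes "bilinear (B :: 'e \<Rightarrow> 'e \<Rightarrow> 'e)"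
  shows "B (x + y) z = B x z + B y z" "B (x - y) z = B x z - B y z" "B (c *\<^sub>R x) z = c *\<^sub>R B x z"
    "B (- x) z = - B x z" "B x (y + z) = B x y + B x z" "B x (y - z) = B x y - B x z"
    "B x (c *\<^sub>R y) = c *\<^sub>R B x y" "B x (- y) = - B x y"
  using assms by (auto simp: bilinear_ladd bilinear_lsub bilinear_lmul bilinear_lneg
      bilinear_radd bilinear_rsub bilinear_rmul bilinear_rneg)

lemma bilinearI:
  assumes "\<And>x y z. B (x + y) z = B x z + B y z" "\<And>c x z. B (c *\<^sub>R x) z = c *\<^sub>R B x z"
    "\<And>x y z. B x (y + z) = B x y + B x z" "\<And>c x y. B x (c *\<^sub>R y) = c *\<^sub>R B x y"
  shows "bilinear (B :: 'e \<Rightarrow> 'e \<Rightarrow> 'b::real_vector)"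
  using assms by (auto simp: bilinear_def intro!: linearI)

lemma bilinear_nabJ:
  assumes "bilinear \<Gamma>" shows "bilinear (nabJ \<Gamma>)"
  by (rule bilinearI) (simp_all add: nabJ_def bilinear_simps[OF assms] j_simps algebra_simps)

text \<open>The derivative of J J = -1: \<nabla>J anticommutes with J.\<close>

lemma nabJ_j:
  assumes "bilinear \<Gamma>" shows "nabJ \<Gamma> x (j y) = - j (nabJ \<Gamma> x y)"
  by (simp add: nabJ_def bilinear_simps[OF assms] j_simps jj)

text \<open>The definition of D^t prescribes inner products with every z. Those prescriptions are
  linear in z, so packing their values at basis vectors into one vector recovers them all; every
  later identity about D^t is read off from this form.\<close>

lemma gaud_shift_inner:
  assumes "bilinear \<Gamma>"
  shows "gaud_shift \<Gamma> x y \<bullet> z = - (1/2) * (j (nabJ \<Gamma> x y) \<bullet> z)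
    + t/4 * ((nabJ \<Gamma> (j y) z + j (nabJ \<Gamma> y z)) \<bullet> x - (nabJ \<Gamma> (j z) y + j (nabJ \<Gamma> z y)) \<bullet> x)"
proof -
  have "linear (\<lambda>z. (nabJ \<Gamma> (j y) z + j (nabJ \<Gamma> y z)) \<bullet> x - (nabJ \<Gamma> (j z) y + j (nabJ \<Gamma> z y)) \<bullet> x)"
    by (rule linearI) (simp_all add: bilinear_simps[OF bilinear_nabJ[OF assms]] j_simps
        inner_simps algebra_simps)
  from sum_Basis_contract_real[OF this, of z] show ?thesis
    by (simp add: gaud_shift_def inner_simps inner_sum_left inner_commute[of z] mult.commute)
qed

lemma bilinear_gaud_shift:
  assumes "bilinear \<Gamma>" shows "bilinear (gaud_shift \<Gamma>)"
  by (rule bilinearI; subst euclidean_eq_iff)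
    (simp_all add: gaud_shift_inner[OF assms] bilinear_simps[OF bilinear_nabJ[OF assms]] j_simps
        inner_simps algebra_simps)

lemma bilinear_gaud:
  assumes "bilinear \<Gamma>" shows "bilinear (gaud \<Gamma>)"
  by (rule bilinearI)
    (simp_all add: gaud_def bilinear_simps[OF bilinear_gaud_shift[OF assms]] bilinear_simps[OF
        assms] algebra_simps)

text \<open>The three added terms are the conformal change of the Levi-Civita coefficients, and this
  substitution is where \<open>cskew\<close> comes from. Inner products with \<open>j\<close> are
  first brought to one orientation by \<open>j_anti\<close>, after which the coefficients compare
  directly.\<close>

lemma gaud_conformal:
  assumes \<Gamma>: "bilinear \<Gamma>"
  shows "gaud (\<lambda>x y. \<Gamma> x y + (u \<bullet> x) *\<^sub>R y + (u \<bullet> y) *\<^sub>R x - (x \<bullet> y) *\<^sub>R u) x y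
    = gaud \<Gamma> x y + (u \<bullet> x) *\<^sub>R y + cskew u x y"
proof -
  let ?\<Gamma> = "\<lambda>x y. \<Gamma> x y + (u \<bullet> x) *\<^sub>R y + (u \<bullet> y) *\<^sub>R x - (x \<bullet> y) *\<^sub>R u"
  have bil: "bilinear ?\<Gamma>"
    by (rule bilinearI) (simp_all add: bilinear_simps[OF \<Gamma>] inner_simps algebra_simps)
  \<comment> \<open>The scalar term \<langle>u,x\<rangle> y commutes with \<open>j\<close> and so
    drops out of \<nabla>J.\<close>
  have N: "nabJ ?\<Gamma> x y = nabJ \<Gamma> x y + (u \<bullet> j y) *\<^sub>R x - (x \<bullet> j y) *\<^sub>R u - (u \<bullet> y) *\<^sub>R j x + (x \<bullet>
      y) *\<^sub>R j u" for x y
    by (simp add: nabJ_def j_simps algebra_simps)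
  have "gaud ?\<Gamma> x y \<bullet> z = (gaud \<Gamma> x y + (u \<bullet> x) *\<^sub>R y + cskew u x y) \<bullet> z" for z
    unfolding gaud_def inner_add_left gaud_shift_inner[OF \<Gamma>] gaud_shift_inner[OF bil] N cskew_def
    using j_anti[of z x] j_anti[of z y] j_anti[of z u] j_anti[of y x] j_anti[of y u] j_anti[of x u]
    by (simp add: inner_simps j_simps jj j_iso j_skew inner_commute[of _ z] inner_commute[of y]
        inner_commute[of x u])
      (simp add: field_simps)
  then show ?thesis
    by (auto intro: euclidean_eqI)
qed

text \<open>The Lee form is \<open>\<alpha>\<^sub>F(x) = \<langle>lee_vec \<Gamma>, j x\<rangle>\<close>.\<close>

definition lee_vec :: "('e \<Rightarrow> 'e \<Rightarrow> 'e) \<Rightarrow> 'e" where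
  "lee_vec \<Gamma> = (\<Sum>b\<in>Basis. nabJ \<Gamma> b b)"

context
  fixes \<Gamma> :: "'e \<Rightarrow> 'e \<Rightarrow> 'e"
  assumes \<Gamma>: "bilinear \<Gamma>" and \<Gamma>_skew: "\<And>x y z. \<Gamma> x y \<bullet> z = - (y \<bullet> \<Gamma> x z)"
begin

lemmas nabJ_simps = bilinear_simps[OF bilinear_nabJ[OF \<Gamma>]]
lemma nabJ_skew: "nabJ \<Gamma> x y \<bullet> z = - (y \<bullet> nabJ \<Gamma> x z)"
  by (simp add: nabJ_def inner_simps \<Gamma>_skew[of x "j y"] j_skew \<Gamma>_skew[of x y])

lemma nabJ_skew0: "nabJ \<Gamma> x y \<bullet> y = 0"
  using nabJ_skew[of x y y] by (simp add: inner_commute)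

lemma nabJ_jskew: "j (nabJ \<Gamma> x y) \<bullet> z = - (y \<bullet> j (nabJ \<Gamma> x z))"
  by (simp add: j_skew nabJ_skew nabJ_j[OF \<Gamma>])

text \<open>The t-part is antisymmetric in y and z by construction, and J\<nabla>J is skew because
  \<nabla>J is skew and anticommutes with J. Thus D^t is metric.\<close>

lemma gaud_shift_skew: "gaud_shift \<Gamma> x y \<bullet> z = - (y \<bullet> gaud_shift \<Gamma> x z)"
proof -
  have "j (nabJ \<Gamma> x y) \<bullet> z = - (j (nabJ \<Gamma> x z) \<bullet> y)"
    using nabJ_jskew[of x y z] by (simp add: inner_commute)
  then have "gaud_shift \<Gamma> x y \<bullet> z = - (gaud_shift \<Gamma> x z \<bullet> y)"
    unfolding gaud_shift_inner[OF \<Gamma>] by (simp add: field_simps)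
  then show ?thesis
    by (simp add: inner_commute)
qed

lemma gaud_skew: "gaud \<Gamma> x y \<bullet> z = - (y \<bullet> gaud \<Gamma> x z)"
  by (simp add: gaud_def inner_simps gaud_shift_skew[of x y] \<Gamma>_skew[of x y])

text \<open>The t-part commutes with \<open>j\<close>; the defect comes from -(1/2) J\<nabla>J
  alone. It exactly cancels the failure of \<open>\<Gamma>\<close> to commute with \<open>j\<close>,
  so D^t preserves J.\<close>

lemma gaud_shift_j: "gaud_shift \<Gamma> x (j y) = j (gaud_shift \<Gamma> x y) - nabJ \<Gamma> x y"
proof -
  have "gaud_shift \<Gamma> x (j y) \<bullet> z = (j (gaud_shift \<Gamma> x y) - nabJ \<Gamma> x y) \<bullet> z" for z
    by (simp add: inner_simps j_skew[of "gaud_shift _ _ _"] gaud_shift_inner[OF \<Gamma>] nabJ_j[OF \<Gamma>]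
        nabJ_simps j_simps jj)
      (simp add: j_skew jj field_simps)
  then show ?thesis
    by (auto intro: euclidean_eqI)
qed

lemma gaud_j: "gaud \<Gamma> x (j y) = j (gaud \<Gamma> x y)"
  by (simp add: gaud_def gaud_shift_j nabJ_def j_simps)

lemma lee_vec_j: "(\<Sum>b\<in>Basis. nabJ \<Gamma> b (j b)) = - j (lee_vec \<Gamma>)" "(\<Sum>b\<in>Basis. nabJ \<Gamma> (j b) b) = j
    (lee_vec \<Gamma>)"
proof -
  show "(\<Sum>b\<in>Basis. nabJ \<Gamma> b (j b)) = - j (lee_vec \<Gamma>)"
    by (simp add: nabJ_j[OF \<Gamma>] lee_vec_def j_simps sum_negf)
  then show "(\<Sum>b\<in>Basis. nabJ \<Gamma> (j b) b) = j (lee_vec \<Gamma>)"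
    using trace_j_skew[OF bilinear_nabJ[OF \<Gamma>]] by simp
qed

text \<open>The right side is (1 + t)/2 times the Lee form at x: one half from -(1/2) J\<nabla>J,
  and t/2 from two equal contributions of weight t/4. The other t-terms vanish by skewness.\<close>

lemma gaud_shift_trace: "x \<bullet> (\<Sum>b\<in>Basis. gaud_shift \<Gamma> b b) = (1 + t) / 2 * (lee_vec \<Gamma> \<bullet> j x)"
proof -
  have *: "gaud_shift \<Gamma> b b \<bullet> x = - (1/2) * (j (nabJ \<Gamma> b b) \<bullet> x)
      + t/4 * (- (x \<bullet> nabJ \<Gamma> (j b) b) - x \<bullet> j (nabJ \<Gamma> b b))" for b
    using nabJ_skew[of "j b" x b] nabJ_jskew[of b x b] nabJ_skew0[of "j x" b] nabJ_jskew[of x b b]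
    unfolding gaud_shift_inner[OF \<Gamma>] by (simp add: inner_simps inner_commute)
  have "(\<Sum>b\<in>Basis. gaud_shift \<Gamma> b b) \<bullet> x = - (1/2) * (j (lee_vec \<Gamma>) \<bullet> x) + t/4 * (- (x \<bullet> j
      (lee_vec \<Gamma>)) - x \<bullet> j (lee_vec \<Gamma>))"
    unfolding inner_sum_left * sum.distrib sum_distrib_left[symmetric] sum_subtractf sum_negf
    unfolding inner_sum_right[symmetric] inner_sum_left[symmetric] lee_vec_j
    by (simp add: lee_vec_def j_simps)
  then show ?thesis
    unfolding j_anti[of x "lee_vec \<Gamma>"] j_skew[of "lee_vec \<Gamma>" x] by (simp add: inner_commute[of x
        "sum _ _"] field_simps)
qed

lemma gaud_shift_trace_j: "x \<bullet> (\<Sum>b\<in>Basis. gaud_shift \<Gamma> b (j b)) = - (x \<bullet> lee_vec \<Gamma>) - (1 + t) / 2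
    * (lee_vec \<Gamma> \<bullet> j (j x))"
proof -
  have "(\<Sum>b\<in>Basis. gaud_shift \<Gamma> b (j b)) = j (\<Sum>b\<in>Basis. gaud_shift \<Gamma> b b) - lee_vec \<Gamma>"
    by (simp add: gaud_shift_j sum_subtractf lee_vec_def j_simps)
  then show ?thesis
    using gaud_shift_trace[of "j x"] by (simp add: inner_simps j_skew)
qed

text \<open>The trace against \<open>j\<close> sees only the t-part: -(1/2) J\<nabla>J contributes
  inner products of \<nabla>J b with b, which are zero.\<close>

lemma gaud_shift_trace_jj: "(\<Sum>b\<in>Basis. gaud_shift \<Gamma> x b \<bullet> j b) = t * (lee_vec \<Gamma> \<bullet> x)"
proof -
  have *: "gaud_shift \<Gamma> x b \<bullet> j b = t/4 * (nabJ \<Gamma> (j b) (j b) \<bullet> x + 2 * (nabJ \<Gamma> b b \<bullet> x) - j (nabJ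
      \<Gamma> (j b) b) \<bullet> x)" for b
    using nabJ_skew0[of x b]
    by (simp add: gaud_shift_inner[OF \<Gamma>] inner_simps nabJ_j[OF \<Gamma>] nabJ_simps jj j_simps j_iso
        field_simps)
  have "(\<Sum>b\<in>Basis. gaud_shift \<Gamma> x b \<bullet> j b) = t/4 * (lee_vec \<Gamma> \<bullet> x + 2 * (lee_vec \<Gamma> \<bullet> x) - j (j
      (lee_vec \<Gamma>)) \<bullet> x)"
    unfolding * sum.distrib sum_distrib_left[symmetric] sum_subtractf
    unfolding inner_sum_left[symmetric] trace_j[OF bilinear_nabJ[OF \<Gamma>]] j_simps[symmetric]
        lee_vec_j lee_vec_def[symmetric] ..
  then show ?thesis by (simp add: jj)
qed

end

section \<open>The curvature difference and its two real traces\<close>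

text \<open>Exchanging rows and columns changes the sign of the double sum. This removes the
  quadratic term from the first trace.\<close>

lemma trace_skew_symmetric:
  fixes X Y :: "'e \<Rightarrow> 'e"
  assumes "\<And>y z. X y \<bullet> z = - (y \<bullet> X z)" "\<And>y z. Y y \<bullet> z = y \<bullet> Y z"
  shows "(\<Sum>a\<in>Basis. X a \<bullet> Y a) = 0"
proof -
  have "(\<Sum>a\<in>Basis. X a \<bullet> Y a) = (\<Sum>a\<in>Basis. \<Sum>c\<in>Basis. (X a \<bullet> c) * (Y a \<bullet> c))"
    by (simp add: euclidean_inner[symmetric])
  also have "\<dots> = (\<Sum>c\<in>Basis. \<Sum>a\<in>Basis. - ((X c \<bullet> a) * (Y c \<bullet> a)))"
  proof (subst sum.swap, intro sum.cong refl)
    fix a c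
    show "(X a \<bullet> c) * (Y a \<bullet> c) = - ((X c \<bullet> a) * (Y c \<bullet> a))"
      using assms(1)[of a c] assms(2)[of a c] by (simp add: inner_commute)
  qed
  also have "\<dots> = - (\<Sum>a\<in>Basis. X a \<bullet> Y a)"
    by (simp add: sum_negf euclidean_inner[symmetric])
  finally show ?thesis by simp
qed

definition curv_diff :: "'e \<Rightarrow> ('e \<Rightarrow> 'e) \<Rightarrow> ('e \<Rightarrow> 'e \<Rightarrow> 'e) \<Rightarrow> 'e \<Rightarrow> 'e \<Rightarrow> 'e \<Rightarrow> 'e" where
  "curv_diff u D T x y z =
     cskew (D x) y z - cskew (D y) x z + cskew u (T x y) z + cskew u x (cskew u y z) - cskew u y
         (cskew u x z)"

lemma curv_diff_skew: "curv_diff u D T x y z \<bullet> w = - (z \<bullet> curv_diff u D T x y w)"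
  by (simp add: curv_diff_def inner_simps cskew_skew[of _ _ z] cskew_skew[of _ _ "cskew _ _ _"])

lemma curv_diff_j: "curv_diff u D T x y (j z) = j (curv_diff u D T x y z)"
  by (simp add: curv_diff_def cskew_j j_simps)

text \<open>\<open>cskew\<close> is built from the inner product and \<open>j\<close>, hence
  equivariant under unitary maps; this is the infinitesimal version for \<omega> x in the unitary
  Lie algebra. Geometrically, the D^t-derivative of the difference tensor falls on \<open>u\<close>
  alone.\<close>

lemma gaud_cskew:
  fixes \<omega> :: "'e \<Rightarrow> 'e \<Rightarrow> 'e"
  assumes skew: "\<And>x y z. \<omega> x y \<bullet> z = - (y \<bullet> \<omega> x z)" and com: "\<And>x y. \<omega> x (j y) = j (\<omega> x y)"
    and bil: "bilinear \<omega>"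
  shows "\<omega> x (cskew u y z) = cskew (\<omega> x u) y z + cskew u (\<omega> x y) z + cskew u y (\<omega> x z)"
proof -
  have 1: "\<omega> x a \<bullet> b = - (a \<bullet> \<omega> x b)" "\<omega> x a \<bullet> j b = - (a \<bullet> j (\<omega> x b))" for a b
    using skew[of x a b] skew[of x a "j b"] by (simp_all add: com)
  show ?thesis
    unfolding cskew_def bilinear_simps[OF bil] com
    by (simp add: 1(2)[of u] 1(2)[of y] 1(1)[of u] 1(1)[of y] com algebra_simps)
qed

text \<open>The left side is R' - R at a point for the connection \<omega> + S, with
  \<open>du\<close> the ordinary derivative of the components of u. Equivariance gathers the
  \<omega>-terms into the covariant derivative of u and the torsion; the remainder is a scalar times
  the identity, and \<open>hess\<close> makes that scalar zero.\<close>

lemma curvature_change: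
  fixes \<omega> :: "'e \<Rightarrow> 'e \<Rightarrow> 'e"
  assumes skew: "\<And>x y z. \<omega> x y \<bullet> z = - (y \<bullet> \<omega> x z)" and com: "\<And>x y. \<omega> x (j y) = j (\<omega> x y)"
    and bil: "bilinear \<omega>"
    and S: "\<And>u x z. S u x z = (u \<bullet> x) *\<^sub>R z + cskew u x z"
    and hess: "\<And>x y. du x \<bullet> y - du y \<bullet> x = u \<bullet> \<tau> x y"
  shows "S (du x) y z - S (du y) x z + \<omega> x (S u y z) + S u x (\<omega> y z) + S u x (S u y z)
      - \<omega> y (S u x z) - S u y (\<omega> x z) - S u y (S u x z) - S u (\<tau> x y) z
    = curv_diff u (\<lambda>x. du x + \<omega> x u) (\<lambda>x y. \<omega> x y - \<omega> y x - \<tau> x y) x y z"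
proof -
  have "S (du x) y z - S (du y) x z + \<omega> x (S u y z) + S u x (\<omega> y z) + S u x (S u y z)
      - \<omega> y (S u x z) - S u y (\<omega> x z) - S u y (S u x z) - S u (\<tau> x y) z
    - curv_diff u (\<lambda>x. du x + \<omega> x u) (\<lambda>x y. \<omega> x y - \<omega> y x - \<tau> x y) x y z
    = (du x \<bullet> y - du y \<bullet> x - u \<bullet> \<tau> x y) *\<^sub>R z"
    unfolding S curv_diff_def bilinear_simps[OF bil] gaud_cskew[OF skew com bil] cskew_simps
    by (simp add: algebra_simps)
  then show ?thesis by (simp add: hess)
qed

context
  fixes \<Gamma> :: "'e \<Rightarrow> 'e \<Rightarrow> 'e" and u :: 'e and H D :: "'e \<Rightarrow> 'e" and T :: "'e \<Rightarrow> 'e \<Rightarrow> 'e"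
  assumes \<Gamma>: "bilinear \<Gamma>" and \<Gamma>_skew: "\<And>x y z. \<Gamma> x y \<bullet> z = - (y \<bullet> \<Gamma> x z)"
    and H: "linear H" and D: "D = (\<lambda>x. H x + gaud_shift \<Gamma> x u)" and T: "T = (\<lambda>x y. gaud_shift \<Gamma> x
        y - gaud_shift \<Gamma> y x)"
begin

text \<open>Here \<open>H\<close> is the Levi-Civita Hessian of f as an endomorphism,
  \<open>D\<close> the D^t-derivative of u, and \<open>T\<close> the torsion of D^t, obtained by
  antisymmetrising D^t - \<nabla> because \<nabla> is torsion-free. Skewness moves the correction
  onto u, where it becomes a Lee form term.\<close>

lemma trace_D: "(\<Sum>a\<in>Basis. D a \<bullet> a) = (\<Sum>a\<in>Basis. H a \<bullet> a) - (1 + t) / 2 * (lee_vec \<Gamma> \<bullet> j u)"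
  using gaud_shift_trace[OF \<Gamma> \<Gamma>_skew, of u]
  by (simp add: D inner_simps sum.distrib gaud_shift_skew[OF \<Gamma> \<Gamma>_skew, of _ u] inner_sum_right
      sum_negf sum_subtractf)

text \<open>The Lee form arrives with weight (1 + t)/2 from \<open>trace_D\<close> and (1 - t)/2
  from the torsion. The weights add to 1, which is why \<Delta>f and the Lee term share one
  coefficient. The factor 4 is undone by the 1/4 in \<open>ctrace1\<close>.\<close>

lemma trace1:
  "(\<Sum>a\<in>Basis. \<Sum>b\<in>Basis. curv_diff u D T b (j b) (j a) \<bullet> a) =
    4 * (real n * t - t + 1) * (- (\<Sum>a\<in>Basis. H a \<bullet> a) + lee_vec \<Gamma> \<bullet> j u)"
proof -
  let ?c = "2 * (real n * t + (1 - t))"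
  note bil = bilinear_gaud_shift[OF \<Gamma>]
  \<comment> \<open>Both maps are skew and commute with \<open>j\<close>, so \<open>j\<close> times
    the second is symmetric and each quadratic term is traceless by itself.\<close>
  have com: "(\<Sum>a\<in>Basis. cskew u x (cskew u y (j a)) \<bullet> a) = 0" for x y
  proof -
    have "(\<Sum>a\<in>Basis. cskew u x a \<bullet> j (cskew u y a)) = 0"
      by (rule trace_skew_symmetric) (auto simp: cskew_skew cskew_j j_skew[of "cskew _ _ _"])
    then show ?thesis
      by (simp add: cskew_skew cskew_j sum_negf inner_commute)
  qed
  have inner: "(\<Sum>a\<in>Basis. curv_diff u D T b (j b) (j a) \<bullet> a) =
      - ?c * (D b \<bullet> b) - ?c * (D (j b) \<bullet> j b) + ?c * (u \<bullet> j (gaud_shift \<Gamma> b (j b))) - ?c * (u \<bullet> j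
          (gaud_shift \<Gamma> (j b) b))" for b
    unfolding curv_diff_def inner_add_left inner_diff_left sum.distrib sum_subtractf trace_cskew_j
        com
    by (simp add: T jj j_simps inner_simps algebra_simps)
  have l: "linear D"
    unfolding D by (rule linearI)
      (simp_all add: linear_add[OF H] linear_scale[OF H] bilinear_simps[OF bil] algebra_simps)
  have bD: "bilinear (\<lambda>x y. D x \<bullet> y)"
    by (rule bilinearI) (simp_all add: linear_add[OF l] linear_scale[OF l] inner_simps)
  have bB: "bilinear (\<lambda>x y. u \<bullet> j (gaud_shift \<Gamma> x y))"
    by (rule bilinearI) (simp_all add: bilinear_simps[OF bil] j_simps inner_simps)
  have P: "(\<Sum>b\<in>Basis. u \<bullet> j (gaud_shift \<Gamma> b (j b))) = (1 - t) / 2 * (lee_vec \<Gamma> \<bullet> j u)"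
  proof -
    have "(\<Sum>b\<in>Basis. u \<bullet> j (gaud_shift \<Gamma> b (j b))) = - (j u \<bullet> (\<Sum>b\<in>Basis. gaud_shift \<Gamma> b (j b)))"
      by (simp add: inner_sum_right sum_negf j_skew[of u])
    also have "\<dots> = (1 - t) / 2 * (lee_vec \<Gamma> \<bullet> j u)"
      unfolding gaud_shift_trace_j[OF \<Gamma> \<Gamma>_skew]
      by (simp add: jj j_simps inner_simps inner_commute[of "j u" "lee_vec \<Gamma>"] field_simps)
    finally show ?thesis .
  qed
  have "(\<Sum>a\<in>Basis. \<Sum>b\<in>Basis. curv_diff u D T b (j b) (j a) \<bullet> a)
    = (\<Sum>b\<in>Basis. \<Sum>a\<in>Basis. curv_diff u D T b (j b) (j a) \<bullet> a)"
    by (rule sum.swap)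
  also have "\<dots> = - ?c * (\<Sum>b\<in>Basis. D b \<bullet> b) - ?c * (\<Sum>b\<in>Basis. D (j b) \<bullet> j b)
    + ?c * (\<Sum>b\<in>Basis. u \<bullet> j (gaud_shift \<Gamma> b (j b))) - ?c * (\<Sum>b\<in>Basis. u \<bullet> j (gaud_shift \<Gamma> (j b) b))"
    unfolding inner sum.distrib sum_subtractf sum_distrib_left ..
  also have "\<dots> = 4 * (real n * t - t + 1) * (- (\<Sum>a\<in>Basis. H a \<bullet> a) + lee_vec \<Gamma> \<bullet> j u)"
    unfolding trace_j[OF bD] trace_j_skew[OF bB] P trace_D by (simp add: field_simps)
  finally show ?thesis .
qed

text \<open>With v = t + n(1 - t) the quadratic part is t^2 + 2nt(1 - t) + (1 - t)^2 - v^2 = (1 -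
  t)^2 (1 - n^2). The Lee form gets (1 + t) v from \<open>trace_D\<close> and 2(1 - t)(t - 1/2) from
  the torsion, together 2v - (n + 1)(1 - t)^2.\<close>

lemma trace2:
  "(\<Sum>a\<in>Basis. \<Sum>b\<in>Basis. curv_diff u D T a b b \<bullet> a) = 2 * (
    (real n * (1 - t) + t) * (- (\<Sum>a\<in>Basis. H a \<bullet> a)) + (1 - t)\<^sup>2 * (1 - (real n)\<^sup>2) / 2 * (u \<bullet> u)
    + (real n * (1 - t) + t - (real n + 1) * (1 - t)\<^sup>2 / 2) * (lee_vec \<Gamma> \<bullet> j u))"
proof -
  let ?v = "t + real n * (1 - t)" and ?k = "lee_vec \<Gamma> \<bullet> j u"
  note bil = bilinear_gaud_shift[OF \<Gamma>] and skew = gaud_shift_skew[OF \<Gamma> \<Gamma>_skew]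
  have V: "(\<Sum>b\<in>Basis. w \<bullet> cskew u' b b) = - ?v * (w \<bullet> u')" for w u'
    using arg_cong[OF sum_cskew_diag, of "inner w"] by (simp add: inner_sum_right)
  have 1: "(\<Sum>a\<in>Basis. \<Sum>b\<in>Basis. a \<bullet> cskew (D a) b b) = - ?v * (\<Sum>a\<in>Basis. D a \<bullet> a)"
    unfolding V sum_distrib_left[symmetric] by (simp add: inner_commute)
  have 2: "(\<Sum>a\<in>Basis. \<Sum>b\<in>Basis. b \<bullet> cskew (D b) a a) = - ?v * (\<Sum>a\<in>Basis. D a \<bullet> a)"
    by (subst sum.swap) (rule 1)
  \<comment> \<open>The traces left by \<open>trace_cskew_torsion\<close> are -(1 - t)/2, (1 + t)/2
    and t times \<open>?k\<close>.\<close>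
  have 3: "(\<Sum>a\<in>Basis. \<Sum>b\<in>Basis. cskew u (gaud_shift \<Gamma> a b) b \<bullet> a) = (1 - t) * (t - 1 / 2) * ?k"
    unfolding trace_cskew_torsion[OF bil skew] gaud_shift_trace_j[OF \<Gamma> \<Gamma>_skew] gaud_shift_trace[OF
        \<Gamma> \<Gamma>_skew]
      gaud_shift_trace_jj[OF \<Gamma> \<Gamma>_skew]
    using inner_commute[of "j u" "lee_vec \<Gamma>"] by (simp add: jj j_simps field_simps)
  have 4: "(\<Sum>a\<in>Basis. \<Sum>b\<in>Basis. b \<bullet> cskew u (gaud_shift \<Gamma> b a) a) = (1 - t) * (t - 1 / 2) * ?k"
    by (subst sum.swap) (simp add: 3 inner_commute[of _ "cskew _ _ _"])
  have 5: "(\<Sum>a\<in>Basis. \<Sum>b\<in>Basis. cskew u b b \<bullet> cskew u a a) = ?v\<^sup>2 * (u \<bullet> u)"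
  proof -
    have "(\<Sum>a\<in>Basis. \<Sum>b\<in>Basis. cskew u b b \<bullet> cskew u a a) = (\<Sum>b\<in>Basis. cskew u b b) \<bullet> (\<Sum>a\<in>Basis.
        cskew u a a)"
      unfolding inner_sum_left inner_sum_right ..
    then show ?thesis
      by (simp add: sum_cskew_diag power2_eq_square algebra_simps)
  qed
  have "(\<Sum>a\<in>Basis. \<Sum>b\<in>Basis. curv_diff u D T a b b \<bullet> a) =
     (\<Sum>a\<in>Basis. \<Sum>b\<in>Basis. a \<bullet> cskew (D a) b b) + (\<Sum>a\<in>Basis. \<Sum>b\<in>Basis. b \<bullet> cskew (D b) a a)
     + (\<Sum>a\<in>Basis. \<Sum>b\<in>Basis. cskew u (gaud_shift \<Gamma> a b) b \<bullet> a)
     + (\<Sum>a\<in>Basis. \<Sum>b\<in>Basis. b \<bullet> cskew u (gaud_shift \<Gamma> b a) a)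
     - (\<Sum>a\<in>Basis. \<Sum>b\<in>Basis. cskew u b b \<bullet> cskew u a a)
     + (\<Sum>a\<in>Basis. \<Sum>b\<in>Basis. cskew u a b \<bullet> cskew u b a)"
    unfolding sum.distrib[symmetric] sum_subtractf[symmetric]
  proof (intro sum.cong refl)
    fix a b
    show "curv_diff u D T a b b \<bullet> a = a \<bullet> cskew (D a) b b + b \<bullet> cskew (D b) a a + cskew u
        (gaud_shift \<Gamma> a b) b \<bullet> a
      + b \<bullet> cskew u (gaud_shift \<Gamma> b a) a - cskew u b b \<bullet> cskew u a a + cskew u a b \<bullet> cskew u b a"
      unfolding curv_diff_def T inner_add_left inner_diff_left cskew_simps inner_commute[of a]
        cskew_skew[of "D b" a b a] cskew_skew[of u a "cskew u b b" a] cskew_skew[of u b "cskew u a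
            b" a]
        cskew_skew[of u "gaud_shift \<Gamma> b a" b a]
      by simp
  qed
  also have "\<dots> = 2 * (
    (real n * (1 - t) + t) * (- (\<Sum>a\<in>Basis. H a \<bullet> a)) + (1 - t)\<^sup>2 * (1 - (real n)\<^sup>2) / 2 * (u \<bullet> u)
    + (real n * (1 - t) + t - (real n + 1) * (1 - t)\<^sup>2 / 2) * ?k)"
    unfolding 1 2 3 4 5 sum_cskew_cskew trace_D by (simp add: field_simps power2_eq_square)
  finally show ?thesis .
qed

end

section \<open>Frame-independent form of the complex contractions\<close>

text \<open>The two contractions of \<open>K(W,Z,X,Y)\<close> that define the scalar curvatures, rewritten with
  \<open>\<Sum>\<^sub>i u\<^sub>i \<otimes> conj u\<^sub>i = 1/2 \<Sum>\<^sub>a (e\<^sub>a \<otimes> e\<^sub>a + \<i> e\<^sub>a \<otimes> J e\<^sub>a)\<close>, \<open>a\<close> running over all \<open>2n\<close> indices;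
  in this form independence of the frame is evident.\<close>

definition ctrace1 :: "('e \<Rightarrow> 'e \<Rightarrow> 'e \<Rightarrow> 'e \<Rightarrow> complex) \<Rightarrow> complex" where
  "ctrace1 K = 1/4 * (\<Sum>a\<in>Basis. \<Sum>b\<in>Basis. (K a a b b + \<i> * K a a b (j b)) - \<i> * (K a (j a) b b + \<i>
      * K a (j a) b (j b)))"

definition ctrace2 :: "('e \<Rightarrow> 'e \<Rightarrow> 'e \<Rightarrow> 'e \<Rightarrow> complex) \<Rightarrow> complex" where
  "ctrace2 K = 1/4 * (\<Sum>a\<in>Basis. \<Sum>b\<in>Basis. (K a b a b + \<i> * K a b a (j b)) - \<i> * (K a b (j a) b + \<i>
      * K a b (j a) (j b)))"

lemma ctrace1_add: "ctrace1 (\<lambda>w z x y. K w z x y + L w z x y) = ctrace1 K + ctrace1 L"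
  by (simp add: ctrace1_def sum.distrib algebra_simps sum_subtractf)

lemma ctrace2_add: "ctrace2 (\<lambda>w z x y. K w z x y + L w z x y) = ctrace2 K + ctrace2 L"
  by (simp add: ctrace2_def sum.distrib algebra_simps sum_subtractf)

definition uvec :: "(nat \<Rightarrow> 'e) \<Rightarrow> nat \<Rightarrow> 'e \<times> 'e" where
  "uvec U i = ((1 / sqrt 2) *\<^sub>R U i, - ((1 / sqrt 2) *\<^sub>R U (n + i)))"

definition uvec_bar :: "(nat \<Rightarrow> 'e) \<Rightarrow> nat \<Rightarrow> 'e \<times> 'e" where
  "uvec_bar U i = ((1 / sqrt 2) *\<^sub>R U i, (1 / sqrt 2) *\<^sub>R U (n + i))"

text \<open>The vectors \<open>U i\<close> are an orthonormal basis for \<open>\<mu>\<close> times the Euclidean metric; for the frame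
  of \<open>exp(2f) h\<close> this is used with \<open>\<mu> = exp(2 f p)\<close>.\<close>

context
  fixes U :: "nat \<Rightarrow> 'e" and \<mu> :: real
  assumes \<mu>: "\<mu> > 0" and U: "\<And>x. x = (\<Sum>i<2 * n. (\<mu> * (x \<bullet> U i)) *\<^sub>R U i)"
    and jU: "\<And>i. i < n \<Longrightarrow> U (n + i) = j (U i)"
begin

lemma trace_U:
  fixes G :: "'e \<Rightarrow> 'e \<Rightarrow> complex"
  assumes "bilinear G"
  shows "(\<Sum>b\<in>Basis. G b b) = \<mu> * (\<Sum>i<n. G (U i) (U i) + G (j (U i)) (j (U i)))"
proof -
  have G: "G (c *\<^sub>R x) (c *\<^sub>R y) = c * c * G x y" for c x y
    using assms by (simp add: bilinear_lmul bilinear_rmul scaleR_conv_of_real)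
  have "(\<Sum>b\<in>Basis. G b b) = (\<Sum>i<2 * n. G (sqrt \<mu> *\<^sub>R U i) (sqrt \<mu> *\<^sub>R U i))"
  proof (rule trace_invariant[OF assms, symmetric])
    fix x
    have "(\<Sum>i<2 * n. (x \<bullet> sqrt \<mu> *\<^sub>R U i) *\<^sub>R sqrt \<mu> *\<^sub>R U i) = (\<Sum>i<2 * n. (\<mu> * (x \<bullet> U i)) *\<^sub>R U i)"
      using \<mu> by (intro sum.cong refl) (simp add: mult.assoc[symmetric] mult.commute)
    then show "x = (\<Sum>i<2 * n. (x \<bullet> sqrt \<mu> *\<^sub>R U i) *\<^sub>R sqrt \<mu> *\<^sub>R U i)"
      using U[of x] by simp
  qed
  also have "\<dots> = \<mu> * (\<Sum>i<2 * n. G (U i) (U i))"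
    using \<mu> by (simp add: G sum_distrib_left flip: of_real_mult)
  finally show ?thesis
    using sum_lessThan_add[of "\<lambda>i. G (U i) (U i)" n n] by (simp add: mult_2 jU sum.distrib)
qed

text \<open>Multiplying out one conjugate pair leaves half the trace of G(x, y) plus or minus \<i>
  G(x, j y), with plus when the conjugate vector is in the second slot. The result no longer
  mentions the frame.\<close>

lemma pair_trace:
  fixes G :: "'e \<Rightarrow> 'e \<Rightarrow> complex"
  assumes G: "bilinear G"
  shows "\<mu> * (\<Sum>i<n. cext (\<lambda>x. cext (\<lambda>y. G x y) (uvec_bar U i)) (uvec U i)) = 1/2 * (\<Sum>b\<in>Basis. G b
      b + \<i> * G b (j b))" (is ?A)
    and "\<mu> * (\<Sum>i<n. cext (\<lambda>x. cext (\<lambda>y. G x y) (uvec U i)) (uvec_bar U i)) = 1/2 * (\<Sum>b\<in>Basis. G b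
        b - \<i> * G b (j b))" (is ?B)
proof -
  have G': "bilinear (\<lambda>x y. G x (j y))"
    using G by (auto intro!: bilinearI simp: j_simps bilinear_ladd bilinear_radd bilinear_lmul
        bilinear_rmul)
  note s = bilinear_ladd[OF G] bilinear_radd[OF G] bilinear_lmul[OF G] bilinear_rmul[OF G]
    bilinear_lneg[OF G] bilinear_rneg[OF G]
  define s2 where "s2 = complex_of_real (1 / sqrt 2)"
  have h: "s2 * (s2 * c) = c / 2" "s2 * - (s2 * c) = - c / 2" for c
    unfolding s2_def by (simp_all flip: of_real_mult mult.assoc)
  have 1: "cext (\<lambda>x. cext (\<lambda>y. G x y) (uvec_bar U i)) (uvec U i) = 1/2 * ((G (U i) (U i) + G (j (U
      i)) (j (U i)))
      + \<i> * (G (U i) (j (U i)) - G (j (U i)) (U i)))" if "i < n" for i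
    unfolding cext_def uvec_def uvec_bar_def jU[OF that] fst_conv snd_conv s scaleR_conv_of_real
        s2_def[symmetric]
    by (simp add: h algebra_simps add_divide_distrib diff_divide_distrib)
  have 2: "cext (\<lambda>x. cext (\<lambda>y. G x y) (uvec U i)) (uvec_bar U i) = 1/2 * ((G (U i) (U i) + G (j (U
      i)) (j (U i)))
      - \<i> * (G (U i) (j (U i)) - G (j (U i)) (U i)))" if "i < n" for i
    unfolding cext_def uvec_def uvec_bar_def jU[OF that] fst_conv snd_conv s scaleR_conv_of_real
        s2_def[symmetric]
    by (simp add: h algebra_simps add_divide_distrib diff_divide_distrib)
  have t: "(\<Sum>b\<in>Basis. G b (j b)) = \<mu> * (\<Sum>i<n. G (U i) (j (U i)) - G (j (U i)) (U i))"
    using trace_U[OF G'] by (simp add: jj s)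
  show ?A ?B
    unfolding sum.distrib sum_subtractf sum_distrib_left[symmetric] t trace_U[OF G]
    by (simp_all add: 1 2 sum.distrib sum_subtractf sum_distrib_left[symmetric]
        sum_divide_distrib[symmetric]
        algebra_simps)
qed

context
  fixes K :: "'e \<Rightarrow> 'e \<Rightarrow> 'e \<Rightarrow> 'e \<Rightarrow> complex"
  assumes l: "linear (\<lambda>w. K w z x y)" "linear (\<lambda>z. K w z x y)" "linear (\<lambda>x. K w z x y)" "linear
      (\<lambda>y. K w z x y)"
begin

lemmas K_simps = l[THEN linear_add] l[THEN linear_scale]

text \<open>Two successive pair contractions, each absorbing one factor \<mu>: the pair (x, y)
  inside, then (w, z), where the conjugate vector is in the first slot and the sign is
  reversed.\<close>

lemma sum_curv1:
  "\<mu>\<^sup>2 * (\<Sum>i<n. \<Sum>k<n. cext (\<lambda>w. cext (\<lambda>z. cext (\<lambda>x. cext (\<lambda>y. K w z x y) (uvec_bar U k)) (uvec U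
      k)) (uvec U i)) (uvec_bar U i)) = ctrace1 K"
proof -
  define M where "M = (\<lambda>w z. \<Sum>b\<in>Basis. K w z b b + \<i> * K w z b (j b))"
  have M: "bilinear M"
    unfolding M_def by (rule bilinearI)
      (simp_all add: K_simps sum.distrib sum_distrib_left scaleR_sum_right algebra_simps
          scaleR_conv_of_real)
  have b: "bilinear (K w z)" for w z
    by (rule bilinearI) (simp_all add: K_simps)
  have "\<mu>\<^sup>2 * (\<Sum>i<n. \<Sum>k<n. cext (\<lambda>w. cext (\<lambda>z. cext (\<lambda>x. cext (\<lambda>y. K w z x y) (uvec_bar U k))
      (uvec U k)) (uvec U i)) (uvec_bar U i))
    = \<mu> * (\<Sum>i<n. cext (\<lambda>w. cext (\<lambda>z. \<mu> * (\<Sum>k<n. cext (\<lambda>x. cext (\<lambda>y. K w z x y) (uvec_bar U k))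
        (uvec U k))) (uvec U i)) (uvec_bar U i))"
    by (simp add: cext_cmult cext_sum power2_eq_square sum_distrib_left mult_ac)
  also have "\<dots> = \<mu> * (\<Sum>i<n. cext (\<lambda>w. cext (\<lambda>z. 1/2 * M w z) (uvec U i)) (uvec_bar U i))"
    unfolding pair_trace(1)[OF b] M_def ..
  also have "\<dots> = 1/2 * (\<mu> * (\<Sum>i<n. cext (\<lambda>w. cext (\<lambda>z. M w z) (uvec U i)) (uvec_bar U i)))"
    unfolding cext_cmult by (simp add: sum_distrib_left)
  also have "\<dots> = ctrace1 K"
    unfolding pair_trace(2)[OF M] by (simp add: ctrace1_def M_def sum_subtractf sum_distrib_left)
  finally show ?thesis .
qed

text \<open>The conjugate pairs are now (z, y) and (w, x), so the two middle slots are exchanged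
  before contracting.\<close>

lemma sum_curv2:
  "\<mu>\<^sup>2 * (\<Sum>i<n. \<Sum>k<n. cext (\<lambda>w. cext (\<lambda>z. cext (\<lambda>x. cext (\<lambda>y. K w z x y) (uvec_bar U k)) (uvec U
      i)) (uvec U k)) (uvec_bar U i)) = ctrace2 K"
proof -
  define M where "M = (\<lambda>w x. \<Sum>b\<in>Basis. K w b x b + \<i> * K w b x (j b))"
  have M: "bilinear M"
    unfolding M_def by (rule bilinearI)
      (simp_all add: K_simps sum.distrib sum_distrib_left scaleR_sum_right algebra_simps
          scaleR_conv_of_real)
  have b: "bilinear (\<lambda>z y. K w z x y)" for w x
    by (rule bilinearI) (simp_all add: K_simps)
  have "\<mu>\<^sup>2 * (\<Sum>i<n. \<Sum>k<n. cext (\<lambda>w. cext (\<lambda>z. cext (\<lambda>x. cext (\<lambda>y. K w z x y) (uvec_bar U k))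
      (uvec U i)) (uvec U k)) (uvec_bar U i))
    = \<mu>\<^sup>2 * (\<Sum>i<n. \<Sum>k<n. cext (\<lambda>w. cext (\<lambda>x. cext (\<lambda>z. cext (\<lambda>y. K w z x y) (uvec_bar U k)) (uvec
        U k)) (uvec U i)) (uvec_bar U i))"
    by (subst cext_swap) (rule refl)
  also have "\<dots>
    = \<mu> * (\<Sum>i<n. cext (\<lambda>w. cext (\<lambda>x. \<mu> * (\<Sum>k<n. cext (\<lambda>z. cext (\<lambda>y. K w z x y) (uvec_bar U k))
        (uvec U k))) (uvec U i)) (uvec_bar U i))"
    by (simp add: cext_cmult cext_sum power2_eq_square sum_distrib_left mult_ac)
  also have "\<dots> = \<mu> * (\<Sum>i<n. cext (\<lambda>w. cext (\<lambda>x. 1/2 * M w x) (uvec U i)) (uvec_bar U i))"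
    unfolding pair_trace(1)[OF b] M_def ..
  also have "\<dots> = 1/2 * (\<mu> * (\<Sum>i<n. cext (\<lambda>w. cext (\<lambda>x. M w x) (uvec U i)) (uvec_bar U i)))"
    unfolding cext_cmult by (simp add: sum_distrib_left)
  also have "\<dots> = ctrace2 K"
    unfolding pair_trace(2)[OF M] by (simp add: ctrace2_def M_def sum_subtractf sum_distrib_left)
  finally show ?thesis .
qed

end
end

text \<open>In the first contraction skewness kills the terms with w = z and alternation those with
  x = y, leaving the product of the two terms with \<i>, of real weight 1/4. In the second the two
  real terms agree, giving 2/4, and the imaginary ones cancel.\<close>

lemma inv_skew:
  fixes R :: "'e \<Rightarrow> 'e \<Rightarrow> 'e \<Rightarrow> 'e"
  assumes l: "\<And>y z. linear (\<lambda>x. R x y z)" "\<And>x z. linear (\<lambda>y. R x y z)" "\<And>x y. linear (\<lambda>z. R x y z)"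
    and skew: "\<And>x y z w. R x y z \<bullet> w = - (z \<bullet> R x y w)" and com: "\<And>x y z. R x y (j z) = j (R x y z)"
    and alt: "\<And>x y z. R x y z = - R y x z"
  shows "ctrace1 (\<lambda>w z x y. complex_of_real (R x y z \<bullet> w)) =
      of_real (1/4 * (\<Sum>a\<in>Basis. \<Sum>b\<in>Basis. R b (j b) (j a) \<bullet> a))"
    and "ctrace2 (\<lambda>w z x y. complex_of_real (R x y z \<bullet> w)) =
      of_real (1/2 * (\<Sum>a\<in>Basis. \<Sum>b\<in>Basis. R a b b \<bullet> a))"
proof -
  have R0: "R x y z \<bullet> z = 0" for x y z
    using skew[of x y z z] by (simp add: inner_commute)
  have R1: "R x x z = 0" for x z
  proof -
    have "R x x z + R x x z = 0"
      using alt[of x x z] by (metis add.right_inverse)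
    then show ?thesis by (simp flip: scaleR_2)
  qed
  show "ctrace1 (\<lambda>w z x y. complex_of_real (R x y z \<bullet> w)) =
      of_real (1/4 * (\<Sum>a\<in>Basis. \<Sum>b\<in>Basis. R b (j b) (j a) \<bullet> a))"
    by (simp add: ctrace1_def R0 R1 algebra_simps)
  have b1: "bilinear (\<lambda>a' a. R a' (j b) b \<bullet> a)" for b
    by (rule bilinearI) (simp_all add: l[THEN linear_add] l[THEN linear_scale] inner_simps)
  have b2: "bilinear (\<lambda>b' b. R a b' (j b) \<bullet> j a)" for a
    by (rule bilinearI) (simp_all add: l[THEN linear_add] l[THEN linear_scale] inner_simps j_simps)
  \<comment> \<open>The sum over \<open>a\<close> moves one \<open>j\<close> to the other slot; in
    the sum over \<open>b\<close> the second \<open>j\<close> passes through \<open>R\<close> and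
    cancels the first by isometry. The two sign changes compensate.\<close>
  have re: "(\<Sum>a\<in>Basis. \<Sum>b\<in>Basis. R (j a) (j b) b \<bullet> a) = (\<Sum>a\<in>Basis. \<Sum>b\<in>Basis. R a b b \<bullet> a)"
  proof -
    have "(\<Sum>a\<in>Basis. \<Sum>b\<in>Basis. R (j a) (j b) b \<bullet> a) = (\<Sum>b\<in>Basis. \<Sum>a\<in>Basis. R (j a) (j b) b \<bullet> a)"
      by (rule sum.swap)
    also have "\<dots> = - (\<Sum>b\<in>Basis. \<Sum>a\<in>Basis. R a (j b) b \<bullet> j a)"
      by (simp add: trace_j_skew[OF b1] sum_negf)
    also have "\<dots> = - (\<Sum>a\<in>Basis. \<Sum>b\<in>Basis. R a (j b) b \<bullet> j a)"
      by (subst sum.swap) (rule refl)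
    also have "\<dots> = (\<Sum>a\<in>Basis. \<Sum>b\<in>Basis. R a b b \<bullet> a)"
    proof -
      have "(\<Sum>b\<in>Basis. R a (j b) b \<bullet> j a) = - (\<Sum>b\<in>Basis. R a b b \<bullet> a)" for a
      proof -
        have b3: "bilinear (\<lambda>b' b. R a b' b \<bullet> j a)"
          by (rule bilinearI) (simp_all add: l[THEN linear_add] l[THEN linear_scale] inner_simps)
        show ?thesis
          using trace_j_skew[OF b3] by (simp add: com j_iso)
      qed
      then show ?thesis by (simp add: sum_negf)
    qed
    finally show ?thesis .
  qed
  \<comment> \<open>Alternation and skewness together exchange the roles of \<open>a\<close> and
    \<open>b\<close>.\<close>
  have im: "(\<Sum>a\<in>Basis. \<Sum>b\<in>Basis. R (j a) b b \<bullet> a) = (\<Sum>a\<in>Basis. \<Sum>b\<in>Basis. R a (j b) b \<bullet> a)"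
  proof -
    have "R (j a) b b \<bullet> a = R b (j a) a \<bullet> b" for a b
      using alt[of "j a" b b] skew[of b "j a" b a] by (simp add: inner_commute)
    then have "(\<Sum>a\<in>Basis. \<Sum>b\<in>Basis. R (j a) b b \<bullet> a) = (\<Sum>a\<in>Basis. \<Sum>b\<in>Basis. R b (j a) a \<bullet> b)"
      by simp
    also have "\<dots> = (\<Sum>a\<in>Basis. \<Sum>b\<in>Basis. R a (j b) b \<bullet> a)"
      by (rule sum.swap)
    finally show ?thesis .
  qed
  have "ctrace2 (\<lambda>w z x y. complex_of_real (R x y z \<bullet> w)) =
    1/4 * (of_real (\<Sum>a\<in>Basis. \<Sum>b\<in>Basis. R a b b \<bullet> a) + \<i> * of_real (\<Sum>a\<in>Basis. \<Sum>b\<in>Basis. R a (j b)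
        b \<bullet> a)
      - \<i> * of_real (\<Sum>a\<in>Basis. \<Sum>b\<in>Basis. R (j a) b b \<bullet> a) + of_real (\<Sum>a\<in>Basis. \<Sum>b\<in>Basis. R (j a)
          (j b) b \<bullet> a))"
    by (simp add: ctrace2_def sum.distrib sum_subtractf sum_distrib_left algebra_simps)
  then show "ctrace2 (\<lambda>w z x y. complex_of_real (R x y z \<bullet> w)) =
      of_real (1/2 * (\<Sum>a\<in>Basis. \<Sum>b\<in>Basis. R a b b \<bullet> a))"
    unfolding re im by simp
qed

end

section \<open>Derivations and smooth vector fields\<close>

locale smooth_manifold =
  fixes A :: "('m::{t2_space,second_countable_topology}, 'e::euclidean_space) atlas"
  assumes A: "smooth_atlas A"
begin

section \<open>Smooth functions in charts\<close>

lemma atlas_open_image: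
  assumes "(U, \<phi>) \<in> A" "open W"
  shows "open (\<phi> ` (U \<inter> W))"
proof -
  from A assms have h: "open U" "open (\<phi> ` U)" "homeomorphism U (\<phi> ` U) \<phi> (inv_into U \<phi>)"
    unfolding smooth_atlas_def by auto
  then have "openin (top_of_set (\<phi> ` U)) (\<phi> ` (U \<inter> W))"
    using homeomorphism_imp_open_map[OF h(3)] \<open>open W\<close> by (simp add: openin_open_Int)
  with h(2) show ?thesis
    using openin_open_trans by blast
qed

lemma inv_into_image_in:
  assumes "(U, \<phi>) \<in> A" "x \<in> \<phi> ` (U \<inter> W)"
  shows "inv_into U \<phi> x \<in> W"
proof -
  have "homeomorphism U (\<phi> ` U) \<phi> (inv_into U \<phi>)"
    using A assms unfolding smooth_atlas_def by auto
  with assms show ?thesis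
    by (auto simp: homeomorphism_def)
qed

lemma smooth_atD:
  assumes "smooth_at A p g"
  obtains W where "open W" "p \<in> W"
    "\<forall>U \<phi> m. (U, \<phi>) \<in> A \<longrightarrow> Ck_on m (g \<circ> inv_into U \<phi>) (\<phi> ` (U \<inter> W))"
  using assms unfolding smooth_at_def smooth_on_def by fast

lemma smooth_atI:
  assumes "open W" "p \<in> W"
    "\<And>U \<phi> m. (U, \<phi>) \<in> A \<Longrightarrow> Ck_on m (g \<circ> inv_into U \<phi>) (\<phi> ` (U \<inter> W))"
  shows "smooth_at A p g"
  using assms unfolding smooth_at_def smooth_on_def by fast

lemma smooth_at_nbhd:
  assumes "smooth_at A p g"
  obtains W where "open W" "p \<in> W" "\<And>q. q \<in> W \<Longrightarrow> smooth_at A q g"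
  using assms unfolding smooth_at_def by blast

lemma smooth_at_cong:
  assumes "smooth_at A p g" "open V" "p \<in> V" "\<And>q. q \<in> V \<Longrightarrow> g q = k q"
  shows "smooth_at A p k"
proof -
  from assms(1) obtain W where W: "open W" "p \<in> W"
    "\<forall>U \<phi> m. (U, \<phi>) \<in> A \<longrightarrow> Ck_on m (g \<circ> inv_into U \<phi>) (\<phi> ` (U \<inter> W))"
    by (rule smooth_atD)
  show ?thesis
  proof (rule smooth_atI)
    show "open (W \<inter> V)" "p \<in> W \<inter> V"
      using W assms by auto
    fix U \<phi> m assume U: "(U, \<phi>) \<in> A"
    show "Ck_on m (k \<circ> inv_into U \<phi>) (\<phi> ` (U \<inter> (W \<inter> V)))"
    proof (rule Ck_on_cong)
      show "open (\<phi> ` (U \<inter> (W \<inter> V)))"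
        using atlas_open_image[OF U] W assms by blast
      show "Ck_on m (g \<circ> inv_into U \<phi>) (\<phi> ` (U \<inter> (W \<inter> V)))"
        using W(3)[rule_format, OF U] by (rule Ck_on_subset) auto
      fix x assume "x \<in> \<phi> ` (U \<inter> (W \<inter> V))"
      then have "inv_into U \<phi> x \<in> W \<inter> V"
        by (rule inv_into_image_in[OF U])
      then show "(g \<circ> inv_into U \<phi>) x = (k \<circ> inv_into U \<phi>) x"
        using assms by simp
    qed
  qed
qed

lemma smooth_at_const: "smooth_at A p (\<lambda>q. c)"
  by (rule smooth_atI[of UNIV]) (auto simp: o_def Ck_on_const)

text \<open>One scheme for all pointwise operations: intersect the two neighbourhoods and argue
  chart by chart. A function of one variable is treated as a binary operation constant in its second
  argument.\<close>

lemma smooth_at_binop: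
  assumes "smooth_at A p g" "smooth_at A p k"
    and op: "\<And>S m a b. open S \<Longrightarrow> Ck_on m a S \<Longrightarrow> Ck_on m b S \<Longrightarrow> Ck_on m (\<lambda>x. F (a x) (b x)) (S::'e set)"
  shows "smooth_at A p (\<lambda>q. F (g q) (k q))"
proof -
  from assms(1) obtain W where W: "open W" "p \<in> W"
    "\<forall>U \<phi> m. (U, \<phi>) \<in> A \<longrightarrow> Ck_on m (g \<circ> inv_into U \<phi>) (\<phi> ` (U \<inter> W))"
    by (rule smooth_atD)
  from assms(2) obtain V where V: "open V" "p \<in> V"
    "\<forall>U \<phi> m. (U, \<phi>) \<in> A \<longrightarrow> Ck_on m (k \<circ> inv_into U \<phi>) (\<phi> ` (U \<inter> V))"
    by (rule smooth_atD)
  show ?thesis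
  proof (rule smooth_atI)
    show "open (W \<inter> V)" "p \<in> W \<inter> V"
      using W V by auto
    fix U \<phi> m assume U: "(U, \<phi>) \<in> A"
    have "open (\<phi> ` (U \<inter> (W \<inter> V)))"
      using atlas_open_image[OF U] W V by blast
    moreover have "Ck_on m (g \<circ> inv_into U \<phi>) (\<phi> ` (U \<inter> (W \<inter> V)))"
      using W(3)[rule_format, OF U] by (rule Ck_on_subset) auto
    moreover have "Ck_on m (k \<circ> inv_into U \<phi>) (\<phi> ` (U \<inter> (W \<inter> V)))"
      using V(3)[rule_format, OF U] by (rule Ck_on_subset) auto
    ultimately show "Ck_on m ((\<lambda>q. F (g q) (k q)) \<circ> inv_into U \<phi>) (\<phi> ` (U \<inter> (W \<inter> V)))"
      unfolding o_def by (rule op)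
  qed
qed

lemma smooth_at_add: "smooth_at A p g \<Longrightarrow> smooth_at A p k \<Longrightarrow> smooth_at A p (\<lambda>q. g q + k q)"
  by (rule smooth_at_binop[where F = "(+)"]) (assumption, assumption, rule Ck_on_add)

lemma smooth_at_mult: "smooth_at A p g \<Longrightarrow> smooth_at A p k \<Longrightarrow> smooth_at A p (\<lambda>q. g q * k q)"
  by (rule smooth_at_binop[where F = "(*)"]) (assumption, assumption, rule Ck_on_mult)

lemma smooth_at_sum:
  "(\<And>i. i \<in> I \<Longrightarrow> smooth_at A p (g i)) \<Longrightarrow> smooth_at A p (\<lambda>q. \<Sum>i\<in>I. g i q)"
  by (induction I rule: infinite_finite_induct) (simp_all add: smooth_at_const smooth_at_add)

lemma smooth_at_compose_real:
  assumes F: "\<And>i y. (F i has_real_derivative F (Suc i) y) (at y)" and "smooth_at A p g"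
  shows "smooth_at A p (\<lambda>q. F i (g q))"
  by (rule smooth_at_binop[OF assms(2,2), where F = "\<lambda>a b. F i a"])
    (rule Ck_on_compose_real[of _ F], assumption, rule F)

section \<open>Tangent vectors as derivations\<close>

lemma tangent_lincomb:
  assumes "v \<in> tangent_space A p" "smooth_at A p g" "smooth_at A p k"
  shows "v (\<lambda>q. a * g q + b * k q) = a * v g + b * v k"
  using assms unfolding tangent_space_def by blast

lemma tangent_mult:
  assumes "v \<in> tangent_space A p" "smooth_at A p g" "smooth_at A p k"
  shows "v (\<lambda>q. g q * k q) = v g * k p + g p * v k"
  using assms unfolding tangent_space_def by blast

lemma tangent_not_smooth: "v \<in> tangent_space A p \<Longrightarrow> \<not> smooth_at A p g \<Longrightarrow> v g = 0"
  unfolding tangent_space_def by blast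

lemma tangent_add:
  assumes "v \<in> tangent_space A p" "smooth_at A p g" "smooth_at A p k"
  shows "v (\<lambda>q. g q + k q) = v g + v k"
  using tangent_lincomb[OF assms, of 1 1] by simp

lemma tangent_const: 
  assumes "v \<in> tangent_space A p" shows "v (\<lambda>q. c) = 0"
proof -
  have "v (\<lambda>q. 1 * 1) = v (\<lambda>q. 1) * 1 + 1 * v (\<lambda>q. 1)"
    by (rule tangent_mult[OF assms smooth_at_const smooth_at_const])
  then have "v (\<lambda>q. 1) = 0" by simp
  then show ?thesis
    using tangent_lincomb[OF assms smooth_at_const[of p 1] smooth_at_const[of p 1], of c 0] by simp
qed

lemma tangent_cmult:
  assumes "v \<in> tangent_space A p" "smooth_at A p g"
  shows "v (\<lambda>q. c * g q) = c * v g"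
  using tangent_lincomb[OF assms assms(2), of c 0] by simp

lemma tangent_sum:
  assumes "v \<in> tangent_space A p" "\<And>i. i \<in> I \<Longrightarrow> smooth_at A p (g i)"
  shows "v (\<lambda>q. \<Sum>i\<in>I. g i q) = (\<Sum>i\<in>I. v (g i))"
  using assms(2)
proof (induction I rule: infinite_finite_induct)
  case (insert i I)
  then show ?case
    using tangent_add[OF assms(1), of "g i" "\<lambda>q. \<Sum>i\<in>I. g i q"] by (simp add: smooth_at_sum)
qed (auto simp: tangent_const[OF assms(1)])

lemma smooth_at_indicator:
  assumes "open W" "p \<in> W" 
  shows "smooth_at A p (indicator W)"
  by (rule smooth_at_cong[OF smooth_at_const[of p 1] assms]) auto

lemma tangent_indicator:
  assumes "v \<in> tangent_space A p" "open W" "p \<in> W" 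
  shows "v (indicator W) = 0"
proof -
  have "v (\<lambda>q. indicator W q * indicator W q) = v (indicator W) + v (indicator W)"
    using tangent_mult[OF assms(1) smooth_at_indicator smooth_at_indicator] assms by simp
  moreover have "(\<lambda>q. indicator W q * indicator W q) = (indicator W :: 'm \<Rightarrow> real)"
    by (auto simp: indicator_def)
  ultimately show ?thesis by simp
qed

text \<open>Multiplication by the indicator of \<open>W\<close> makes the two functions literally
  equal without changing the value of v. Where one is not smooth neither is the other, and both
  values are the default 0.\<close>

lemma tangent_cong:
  assumes "v \<in> tangent_space A p" "open W" "p \<in> W" "\<And>q. q \<in> W \<Longrightarrow> g q = k q"
  shows "v g = v k"
proof (cases "smooth_at A p g")
  case True
  then have k: "smooth_at A p k"
    using smooth_at_cong assms by blast
  have "v (\<lambda>q. indicator W q * g q) = v g" "v (\<lambda>q. indicator W q * k q) = v k"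
    using tangent_mult[OF assms(1) smooth_at_indicator[OF assms(2,3)]] True k
      tangent_indicator[OF assms(1-3)] assms(3) by auto
  moreover have "(\<lambda>q. indicator W q * g q) = (\<lambda>q. indicator W q * k q)"
    using assms(4) by (auto simp: indicator_def)
  ultimately show ?thesis by simp
next
  case False
  then have "\<not> smooth_at A p k"
    using smooth_at_cong[of p k W g] assms by auto
  with False show ?thesis
    using assms(1) tangent_not_smooth by metis
qed

lemma tangent_lincombI:
  assumes "v \<in> tangent_space A p" "w \<in> tangent_space A p"
  shows "(\<lambda>g. a * v g + b * w g) \<in> tangent_space A p"
  unfolding tangent_space_def
proof (intro CollectI conjI allI impI)
  fix g k a' b' assume s: "smooth_at A p g" "smooth_at A p k"
  show "a * v (\<lambda>q. a' * g q + b' * k q) + b * w (\<lambda>q. a' * g q + b' * k q)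
    = a' * (a * v g + b * w g) + b' * (a * v k + b * w k)"
    by (simp add: tangent_lincomb[OF assms(1) s] tangent_lincomb[OF assms(2) s] algebra_simps)
  show "a * v (\<lambda>q. g q * k q) + b * w (\<lambda>q. g q * k q)
    = (a * v g + b * w g) * k p + g p * (a * v k + b * w k)"
    by (simp add: tangent_mult[OF assms(1) s] tangent_mult[OF assms(2) s] algebra_simps)
next
  fix g assume "\<not> smooth_at A p g"
  then show "a * v g + b * w g = 0"
    by (simp add: assms[THEN tangent_not_smooth])
qed

lemma tangent_zero: "(\<lambda>g. 0) \<in> tangent_space A p"
  unfolding tangent_space_def by simp

lemma tangent_sumI:
  assumes "\<And>i. i \<in> I \<Longrightarrow> v i \<in> tangent_space A p"
  shows "(\<lambda>g. \<Sum>i\<in>I. c i * v i g) \<in> tangent_space A p"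
  using assms
proof (induction I rule: infinite_finite_induct)
  case (insert i I)
  then show ?case
    using tangent_lincombI[of "v i" p "\<lambda>g. \<Sum>i\<in>I. c i * v i g" "c i" 1] by simp
qed (auto simp: tangent_zero)

lemma smooth_at_exp: "smooth_at A p g \<Longrightarrow> smooth_at A p (\<lambda>q. exp (g q))"
  by (rule smooth_at_compose_real[of "\<lambda>i. exp"]) (rule DERIV_exp)

text \<open>Abstract derivations know no chain rule; it follows from the factorisation
  \<open>exp y = 1 + y + y\<^sup>2 r(y)\<close> with smooth \<open>r\<close>, applied to \<open>y = g - g p\<close>.\<close>

lemma tangent_exp:
  assumes v: "v \<in> tangent_space A p" and g: "smooth_at A p g"
  shows "v (\<lambda>q. exp (g q)) = exp (g p) * v g"
proof -
  obtain F :: "nat \<Rightarrow> real \<Rightarrow> real"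
    where F: "\<forall>i y. (F i has_real_derivative F (Suc i) y) (at y)"
      and exp: "\<forall>y. exp y = 1 + y + y * y * F 0 y"
    by (rule exp_remainder)
  define k where "k = (\<lambda>q. g q + (- g p))"
  have k: "smooth_at A p k" "k p = 0" "v k = v g"
    unfolding k_def using smooth_at_add[OF g smooth_at_const[of p "- g p"]]
      tangent_add[OF v g smooth_at_const[of p "- g p"]] tangent_const[OF v] by simp_all
  define r where "r = (\<lambda>q. k q * F 0 (k q))"
  have r: "smooth_at A p r"
    unfolding r_def by (rule smooth_at_mult[OF k(1) smooth_at_compose_real]) (use F k in auto)
  have "(\<lambda>q. exp (g q)) = (\<lambda>q. exp (g p) * (k q + k q * r q) + exp (g p))"
  proof
    fix q
    have "exp (g q) = exp (g p) * exp (k q)"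
      by (simp add: k_def flip: exp_add)
    then show "exp (g q) = exp (g p) * (k q + k q * r q) + exp (g p)"
      using exp[rule_format, of "k q"] by (simp add: r_def algebra_simps)
  qed
  moreover have "v (\<lambda>q. exp (g p) * (k q + k q * r q) + exp (g p)) = exp (g p) * v g"
    using k(2,3) by (simp add: tangent_add[OF v] tangent_cmult[OF v] tangent_mult[OF v]
        tangent_const[OF v] k(1) r smooth_at_add smooth_at_mult smooth_at_const) (simp add: r_def)
  ultimately show ?thesis by simp
qed

section \<open>Germs and locally defined vector fields\<close>

lemma smooth_at_local: "eventually (\<lambda>q. g q = k q) (nhds p) \<Longrightarrow> smooth_at A p g \<Longrightarrow> smooth_at A p k"
  unfolding eventually_nhds using smooth_at_cong by blast

lemma tangent_local:
  "v \<in> tangent_space A p \<Longrightarrow> eventually (\<lambda>q. g q = k q) (nhds p) \<Longrightarrow> v g = v k"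
  unfolding eventually_nhds using tangent_cong by blast

lemma smooth_at_eventually: "smooth_at A p g \<Longrightarrow> eventually (\<lambda>q. smooth_at A q g) (nhds p)"
  unfolding eventually_nhds using smooth_at_nbhd by metis

lemma vfield_at_iff:
  "vfield_at A p X \<longleftrightarrow> eventually (\<lambda>q. X q \<in> tangent_space A q \<and>
     (\<forall>g. smooth_at A q g \<longrightarrow> smooth_at A q (\<lambda>r. X r g))) (nhds p)"
  unfolding vfield_at_def eventually_nhds by blast

lemma vfield_at_tangent: "vfield_at A p X \<Longrightarrow> X p \<in> tangent_space A p"
  unfolding vfield_at_def by blast

lemma vfield_at_smooth: "vfield_at A p X \<Longrightarrow> smooth_at A p g \<Longrightarrow> smooth_at A p (\<lambda>r. X r g)"
  unfolding vfield_at_def by blast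

lemma vfield_at_eventually: "vfield_at A p X \<Longrightarrow> eventually (\<lambda>q. vfield_at A q X) (nhds p)"
  unfolding vfield_at_iff by (subst eventually_eventually)

lemma eventually_nhds_double:
  "eventually P (nhds p) \<Longrightarrow> eventually (\<lambda>q. eventually P (nhds q)) (nhds p)"
  by (subst eventually_eventually)

lemma vfield_at_local:
  assumes "eventually (\<lambda>q. X q = Y q) (nhds p)" "vfield_at A p X"
  shows "vfield_at A p Y"
proof -
  from assms(2) have "eventually (\<lambda>q. X q \<in> tangent_space A q \<and>
     (\<forall>g. smooth_at A q g \<longrightarrow> smooth_at A q (\<lambda>r. X r g))) (nhds p)"
    by (simp add: vfield_at_iff)
  then show ?thesis
    \<comment> \<open>Smoothness of r \<mapsto> Y r g at a nearby q requires agreement of X and Y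
      around q, not just at q, so the hypothesis is also used in its doubled form.\<close>
    unfolding vfield_at_iff using assms(1) eventually_nhds_double[OF assms(1)]
  proof eventually_elim
    case (elim q)
    have "smooth_at A q (\<lambda>r. Y r g)" if "smooth_at A q g" for g
      by (rule smooth_at_local[of "\<lambda>r. X r g"]) (use elim that in \<open>auto elim: eventually_mono\<close>)
    with elim show ?case by auto
  qed
qed

lemma vfield_at_sum:
  assumes "finite I" "\<And>i. i \<in> I \<Longrightarrow> vfield_at A p (X i)" "\<And>i. i \<in> I \<Longrightarrow> smooth_at A p (k i)"
  shows "vfield_at A p (\<lambda>q g. \<Sum>i\<in>I. k i q * X i q g)"
proof -
  have "eventually (\<lambda>q. \<forall>i\<in>I. vfield_at A q (X i)) (nhds p)"
    "eventually (\<lambda>q. \<forall>i\<in>I. smooth_at A q (k i)) (nhds p)"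
    using assms by (auto intro!: eventually_ball_finite vfield_at_eventually smooth_at_eventually)
  then have "eventually (\<lambda>q. (\<lambda>g. \<Sum>i\<in>I. k i q * X i q g) \<in> tangent_space A q \<and>
     (\<forall>g. smooth_at A q g \<longrightarrow> smooth_at A q (\<lambda>r. \<Sum>i\<in>I. k i r * X i r g))) (nhds p)"
  proof eventually_elim
    case (elim q)
    then show ?case
      by (intro conjI allI impI tangent_sumI smooth_at_sum smooth_at_mult)
        (simp_all add: vfield_at_tangent vfield_at_smooth)
  qed
  then show ?thesis
    by (simp add: vfield_at_iff)
qed

lemma vfield_at_cmult: "vfield_at A p X \<Longrightarrow> vfield_at A p (\<lambda>q g. c * X q g)"
  using vfield_at_sum[of "{()}" p "\<lambda>_. X" "\<lambda>_ _. c"] by (simp add: smooth_at_const)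

section \<open>Derivatives of vector-valued functions\<close>

definition smooth_vec :: "'m \<Rightarrow> ('m \<Rightarrow> 'v::euclidean_space) \<Rightarrow> bool" where
  "smooth_vec p k \<longleftrightarrow> (\<forall>b\<in>Basis. smooth_at A p (\<lambda>q. k q \<bullet> b))"

definition dvec :: "'m tangent \<Rightarrow> ('m \<Rightarrow> 'v::euclidean_space) \<Rightarrow> 'v" where
  "dvec v k = (\<Sum>b\<in>Basis. v (\<lambda>q. k q \<bullet> b) *\<^sub>R b)"

lemma smooth_vec_inner:
  assumes "smooth_vec p k" shows "smooth_at A p (\<lambda>q. k q \<bullet> x)"
proof -
  have "smooth_at A p (\<lambda>q. \<Sum>b\<in>Basis. (k q \<bullet> b) * (x \<bullet> b))"
    using assms by (intro smooth_at_sum smooth_at_mult smooth_at_const) (auto simp: smooth_vec_def)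
  then show ?thesis by (simp add: euclidean_inner[symmetric])
qed

lemma csmI: "(\<And>b. b \<in> Basis \<Longrightarrow> smooth_at A p (\<lambda>q. k q \<bullet> b)) \<Longrightarrow> smooth_vec p k"
  by (simp add: smooth_vec_def)

lemma smooth_vec_local:
  fixes k :: "'m \<Rightarrow> 'v::euclidean_space"
  assumes "eventually (\<lambda>q. k q = l q) (nhds p)" "smooth_vec p k"
  shows "smooth_vec p l"
proof (rule csmI)
  fix b :: 'v assume "b \<in> Basis"
  show "smooth_at A p (\<lambda>q. l q \<bullet> b)"
    by (rule smooth_at_local[of "\<lambda>q. k q \<bullet> b"]) (use assms \<open>b \<in> Basis\<close> in \<open>auto simp:
        smooth_vec_def elim: eventually_mono\<close>)
qed

lemma smooth_vec_const: "smooth_vec p (\<lambda>q. c)"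
  by (simp add: smooth_vec_def smooth_at_const)

lemma smooth_vec_add: "smooth_vec p k \<Longrightarrow> smooth_vec p l \<Longrightarrow> smooth_vec p (\<lambda>q. k q + l q)"
  by (simp add: smooth_vec_def inner_add_left smooth_at_add)

lemma smooth_vec_scaleR: "smooth_at A p g \<Longrightarrow> smooth_vec p k \<Longrightarrow> smooth_vec p (\<lambda>q. g q *\<^sub>R k q)"
  by (simp add: smooth_vec_def smooth_at_mult)

lemma smooth_vec_sum: "(\<And>i. i \<in> I \<Longrightarrow> smooth_vec p (k i)) \<Longrightarrow> smooth_vec p (\<lambda>q. \<Sum>i\<in>I. k i q)"
  by (simp add: smooth_vec_def inner_sum_left smooth_at_sum)

lemma smooth_vec_linear:
  assumes "linear L" "smooth_vec p k" shows "smooth_vec p (\<lambda>q. L (k q))"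
proof -
  have "smooth_vec p (\<lambda>q. \<Sum>b\<in>Basis. (k q \<bullet> b) *\<^sub>R L b)"
    using assms by (intro smooth_vec_sum smooth_vec_scaleR smooth_vec_const) (auto simp:
        smooth_vec_def)
  then show ?thesis by (simp add: sum_Basis_contract[OF assms(1)])
qed

lemma smooth_vec_diff: "smooth_vec p k \<Longrightarrow> smooth_vec p l \<Longrightarrow> smooth_vec p (\<lambda>q. k q - l q)"
  using smooth_vec_add[of p k "\<lambda>q. (- 1) *\<^sub>R l q"] smooth_vec_scaleR[OF smooth_at_const, of p l "-
      1"] by simp

context
  fixes p v assumes v: "v \<in> tangent_space A p"
begin

text \<open>Characterises \<open>dvec\<close> by pairing with arbitrary x, so the rules below follow
  from those of v without returning to components.\<close>

lemma dvec_inner: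
  assumes "smooth_vec p k" shows "dvec v k \<bullet> x = v (\<lambda>q. k q \<bullet> x)"
proof -
  have "v (\<lambda>q. \<Sum>b\<in>Basis. (x \<bullet> b) * (k q \<bullet> b)) = (\<Sum>b\<in>Basis. (x \<bullet> b) * v (\<lambda>q. k q \<bullet> b))"
    using assms
    by (subst tangent_sum[OF v]) (auto simp: smooth_vec_def tangent_cmult[OF v] intro!:
        smooth_at_mult smooth_at_const)
  moreover have "(\<lambda>q. \<Sum>b\<in>Basis. (x \<bullet> b) * (k q \<bullet> b)) = (\<lambda>q. k q \<bullet> x)"
    by (rule ext, subst euclidean_inner[symmetric], rule inner_commute)
  moreover have "dvec v k \<bullet> x = (\<Sum>b\<in>Basis. (x \<bullet> b) * v (\<lambda>q. k q \<bullet> b))"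
    by (simp add: dvec_def inner_sum_left inner_commute[of x] mult.commute)
  ultimately show ?thesis by simp
qed

lemma dvec_eqI:
  assumes "smooth_vec p k" "\<And>x. v (\<lambda>q. k q \<bullet> x) = y \<bullet> x" shows "dvec v k = y"
  by (rule euclidean_eqI) (simp add: assms dvec_inner)

lemma dvec_const: "dvec v (\<lambda>q. c) = 0"
  by (simp add: dvec_def tangent_const[OF v])

lemma dvec_local: "eventually (\<lambda>q. k q = l q) (nhds p) \<Longrightarrow> dvec v k = dvec v l"
  unfolding dvec_def by (intro sum.cong refl arg_cong2[of _ _ _ _ scaleR] tangent_local[OF v])
    (auto elim: eventually_mono)

lemma dvec_add: "smooth_vec p k \<Longrightarrow> smooth_vec p l \<Longrightarrow> dvec v (\<lambda>q. k q + l q) = dvec v k + dvec v l"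
  by (rule dvec_eqI) (simp_all add: smooth_vec_add smooth_vec_inner inner_add_left tangent_add[OF
      v] dvec_inner)

lemma dvec_scaleR:
  "smooth_at A p g \<Longrightarrow> smooth_vec p k \<Longrightarrow> dvec v (\<lambda>q. g q *\<^sub>R k q) = v g *\<^sub>R k p + g p *\<^sub>R dvec v k"
  by (rule dvec_eqI) (simp_all add: smooth_vec_scaleR smooth_vec_inner inner_add_left
      tangent_mult[OF v] dvec_inner)

lemma dvec_sum:
  "(\<And>i. i \<in> I \<Longrightarrow> smooth_vec p (k i)) \<Longrightarrow> dvec v (\<lambda>q. \<Sum>i\<in>I. k i q) = (\<Sum>i\<in>I. dvec v (k i))"
  by (rule dvec_eqI) (simp_all add: smooth_vec_sum smooth_vec_inner inner_sum_left tangent_sum[OF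
      v] dvec_inner)

lemma dvec_linear:
  assumes "linear L" "smooth_vec p k" shows "dvec v (\<lambda>q. L (k q)) = L (dvec v k)"
proof -
  have k: "smooth_at A p (\<lambda>q. k q \<bullet> b)" for b
    using assms smooth_vec_inner by blast
  have "dvec v (\<lambda>q. \<Sum>b\<in>Basis. (k q \<bullet> b) *\<^sub>R L b) = (\<Sum>b\<in>Basis. (dvec v k \<bullet> b) *\<^sub>R L b)"
    by (simp add: dvec_sum smooth_vec_scaleR smooth_vec_const k dvec_scaleR dvec_const
        dvec_inner[OF assms(2)])
  then show ?thesis by (simp add: sum_Basis_contract[OF assms(1)])
qed

end

lemma bilinear_expand:
  fixes B :: "'v::euclidean_space \<Rightarrow> 'v \<Rightarrow> 'v"
  assumes "bilinear B"
  shows "B x y = (\<Sum>b\<in>Basis. \<Sum>c\<in>Basis. (x \<bullet> b) *\<^sub>R (y \<bullet> c) *\<^sub>R B b c)"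
proof -
  have l: "linear (B x)" "linear (\<lambda>x. B x y)" for x y
    using assms by (auto simp: bilinear_def)
  have "(\<Sum>b\<in>Basis. \<Sum>c\<in>Basis. (x \<bullet> b) *\<^sub>R (y \<bullet> c) *\<^sub>R B b c) = (\<Sum>b\<in>Basis. (x \<bullet> b) *\<^sub>R B b y)"
    by (simp only: scaleR_sum_right[symmetric] sum_Basis_contract[OF l(1)])
  then show ?thesis
    by (simp only: sum_Basis_contract[OF l(2)])
qed

lemma smooth_vec_bilinear:
  fixes B :: "'m \<Rightarrow> 'v::euclidean_space \<Rightarrow> 'v \<Rightarrow> 'v"
  assumes bil: "eventually (\<lambda>q. bilinear (B q)) (nhds p)" and B: "\<And>x y. smooth_vec p (\<lambda>q. B q x y)"
    and k: "smooth_vec p k" and l: "smooth_vec p l"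
  shows "smooth_vec p (\<lambda>q. B q (k q) (l q))"
proof (rule smooth_vec_local)
  show "eventually (\<lambda>q. (\<Sum>b\<in>Basis. \<Sum>c\<in>Basis. (k q \<bullet> b) *\<^sub>R (l q \<bullet> c) *\<^sub>R B q b c) = B q (k q) (l
      q)) (nhds p)"
    using bil by eventually_elim (rule bilinear_expand[symmetric])
  show "smooth_vec p (\<lambda>q. \<Sum>b\<in>Basis. \<Sum>c\<in>Basis. (k q \<bullet> b) *\<^sub>R (l q \<bullet> c) *\<^sub>R B q b c)"
    by (intro smooth_vec_sum smooth_vec_scaleR B smooth_vec_inner k l)
qed

text \<open>Product rule for a field of bilinear maps applied to two moving vectors. The first
  summand freezes the vectors at p; in the curvature it becomes the derivative of the connection
  coefficients.\<close>

lemma dvec_bilinear: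
  fixes B :: "'m \<Rightarrow> 'v::euclidean_space \<Rightarrow> 'v \<Rightarrow> 'v"
  assumes v: "v \<in> tangent_space A p"
    and bil: "eventually (\<lambda>q. bilinear (B q)) (nhds p)" and B: "\<And>x y. smooth_vec p (\<lambda>q. B q x y)"
    and k: "smooth_vec p k" and l: "smooth_vec p l"
  shows "dvec v (\<lambda>q. B q (k q) (l q)) =
    dvec v (\<lambda>q. B q (k p) (l p)) + B p (dvec v k) (l p) + B p (k p) (dvec v l)"
proof -
  \<comment> \<open>Stated for arbitrary vectors because it is used twice, for the moving ones and
    for the constants they take at p.\<close>
  have e: "dvec v (\<lambda>q. B q (k q) (l q)) = (\<Sum>b\<in>Basis. \<Sum>c\<in>Basis.
      v (\<lambda>q. k q \<bullet> b) *\<^sub>R (l p \<bullet> c) *\<^sub>R B p b c + (k p \<bullet> b) *\<^sub>R v (\<lambda>q. l q \<bullet> c) *\<^sub>R B p b c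
      + (k p \<bullet> b) *\<^sub>R (l p \<bullet> c) *\<^sub>R dvec v (\<lambda>q. B q b c))"
    if k: "smooth_vec p k" and l: "smooth_vec p l" for k l
  proof -
    have "dvec v (\<lambda>q. B q (k q) (l q)) =
        dvec v (\<lambda>q. \<Sum>b\<in>Basis. \<Sum>c\<in>Basis. (k q \<bullet> b) *\<^sub>R (l q \<bullet> c) *\<^sub>R B q b c)"
      by (rule dvec_local[OF v]) (rule eventually_mono[OF bil], rule bilinear_expand)
    also have "\<dots> = (\<Sum>b\<in>Basis. \<Sum>c\<in>Basis. dvec v (\<lambda>q. (k q \<bullet> b) *\<^sub>R (l q \<bullet> c) *\<^sub>R B q b c))"
      by (subst dvec_sum[OF v], intro smooth_vec_sum smooth_vec_scaleR B smooth_vec_inner k l)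
        (intro sum.cong refl dvec_sum[OF v] smooth_vec_scaleR B smooth_vec_inner k l)
    finally show ?thesis
      by (simp only: dvec_scaleR[OF v smooth_vec_inner[OF k] smooth_vec_scaleR[OF
          smooth_vec_inner[OF l] B]]
          dvec_scaleR[OF v smooth_vec_inner[OF l] B] scaleR_right_distrib add_ac)
  qed
  have p: "bilinear (B p)"
    using bil by (rule eventually_nhds_x_imp_x)
  show ?thesis
    unfolding e[OF k l] e[OF smooth_vec_const[of p "k p"] smooth_vec_const[of p "l p"]]
        bilinear_expand[OF p, of "dvec v k"]
      bilinear_expand[OF p, of "k p" "dvec v l"]
    by (simp add: dvec_inner[OF v k] dvec_inner[OF v l] tangent_const[OF v] sum.distrib add_ac)
qed

end

section \<open>Connections in a local unitary frame\<close>

text \<open>Indexing the frame by the basis vectors of \<open>'e\<close> makes the components of a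
  tangent vector an element of \<open>'e\<close> itself. Orthonormality refers to \<open>h\<close>;
  the metric exp(2f) h is always expressed through this same frame.\<close>

locale adapted_frame = smooth_manifold A + hermitian_space j n t
  for A :: "('m::{t2_space,second_countable_topology}, 'e::euclidean_space) atlas"
    and j :: "'e \<Rightarrow> 'e" and n :: nat and t :: real +
  fixes J :: "'m endo" and h :: "'m metric" and F :: "'e \<Rightarrow> 'm vfield" and W :: "'m set"
  assumes almost_complex: "almost_complex_structure A J" and riemannian: "riemannian_metric A h"
    and open_W: "open W"
    and F_vfield: "q \<in> W \<Longrightarrow> b \<in> Basis \<Longrightarrow> vfield_at A q (F b)"
    and F_orthonormal: "q \<in> W \<Longrightarrow> b \<in> Basis \<Longrightarrow> c \<in> Basis \<Longrightarrow> h q (F b q) (F c q) = (if b = c then 1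
        else 0)"
    and F_span: "q \<in> W \<Longrightarrow> v \<in> tangent_space A q \<Longrightarrow> \<exists>c. v = (\<lambda>g. \<Sum>b\<in>Basis. c b * F b q g)"
    and F_J: "q \<in> W \<Longrightarrow> b \<in> Basis \<Longrightarrow> J q (F b q) = (\<lambda>g. \<Sum>c\<in>Basis. (j b \<bullet> c) * F c q g)"
begin

section \<open>Components in the frame\<close>

definition fvec :: "'m \<Rightarrow> 'e \<Rightarrow> 'm tangent" where
  "fvec q x = (\<lambda>g. \<Sum>b\<in>Basis. (x \<bullet> b) * F b q g)"

definition coords :: "'m \<Rightarrow> 'm tangent \<Rightarrow> 'e" where
  "coords q v = (\<Sum>b\<in>Basis. h q v (F b q) *\<^sub>R b)"

lemma eventually_W: "q \<in> W \<Longrightarrow> eventually (\<lambda>r. r \<in> W) (nhds q)"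
  using open_W by (rule eventually_nhds_in_open)

lemma fvec_lin: "linear (\<lambda>x. fvec q x g)"
  by (rule linearI) (simp_all add: fvec_def inner_simps sum.distrib sum_distrib_left algebra_simps)

lemma fvec_add: "fvec q (x + y) g = fvec q x g + fvec q y g"
  using linear_add[OF fvec_lin] .
lemma fvec_diff: "fvec q (x - y) g = fvec q x g - fvec q y g"
  using linear_diff[OF fvec_lin] .
lemma fvec_scaleR: "fvec q (c *\<^sub>R x) g = c * fvec q x g"
  using linear_scale[OF fvec_lin] by simp
lemma fvec_sum: "fvec q (\<Sum>i\<in>I. x i) g = (\<Sum>i\<in>I. fvec q (x i) g)"
  using linear_sum[OF fvec_lin] .
lemma fvec_zero: "fvec q 0 g = 0"
  using linear_0[OF fvec_lin] .

lemma fvec_Basis: "b \<in> Basis \<Longrightarrow> fvec q b = F b q"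
  by (rule ext) (simp add: fvec_def inner_Basis sum.delta' if_distrib[of "\<lambda>x. x * _"] cong: if_cong)

lemma h_sym: "v \<in> tangent_space A q \<Longrightarrow> w \<in> tangent_space A q \<Longrightarrow> h q v w = h q w v"
  using riemannian unfolding riemannian_metric_def by blast

lemma h_lincomb: "v \<in> tangent_space A q \<Longrightarrow> w \<in> tangent_space A q \<Longrightarrow> z \<in> tangent_space A q \<Longrightarrow>
    h q (\<lambda>g. a * v g + b * w g) z = a * h q v z + b * h q w z"
  using riemannian unfolding riemannian_metric_def by blast

lemma h_zero: "z \<in> tangent_space A q \<Longrightarrow> h q (\<lambda>g. 0) z = 0"
  using h_lincomb[OF tangent_zero tangent_zero, of z q 0 0] by simp

lemma h_sum:
  assumes "\<And>i. i \<in> I \<Longrightarrow> v i \<in> tangent_space A q" "z \<in> tangent_space A q"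
  shows "h q (\<lambda>g. \<Sum>i\<in>I. c i * v i g) z = (\<Sum>i\<in>I. c i * h q (v i) z)"
  using assms(1)
proof (induction I rule: infinite_finite_induct)
  case (insert i I)
  have "h q (\<lambda>g. c i * v i g + 1 * (\<Sum>i\<in>I. c i * v i g)) z
    = c i * h q (v i) z + 1 * h q (\<lambda>g. \<Sum>i\<in>I. c i * v i g) z"
    by (rule h_lincomb) (use insert assms in \<open>auto intro: tangent_sumI\<close>)
  with insert show ?case by simp
qed (auto simp: h_zero assms)

lemma J_lincomb: "v \<in> tangent_space A q \<Longrightarrow> w \<in> tangent_space A q \<Longrightarrow>
    J q (\<lambda>g. a * v g + b * w g) = (\<lambda>g. a * J q v g + b * J q w g)"
  using almost_complex unfolding almost_complex_structure_def by blast

lemma J_zero: "J q (\<lambda>g. 0) = (\<lambda>g. 0)"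
  using J_lincomb[OF tangent_zero tangent_zero, of q 0 0] by simp

lemma J_sum:
  assumes "\<And>i. i \<in> I \<Longrightarrow> v i \<in> tangent_space A q"
  shows "J q (\<lambda>g. \<Sum>i\<in>I. c i * v i g) = (\<lambda>g. \<Sum>i\<in>I. c i * J q (v i) g)"
  using assms
proof (induction I rule: infinite_finite_induct)
  case (insert i I)
  have "J q (\<lambda>g. c i * v i g + 1 * (\<Sum>i\<in>I. c i * v i g))
    = (\<lambda>g. c i * J q (v i) g + 1 * J q (\<lambda>g. \<Sum>i\<in>I. c i * v i g) g)"
    by (rule J_lincomb) (use insert in \<open>auto intro: tangent_sumI\<close>)
  with insert show ?case by simp
qed (auto simp: J_zero)

lemma F_tangent: "q \<in> W \<Longrightarrow> b \<in> Basis \<Longrightarrow> F b q \<in> tangent_space A q"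
  using F_vfield vfield_at_tangent by blast

lemma fvec_tangent: "q \<in> W \<Longrightarrow> fvec q x \<in> tangent_space A q"
  unfolding fvec_def by (rule tangent_sumI) (rule F_tangent)

lemma h_fvec:
  assumes "q \<in> W" shows "h q (fvec q x) (fvec q y) = x \<bullet> y"
proof -
  have 1: "h q (fvec q x) z = (\<Sum>b\<in>Basis. (x \<bullet> b) * h q (F b q) z)" if "z \<in> tangent_space A q" for
      x z
    unfolding fvec_def by (rule h_sum) (use assms F_tangent that in auto)
  have "h q (F b q) (fvec q y) = y \<bullet> b" if "b \<in> Basis" for b
  proof -
    have "h q (F b q) (fvec q y) = h q (fvec q y) (F b q)"
      using assms that by (intro h_sym fvec_tangent F_tangent)
    then show ?thesis
      using assms that by (simp add: 1 F_tangent F_orthonormal if_distrib[of "\<lambda>x. _ * x"] cong: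
          if_cong)
  qed
  then show ?thesis
    using 1[OF fvec_tangent[OF assms]] by (simp add: euclidean_inner[of x y])
qed

lemma coords_fvec: 
  assumes "q \<in> W" shows "coords q (fvec q x) = x"
proof (rule euclidean_eqI)
  fix b :: 'e assume "b \<in> Basis"
  then show "coords q (fvec q x) \<bullet> b = x \<bullet> b"
    using h_fvec[OF assms, of x b] by (simp add: coords_def inner_sum_left inner_Basis fvec_Basis
        if_distrib[of "\<lambda>x. _ * x"] cong: if_cong)
qed

lemma fvec_coords:
  assumes "q \<in> W" "v \<in> tangent_space A q" shows "fvec q (coords q v) = v"
proof -
  obtain c where "v = (\<lambda>g. \<Sum>b\<in>Basis. c b * F b q g)"
    using F_span[OF assms] by blast
  then have "v = fvec q (\<Sum>b\<in>Basis. c b *\<^sub>R b)"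
    by (simp add: fun_eq_iff fvec_sum fvec_scaleR fvec_Basis)
  then show ?thesis
    using coords_fvec[OF assms(1)] by simp
qed

lemma h_coords:
  assumes "q \<in> W" "v \<in> tangent_space A q" "w \<in> tangent_space A q"
  shows "h q v w = coords q v \<bullet> coords q w"
  using h_fvec[OF assms(1), of "coords q v" "coords q w"] fvec_coords assms by simp

lemma J_fvec:
  assumes "q \<in> W" shows "J q (fvec q x) = fvec q (j x)"
proof -
  have "J q (fvec q x) = (\<lambda>g. \<Sum>b\<in>Basis. (x \<bullet> b) * J q (F b q) g)"
    unfolding fvec_def by (rule J_sum) (use assms F_tangent in auto)
  also have "\<dots> = (\<lambda>g. \<Sum>b\<in>Basis. (x \<bullet> b) * fvec q (j b) g)"
    using F_J[OF assms] by (simp add: fvec_def)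
  also have "\<dots> = (\<lambda>g. fvec q (\<Sum>b\<in>Basis. (x \<bullet> b) *\<^sub>R j b) g)"
    by (simp add: fvec_sum fvec_scaleR)
  also have "\<dots> = fvec q (j x)"
    by (simp add: sum_Basis_contract[OF linear_j])
  finally show ?thesis .
qed

lemma coords_J: "q \<in> W \<Longrightarrow> v \<in> tangent_space A q \<Longrightarrow> coords q (J q v) = j (coords q v)"
  using J_fvec[of q "coords q v"] fvec_coords[of q v] coords_fvec[of q "j (coords q v)"] by simp

lemma vfield_fvec:
  assumes "q \<in> W" "smooth_vec q k" shows "vfield_at A q (\<lambda>r. fvec r (k r))"
  unfolding fvec_def by (rule vfield_at_sum) (use assms F_vfield in \<open>auto simp: smooth_vec_def\<close>)

lemma vfield_fvec_const: "q \<in> W \<Longrightarrow> vfield_at A q (\<lambda>r. fvec r x)"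
  by (rule vfield_fvec) (simp_all add: smooth_vec_const)

lemma smooth_vec_coords:
  assumes "q \<in> W" "vfield_at A q X" shows "smooth_vec q (\<lambda>r. coords r (X r))"
proof (rule csmI)
  fix b :: 'e assume b: "b \<in> Basis"
  have "(\<lambda>r. coords r (X r) \<bullet> b) = (\<lambda>r. h r (X r) (F b r))"
    using b by (simp add: coords_def inner_sum_left inner_Basis if_distrib[of "\<lambda>x. _ * x"] cong:
        if_cong)
  moreover have "smooth_at A q (\<lambda>r. h r (X r) (F b r))"
    using riemannian assms F_vfield[OF assms(1) b] unfolding riemannian_metric_def by blast
  ultimately show "smooth_at A q (\<lambda>r. coords r (X r) \<bullet> b)" by simp
qed

lemma vfield_rep:
  assumes "q \<in> W" "vfield_at A q X"
  shows "eventually (\<lambda>r. X r = fvec r (coords r (X r))) (nhds q)"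
  using eventually_W[OF assms(1)] vfield_at_eventually[OF assms(2)]
  by eventually_elim (simp add: fvec_coords vfield_at_tangent)

section \<open>Connection coefficients\<close>

definition chris :: "'m connection \<Rightarrow> 'm \<Rightarrow> 'e \<Rightarrow> 'e \<Rightarrow> 'e" where
  "chris D q x y = coords q (D q (fvec q x) (\<lambda>r. fvec r y))"

context
  fixes D :: "'m connection" assumes D: "is_connection A D"
begin

lemma D_tangent: "v \<in> tangent_space A q \<Longrightarrow> vfield_at A q Y \<Longrightarrow> D q v Y \<in> tangent_space A q"
  using D unfolding is_connection_def by blast

lemma D_lincomb: "v \<in> tangent_space A q \<Longrightarrow> w \<in> tangent_space A q \<Longrightarrow> vfield_at A q Y \<Longrightarrow>
    D q (\<lambda>g. a * v g + b * w g) Y = (\<lambda>g. a * D q v Y g + b * D q w Y g)"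
  using D unfolding is_connection_def by blast

lemma D_add: "v \<in> tangent_space A q \<Longrightarrow> vfield_at A q Y \<Longrightarrow> vfield_at A q Z \<Longrightarrow>
    D q v (\<lambda>q g. Y q g + Z q g) = (\<lambda>g. D q v Y g + D q v Z g)"
  using D unfolding is_connection_def by blast

lemma D_mult: "v \<in> tangent_space A q \<Longrightarrow> vfield_at A q Y \<Longrightarrow> smooth_at A q k \<Longrightarrow>
    D q v (\<lambda>q g. k q * Y q g) = (\<lambda>g. v k * Y q g + k q * D q v Y g)"
  using D unfolding is_connection_def by blast

lemma D_vfield: "vfield_at A q X \<Longrightarrow> vfield_at A q Y \<Longrightarrow> vfield_at A q (cov D X Y)"
  using D unfolding is_connection_def by blast

text \<open>Multiplying by the indicator of a neighbourhood turns two fields with the same germ into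
  the same total field, and by the Leibniz rule this multiplication does not change the derivative
  at q.\<close>

lemma D_local:
  assumes v: "v \<in> tangent_space A q" and Y: "vfield_at A q Y" and e: "eventually (\<lambda>r. Y r = Z r)
      (nhds q)"
  shows "D q v Y = D q v Z"
proof -
  have Z: "vfield_at A q Z"
    using vfield_at_local[OF e Y] .
  obtain V where V: "open V" "q \<in> V" "\<And>r. r \<in> V \<Longrightarrow> Y r = Z r"
    using e unfolding eventually_nhds by blast
  let ?\<chi> = "indicator V :: 'm \<Rightarrow> real"
  have H: "D q v (\<lambda>r g. ?\<chi> r * X r g) = D q v X" if "vfield_at A q X" for X
    using D_mult[OF v that smooth_at_indicator[OF V(1,2)]] tangent_indicator[OF v V(1,2)] V(2) by
        simp
  moreover have "(\<lambda>r g. ?\<chi> r * Y r g) = (\<lambda>r g. ?\<chi> r * Z r g)"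
    using V(3) by (auto simp: indicator_def fun_eq_iff)
  ultimately show ?thesis
    using H[OF Y] H[OF Z] by simp
qed

lemma D_zero:
  assumes v: "v \<in> tangent_space A q" "q \<in> W" shows "D q v (\<lambda>r g. 0) = (\<lambda>g. 0)"
  using D_mult[OF v(1) vfield_fvec_const[OF v(2), of 0] smooth_at_const[of q 0]] tangent_const[OF
      v(1), of 0] by simp

lemma D_sum:
  assumes v: "v \<in> tangent_space A q" and q: "q \<in> W"
    and "finite I" "\<And>i. i \<in> I \<Longrightarrow> vfield_at A q (X i)" "\<And>i. i \<in> I \<Longrightarrow> smooth_at A q (k i)"
  shows "D q v (\<lambda>r g. \<Sum>i\<in>I. k i r * X i r g) = (\<lambda>g. \<Sum>i\<in>I. v (k i) * X i q g + k i q * D q v (X i)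
      g)"
  using assms(3-5)
proof (induction I rule: finite_induct)
  case (insert i I)
  have "D q v (\<lambda>r g. k i r * X i r g + (\<Sum>i\<in>I. k i r * X i r g))
    = (\<lambda>g. D q v (\<lambda>r g. k i r * X i r g) g + D q v (\<lambda>r g. \<Sum>i\<in>I. k i r * X i r g) g)"
    using vfield_at_sum[of "{i}" q X k] insert by (intro D_add[OF v] vfield_at_sum) auto
  with insert D_mult[OF v, of "X i" "k i"] show ?case
    by simp
qed (simp add: D_zero v q)

lemma D_fvec_frame:
  assumes q: "q \<in> W" and v: "v \<in> tangent_space A q" and k: "smooth_vec q k"
  shows "D q v (\<lambda>r. fvec r (k r)) = (\<lambda>g. fvec q (dvec v k) g + (\<Sum>b\<in>Basis. (k q \<bullet> b) * D q v (F b)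
      g))"
proof -
  have "D q v (\<lambda>r. fvec r (k r)) =
      (\<lambda>g. \<Sum>b\<in>Basis. v (\<lambda>r. k r \<bullet> b) * F b q g + (k q \<bullet> b) * D q v (F b) g)"
    unfolding fvec_def by (rule D_sum[OF v q]) (use k q F_vfield in \<open>auto simp: smooth_vec_def\<close>)
  then show ?thesis
    by (simp add: sum.distrib fvec_def[of q "dvec v k"] dvec_inner[OF v k])
qed

lemma D_fvec_const:
  assumes q: "q \<in> W" and v: "v \<in> tangent_space A q"
  shows "D q v (\<lambda>r. fvec r y) = (\<lambda>g. \<Sum>b\<in>Basis. (y \<bullet> b) * D q v (F b) g)"
  using D_fvec_frame[OF q v smooth_vec_const] by (simp add: dvec_const[OF v] fvec_zero)

lemma fvec_chris:
  assumes q: "q \<in> W" and v: "v \<in> tangent_space A q"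
  shows "fvec q (chris D q (coords q v) y) = D q v (\<lambda>r. fvec r y)"
  unfolding chris_def by (simp add: fvec_coords q v D_tangent vfield_fvec_const)

text \<open>The form d + \<Gamma> of a connection: \<open>dvec\<close> differentiates the
  components, \<open>chris\<close> the frame fields. Only agreement of \<open>Y\<close> with its
  frame expression near q is asked.\<close>

lemma D_fvec:
  assumes q: "q \<in> W" and v: "v \<in> tangent_space A q" and k: "smooth_vec q k"
    and Y: "eventually (\<lambda>r. Y r = fvec r (k r)) (nhds q)"
  shows "D q v Y = fvec q (dvec v k + chris D q (coords q v) (k q))"
proof -
  have "D q v Y = D q v (\<lambda>r. fvec r (k r))"
    by (rule D_local[OF v vfield_at_local[OF eventually_mono[OF Y sym] vfield_fvec[OF q k]] Y])
  then show ?thesis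
    by (simp add: D_fvec_frame[OF q v k] fun_eq_iff fvec_add fvec_chris[OF q v] D_fvec_const[OF q
        v])
qed

lemma bilinear_chris:
  assumes q: "q \<in> W" shows "bilinear (chris D q)"
proof -
  have fvec_inj: "x = y" if "fvec q x = fvec q y" for x y
    using that coords_fvec[OF q] by metis
  have e: "fvec q (chris D q x y) = D q (fvec q x) (\<lambda>r. fvec r y)" for x y
    using fvec_chris[OF q fvec_tangent[OF q], of x y] by (simp add: coords_fvec q)
  note T = fvec_tangent[OF q] and V = vfield_fvec_const[OF q]
  show ?thesis
  proof (rule bilinearI; rule fvec_inj)
    fix x y z c
    show "fvec q (chris D q (x + y) z) = fvec q (chris D q x z + chris D q y z)"
      using D_lincomb[OF T T V, of 1 x 1 y z] by (simp add: e fun_eq_iff fvec_add)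
        (simp add: fvec_add[abs_def])
    show "fvec q (chris D q (c *\<^sub>R x) z) = fvec q (c *\<^sub>R chris D q x z)"
      using D_lincomb[OF T T V, of c x 0 x z] by (simp add: e fun_eq_iff fvec_scaleR)
        (simp add: fvec_scaleR[abs_def])
    show "fvec q (chris D q x (y + z)) = fvec q (chris D q x y + chris D q x z)"
      by (simp add: e fun_eq_iff fvec_add D_fvec_const[OF q T] inner_add_left sum.distrib
          algebra_simps)
    show "fvec q (chris D q x (c *\<^sub>R y)) = fvec q (c *\<^sub>R chris D q x y)"
      by (simp add: e fun_eq_iff fvec_scaleR D_fvec_const[OF q T] sum_distrib_left algebra_simps)
  qed
qed

lemma smooth_vec_chris: "q \<in> W \<Longrightarrow> smooth_vec q (\<lambda>r. chris D r x y)"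
  using smooth_vec_coords[OF _ D_vfield[OF vfield_fvec_const vfield_fvec_const], of q x y] by
      (simp add: cov_def chris_def)

end

section \<open>Gradient and Gauduchon connection in the frame\<close>

definition grad :: "('m \<Rightarrow> real) \<Rightarrow> 'm \<Rightarrow> 'e" where
  "grad f q = (\<Sum>b\<in>Basis. F b q f *\<^sub>R b)"

lemma grad_inner: "grad f q \<bullet> x = fvec q x f"
  by (simp add: grad_def fvec_def inner_sum_left inner_commute[of x] mult.commute)

lemma grad_zero: "q \<in> W \<Longrightarrow> grad (\<lambda>_. 0) q = 0"
  by (simp add: grad_def tangent_const[OF F_tangent])

lemma smooth_vec_grad:
  assumes "q \<in> W" "smooth_at A q f" shows "smooth_vec q (grad f)"
proof (rule csmI)
  fix b :: 'e assume b: "b \<in> Basis"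
  then show "smooth_at A q (\<lambda>r. grad f r \<bullet> b)"
    using vfield_at_smooth[OF F_vfield[OF assms(1) b] assms(2)] by (simp add: grad_inner fvec_Basis)
qed

lemma nabla_J_fvec:
  assumes D: "is_connection A D" and q: "q \<in> W" and v: "v \<in> tangent_space A q" and Y: "vfield_at A
      q Y"
  shows "nabla_J J D q v Y = fvec q (nabJ (chris D q) (coords q v) (coords q (Y q)))"
proof -
  have k: "smooth_vec q (\<lambda>r. coords r (Y r))"
    using smooth_vec_coords[OF q Y] .
  have "eventually (\<lambda>r. J r (Y r) = fvec r (j (coords r (Y r)))) (nhds q)"
    using eventually_W[OF q] vfield_rep[OF q Y]
    by eventually_elim (metis J_fvec)
  from D_fvec[OF D q v smooth_vec_linear[OF linear_j k] this]
  have "D q v (\<lambda>r. J r (Y r)) = fvec q (j (dvec v (\<lambda>r. coords r (Y r))) + chris D q (coords q v)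
      (j (coords q (Y q))))"
    by (simp add: dvec_linear[OF v linear_j k])
  moreover have "J q (D q v Y) = fvec q (j (dvec v (\<lambda>r. coords r (Y r)) + chris D q (coords q v)
      (coords q (Y q))))"
    by (simp add: D_fvec[OF D q v k vfield_rep[OF q Y]] J_fvec[OF q])
  ultimately show ?thesis
    by (simp add: nabla_J_def fun_eq_iff nabJ_def j_simps fvec_diff fvec_add)
qed

text \<open>The factor exp(2f) multiplies every term of the defining equation and cancels, so the
  same algebraic map \<open>gaud\<close> serves both metrics and only the Levi-Civita coefficients
  differ. The vector described by \<open>THE\<close> is unique because fields with constant
  components already determine it.\<close>

lemma gauduchon_fvec:
  assumes D: "is_connection A D" and q: "q \<in> W" and v: "v \<in> tangent_space A q" and Y: "vfield_at A
      q Y"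
  shows "gauduchon A J (conformal_metric f h) D t q v Y =
    fvec q (dvec v (\<lambda>r. coords r (Y r)) + gaud (chris D q) (coords q v) (coords q (Y q)))"
proof -
  define \<Gamma> where "\<Gamma> = chris D q"
  define x y where "x = coords q v" and "y = coords q (Y q)"
  define m where "m = dvec v (\<lambda>r. coords r (Y r))"
  let ?h = "conformal_metric f h q"
  let ?rhs = "\<lambda>Z. ?h (\<lambda>g. D q v Y g - 1/2 * J q (nabla_J J D q v Y) g) (Z q)
          + t/4 * ?h (\<lambda>g. nabla_J J D q (J q (Y q)) Z g + J q (nabla_J J D q (Y q) Z) g) v
          - t/4 * ?h (\<lambda>g. nabla_J J D q (J q (Z q)) Y g + J q (nabla_J J D q (Z q) Y) g) v"
  have bil: "bilinear \<Gamma>"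
    unfolding \<Gamma>_def by (rule bilinear_chris[OF D q])
  have hE: "?h (fvec q a) w = exp (2 * f q) * (a \<bullet> coords q w)" if "w \<in> tangent_space A q" for a w
    using h_fvec[OF q, of a "coords q w"] fvec_coords[OF q that] by (simp add: conformal_metric_def)
  have Yq: "Y q \<in> tangent_space A q"
    using vfield_at_tangent[OF Y] .
  have JT: "J q w \<in> tangent_space A q" if "w \<in> tangent_space A q" for w
    using J_fvec[OF q, of "coords q w"] fvec_coords[OF q that] fvec_tangent[OF q] by metis
  have rhs: "?rhs Z = ?h (fvec q (m + gaud \<Gamma> x y)) (Z q)" if Z: "vfield_at A q Z" for Z
  proof -
    define z where "z = coords q (Z q)"
    have Zq: "Z q \<in> tangent_space A q"
      using vfield_at_tangent[OF Z] .
    have "D q v Y = fvec q (m + \<Gamma> x y)"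
      unfolding \<Gamma>_def x_def y_def m_def by (rule D_fvec[OF D q v smooth_vec_coords[OF q Y]
          vfield_rep[OF q Y]])
    then have 1: "(\<lambda>g. D q v Y g - 1/2 * J q (nabla_J J D q v Y) g) = fvec q (m + \<Gamma> x y - (1/2)
        *\<^sub>R j (nabJ \<Gamma> x y))"
      by (simp add: nabla_J_fvec[OF D q v Y] J_fvec[OF q] fun_eq_iff fvec_diff fvec_scaleR x_def
          y_def \<Gamma>_def)
    have 2: "(\<lambda>g. nabla_J J D q (J q (Y q)) Z g + J q (nabla_J J D q (Y q) Z) g)
        = fvec q (nabJ \<Gamma> (j y) z + j (nabJ \<Gamma> y z))"
      by (simp add: nabla_J_fvec[OF D q JT[OF Yq] Z] nabla_J_fvec[OF D q Yq Z] J_fvec[OF q]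
          coords_J[OF q Yq]
          fun_eq_iff fvec_add z_def y_def \<Gamma>_def)
    have 3: "(\<lambda>g. nabla_J J D q (J q (Z q)) Y g + J q (nabla_J J D q (Z q) Y) g)
        = fvec q (nabJ \<Gamma> (j z) y + j (nabJ \<Gamma> z y))"
      by (simp add: nabla_J_fvec[OF D q JT[OF Zq] Y] nabla_J_fvec[OF D q Zq Y] J_fvec[OF q]
          coords_J[OF q Zq]
          fun_eq_iff fvec_add z_def y_def \<Gamma>_def)
    show ?thesis
      unfolding 1 2 3 hE[OF Zq] hE[OF v] z_def[symmetric] x_def[symmetric]
      by (simp add: gaud_def gaud_shift_inner[OF bil] inner_simps algebra_simps)
  qed
  have "gauduchon A J (conformal_metric f h) D t q v Y = fvec q (m + gaud \<Gamma> x y)"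
    unfolding gauduchon_def
  proof (rule the_equality)
    show "fvec q (m + gaud \<Gamma> x y) \<in> tangent_space A q \<and>
      (\<forall>Z. vfield_at A q Z \<longrightarrow> ?h (fvec q (m + gaud \<Gamma> x y)) (Z q) = ?rhs Z)"
      using fvec_tangent[OF q] rhs by simp
  next
    fix w assume w: "w \<in> tangent_space A q \<and> (\<forall>Z. vfield_at A q Z \<longrightarrow> ?h w (Z q) = ?rhs Z)"
    have "coords q w = m + gaud \<Gamma> x y"
    proof (rule euclidean_eqI)
      fix b :: 'e
      have Z: "vfield_at A q (\<lambda>r. fvec r b)"
        by (rule vfield_fvec_const[OF q])
      have "?h w ((\<lambda>r. fvec r b) q) = ?rhs (\<lambda>r. fvec r b)"
        using w Z by blast
      also have "\<dots> = ?h (fvec q (m + gaud \<Gamma> x y)) ((\<lambda>r. fvec r b) q)"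
        by (rule rhs[OF Z])
      finally show "coords q w \<bullet> b = (m + gaud \<Gamma> x y) \<bullet> b"
        using hE[OF fvec_tangent[OF q], of "coords q w" b] hE[OF fvec_tangent[OF q], of "m + gaud
            \<Gamma> x y" b] w
        by (simp add: fvec_coords[OF q] coords_fvec[OF q])
    qed
    then show "w = fvec q (m + gaud \<Gamma> x y)"
      using fvec_coords[OF q] w by metis
  qed
  then show ?thesis
    by (simp add: m_def \<Gamma>_def x_def y_def)
qed

section \<open>Levi-Civita connections of conformal metrics\<close>

context
  fixes f :: "'m \<Rightarrow> real" and D :: "'m connection"
  assumes f: "smooth_function A f" and LC: "levi_civita A (conformal_metric f h) D"
begin

lemma LC_connection: "is_connection A D"
  using LC unfolding levi_civita_def by blast

lemma f_smooth: "smooth_at A q f"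
  using f unfolding smooth_function_def by blast

text \<open>The frame is orthonormal for \<open>h\<close>, not for exp(2f) h, so the coefficients of
  the new connection fail to be skew by the derivative of the conformal factor.\<close>

lemma LC_metric:
  assumes q: "q \<in> W"
  shows "chris D q x y \<bullet> z + y \<bullet> chris D q x z = 2 * (grad f q \<bullet> x) * (y \<bullet> z)"
proof -
  let ?v = "fvec q x"
  have v: "?v \<in> tangent_space A q"
    by (rule fvec_tangent[OF q])
  have hE: "conformal_metric f h r (fvec r a) (fvec r b) = exp (2 * f r) * (a \<bullet> b)" if "r \<in> W" for
      r a b
    using h_fvec[OF that] by (simp add: conformal_metric_def)
  have DE: "D q ?v (\<lambda>r. fvec r a) = fvec q (chris D q x a)" for a
    using fvec_chris[OF LC_connection q v] coords_fvec[OF q] by simp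
  have "?v (\<lambda>r. conformal_metric f h r (fvec r y) (fvec r z)) =
      conformal_metric f h q (D q ?v (\<lambda>r. fvec r y)) (fvec q z) + conformal_metric f h q (fvec q
          y) (D q ?v (\<lambda>r. fvec r z))"
    using LC v vfield_fvec_const[OF q] unfolding levi_civita_def by blast
  moreover have "?v (\<lambda>r. conformal_metric f h r (fvec r y) (fvec r z)) = ?v (\<lambda>r. (y \<bullet> z) * exp (2
      * f r))"
    by (rule tangent_local[OF v]) (rule eventually_mono[OF eventually_W[OF q]], simp add: hE)
  moreover have "?v (\<lambda>r. (y \<bullet> z) * exp (2 * f r)) = (y \<bullet> z) * (exp (2 * f q) * (2 * ?v f))"
    using smooth_at_mult[OF smooth_at_const[of q 2] f_smooth]
    by (simp add: tangent_cmult[OF v smooth_at_exp] tangent_exp[OF v] tangent_cmult[OF v f_smooth])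
  ultimately have "exp (2 * f q) * (chris D q x y \<bullet> z + y \<bullet> chris D q x z) = exp (2 * f q) * (2 *
      ?v f * (y \<bullet> z))"
    by (simp add: hE[OF q] DE algebra_simps)
  then show ?thesis
    by (simp add: grad_inner)
qed

lemma LC_torsion:
  assumes "vfield_at A q X" "vfield_at A q Y"
  shows "lie_bracket A X Y q = (\<lambda>g. D q (X q) Y g - D q (Y q) X g)"
  using LC assms unfolding levi_civita_def by metis

text \<open>Brackets of frame fields involve no metric; hence the coefficients of both Levi-Civita
  connections have the same antisymmetric part.\<close>

lemma LC_torsion_fvec:
  assumes q: "q \<in> W"
  shows "lie_bracket A (\<lambda>r. fvec r x) (\<lambda>r. fvec r y) q = fvec q (chris D q x y - chris D q y x)"
proof -
  have "D q (fvec q x) (\<lambda>r. fvec r a) = fvec q (chris D q x a)" for x a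
    using fvec_chris[OF LC_connection q fvec_tangent[OF q]] coords_fvec[OF q] by simp
  then show ?thesis
    using LC_torsion[OF vfield_fvec_const[OF q] vfield_fvec_const[OF q], of x y] by (simp add:
        fun_eq_iff fvec_diff)
qed

end

text \<open>The permutation argument behind uniqueness of the Levi-Civita connection: alternating
  the two symmetries six times returns the original value with opposite sign.\<close>

lemma skew_symmetric_zero:
  fixes C :: "'e \<Rightarrow> 'e \<Rightarrow> 'e"
  assumes "\<And>x y. C x y = C y x" "\<And>x y z. C x y \<bullet> z = - (y \<bullet> C x z)"
  shows "C x y = 0"
proof (rule euclidean_eqI)
  fix z :: 'e
  have "C x y \<bullet> z = - (C x z \<bullet> y)" "C z x \<bullet> y = - (C z y \<bullet> x)" "C y z \<bullet> x = - (C y x \<bullet> z)"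
    using assms(2)[of x y z] assms(2)[of z x y] assms(2)[of y z x] by (simp_all only: inner_commute)
  then show "C x y \<bullet> z = 0 \<bullet> z"
    using assms(1)[of x y] assms(1)[of x z] assms(1)[of y z] by simp
qed

text \<open>Lets statements about exp(2f) h be reused for \<open>h\<close>, with f = 0.\<close>

lemma conformal_metric_0: "conformal_metric (\<lambda>_. 0) h = h"
  by (simp add: conformal_metric_def)

lemma smooth_function_0: "smooth_function A (\<lambda>_. 0)"
  by (simp add: smooth_function_def smooth_at_const)

text \<open>The difference \<open>C\<close> of the two sides is symmetric because both connections
  are torsion-free, and skew because both are metric; so it vanishes.\<close>

lemma chris_conformal:
  assumes f: "smooth_function A f" and D: "levi_civita A h D" and D': "levi_civita A
      (conformal_metric f h) D'"
    and q: "q \<in> W"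
  shows "chris D' q x y = chris D q x y + (grad f q \<bullet> x) *\<^sub>R y + (grad f q \<bullet> y) *\<^sub>R x - (x \<bullet> y)
      *\<^sub>R grad f q"
proof -
  let ?u = "grad f q"
  define C where "C = (\<lambda>x y. chris D' q x y - (chris D q x y + (?u \<bullet> x) *\<^sub>R y + (?u \<bullet> y) *\<^sub>R x -
      (x \<bullet> y) *\<^sub>R ?u))"
  have D0: "levi_civita A (conformal_metric (\<lambda>_. 0) h) D"
    using D by (simp add: conformal_metric_0)
  have fvec_inj: "x = y" if "fvec q x = fvec q y" for x y
    using that coords_fvec[OF q] by metis
  have sym: "chris D' q x y - chris D' q y x = chris D q x y - chris D q y x" for x y
    using LC_torsion_fvec[OF f D' q] LC_torsion_fvec[OF smooth_function_0 D0 q] fvec_inj by metis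
  have "C x y = 0"
  proof (rule skew_symmetric_zero[of C])
    fix x y z
    show "C x y = C y x"
      using sym[of x y] by (simp add: C_def inner_commute[of x y] algebra_simps)
    show "C x y \<bullet> z = - (y \<bullet> C x z)"
      using LC_metric[OF f D' q, of x y z] LC_metric[OF smooth_function_0 D0 q, of x y z]
      by (simp add: C_def grad_zero[OF q] inner_simps inner_commute algebra_simps)
  qed
  then show ?thesis by (simp add: C_def)
qed

section \<open>Curvature in the frame\<close>

lemma smooth_vec_gaud:
  assumes "\<And>x y. smooth_vec q (\<lambda>r. \<Gamma> r x y)"
  shows "smooth_vec q (\<lambda>r. gaud (\<Gamma> r) x y)"
proof -
  have N: "smooth_vec q (\<lambda>r. nabJ (\<Gamma> r) x y)" for x y
    unfolding nabJ_def by (intro smooth_vec_diff smooth_vec_linear[OF linear_j] assms)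
  show ?thesis
    unfolding gaud_def gaud_shift_def inner_diff_left[symmetric]
    by (intro smooth_vec_add smooth_vec_scaleR smooth_vec_sum smooth_vec_diff smooth_vec_linear[OF
        linear_j] smooth_vec_inner N assms
        smooth_at_const smooth_vec_const)
qed

text \<open>Curvature of d + \<omega> on fields with constant components. \<open>\<tau> x y\<close>
  stands for the bracket of the frame fields with components x and y; as a parameter it is shared by
  the two connections being compared.\<close>

definition curv :: "('m \<Rightarrow> 'e \<Rightarrow> 'e \<Rightarrow> 'e) \<Rightarrow> ('e \<Rightarrow> 'e \<Rightarrow> 'e) \<Rightarrow> 'm \<Rightarrow> 'e \<Rightarrow> 'e \<Rightarrow> 'e \<Rightarrow> 'e" where
  "curv \<omega> \<tau> p x y z = dvec (fvec p x) (\<lambda>r. \<omega> r y z) - dvec (fvec p y) (\<lambda>r. \<omega> r x z)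
     + \<omega> p x (\<omega> p y z) - \<omega> p y (\<omega> p x z) - \<omega> p (\<tau> x y) z"

lemma dvec_inner_Basis: "b \<in> Basis \<Longrightarrow> dvec v k \<bullet> b = v (\<lambda>q. k q \<bullet> b)" for k :: "'m \<Rightarrow> 'e"
  by (simp add: dvec_def inner_sum_left inner_Basis if_distrib[of "\<lambda>x. _ * x"] cong: if_cong)

context
  fixes D' nabla :: "'m connection" and \<omega> :: "'m \<Rightarrow> 'e \<Rightarrow> 'e \<Rightarrow> 'e" and p :: 'm
  assumes p: "p \<in> W"
    and form: "\<And>q v Y. q \<in> W \<Longrightarrow> v \<in> tangent_space A q \<Longrightarrow> vfield_at A q Y \<Longrightarrow>
      D' q v Y = fvec q (dvec v (\<lambda>r. coords r (Y r)) + \<omega> q (coords q v) (coords q (Y q)))"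
    and bil: "\<And>q. q \<in> W \<Longrightarrow> bilinear (\<omega> q)"
    and smooth_vec_\<omega>: "\<And>q x y. q \<in> W \<Longrightarrow> smooth_vec q (\<lambda>r. \<omega> r x y)"
    and LC: "levi_civita A h nabla"
begin

lemma bil_near: "eventually (\<lambda>q. bilinear (\<omega> q)) (nhds p)"
  using eventually_W[OF p] by eventually_elim (rule bil)

text \<open>Two applications of d + \<omega>. Derivatives of the components of Y and Z are kept,
  since they cancel only after antisymmetrising and subtracting the bracket term.\<close>

lemma second_derivative_fvec:
  assumes X: "vfield_at A p X" and Y: "vfield_at A p Y" and Z: "vfield_at A p Z"
  defines "x \<equiv> \<lambda>r. coords r (X r)" and "y \<equiv> \<lambda>r. coords r (Y r)" and "z \<equiv> \<lambda>r. coords r (Z r)"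
  shows "cov D' X (cov D' Y Z) p = fvec p (dvec (X p) (\<lambda>r. dvec (Y r) z) + dvec (X p) (\<lambda>r. \<omega> r (y
      p) (z p))
    + \<omega> p (dvec (X p) y) (z p) + \<omega> p (y p) (dvec (X p) z) + \<omega> p (x p) (dvec (Y p) z)
    + \<omega> p (x p) (\<omega> p (y p) (z p)))"
proof -
  define m where "m = (\<lambda>r. dvec (Y r) z + \<omega> r (y r) (z r))"
  have Xp: "X p \<in> tangent_space A p"
    using vfield_at_tangent[OF X] .
  have y: "smooth_vec p y" and z: "smooth_vec p z"
    unfolding y_def z_def using smooth_vec_coords p Y Z by auto
  have cov: "eventually (\<lambda>r. cov D' Y Z r = fvec r (m r)) (nhds p)"
    using eventually_W[OF p] vfield_at_eventually[OF Y] vfield_at_eventually[OF Z]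
    by eventually_elim (simp add: cov_def m_def y_def z_def form vfield_at_tangent)
  have csm1: "smooth_vec p (\<lambda>r. dvec (Y r) z)"
  proof (rule csmI)
    fix b :: 'e assume "b \<in> Basis"
    then show "smooth_at A p (\<lambda>r. dvec (Y r) z \<bullet> b)"
      using vfield_at_smooth[OF Y smooth_vec_inner[OF z]] by (simp add: dvec_inner_Basis)
  qed
  have csm2: "smooth_vec p (\<lambda>r. \<omega> r (y r) (z r))"
    by (rule smooth_vec_bilinear[OF bil_near smooth_vec_\<omega>[OF p] y z])
  have m: "smooth_vec p m"
    unfolding m_def by (rule smooth_vec_add[OF csm1 csm2])
  have "vfield_at A p (cov D' Y Z)"
    by (rule vfield_at_local[OF eventually_mono[OF cov sym] vfield_fvec[OF p m]])
  from form[OF p Xp this]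
  have "cov D' X (cov D' Y Z) p = fvec p (dvec (X p) (\<lambda>r. coords r (cov D' Y Z r)) + \<omega> p (x p)
      (coords p (cov D' Y Z p)))"
    by (simp add: cov_def x_def)
  also have "dvec (X p) (\<lambda>r. coords r (cov D' Y Z r)) = dvec (X p) m"
    by (rule dvec_local[OF Xp]) (use cov eventually_W[OF p] in eventually_elim, simp add:
        coords_fvec)
  also have "coords p (cov D' Y Z p) = m p"
    using eventually_nhds_x_imp_x[OF cov] by (simp add: coords_fvec p)
  also have "dvec (X p) m = dvec (X p) (\<lambda>r. dvec (Y r) z) + (dvec (X p) (\<lambda>r. \<omega> r (y p) (z p))
    + \<omega> p (dvec (X p) y) (z p) + \<omega> p (y p) (dvec (X p) z))"
    unfolding m_def dvec_add[OF Xp csm1 csm2] dvec_bilinear[OF Xp bil_near smooth_vec_\<omega>[OF p] y z]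
        ..
  finally show ?thesis
    by (simp add: m_def bilinear_simps[OF bil[OF p]] add_ac)
qed

lemma curvature_fvec:
  assumes X: "vfield_at A p X" and Y: "vfield_at A p Y" and Z: "vfield_at A p Z"
  shows "curvature A D' X Y Z p =
    fvec p (curv \<omega> (\<lambda>x y. chris nabla p x y - chris nabla p y x) p (coords p (X p)) (coords p (Y
        p)) (coords p (Z p)))"
proof -
  define x y z where "x = (\<lambda>r. coords r (X r))" and "y = (\<lambda>r. coords r (Y r))" and "z = (\<lambda>r.
      coords r (Z r))"
  have LC0: "levi_civita A (conformal_metric (\<lambda>_. 0) h) nabla"
    using LC by (simp add: conformal_metric_0)
  note conn = LC_connection[OF smooth_function_0 LC0]
  have Xp: "X p \<in> tangent_space A p" "Y p \<in> tangent_space A p"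
    using vfield_at_tangent X Y by auto
  have z: "smooth_vec p z"
    unfolding z_def using smooth_vec_coords p Z by auto
  define lb where "lb = lie_bracket A X Y p"
  \<comment> \<open>Components of the bracket, read off from the vanishing torsion of
    \<open>nabla\<close>.\<close>
  define w where "w = dvec (X p) y + chris nabla p (x p) (y p) - (dvec (Y p) x + chris nabla p (y
      p) (x p))"
  have lb: "lb = fvec p w"
    unfolding lb_def LC_torsion[OF smooth_function_0 LC0 X Y] w_def x_def y_def
    by (simp add: D_fvec[OF conn p Xp(1) smooth_vec_coords[OF p Y] vfield_rep[OF p Y]]
        D_fvec[OF conn p Xp(2) smooth_vec_coords[OF p X] vfield_rep[OF p X]] fvec_diff fun_eq_iff)
  have lbT: "lb \<in> tangent_space A p"
    unfolding lb by (rule fvec_tangent[OF p])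
  \<comment> \<open>By definition the bracket acts on components as a commutator, which is what
    cancels the second derivatives of Z.\<close>
  have dvec_lb: "dvec lb z = dvec (X p) (\<lambda>r. dvec (Y r) z) - dvec (Y p) (\<lambda>r. dvec (X r) z)"
  proof (rule euclidean_eqI)
    fix b :: 'e assume "b \<in> Basis"
    then show "dvec lb z \<bullet> b = (dvec (X p) (\<lambda>r. dvec (Y r) z) - dvec (Y p) (\<lambda>r. dvec (X r) z)) \<bullet> b"
      using smooth_vec_inner[OF z, of b] by (simp add: dvec_inner_Basis inner_diff_left lb_def
          lie_bracket_def)
  qed
  have 3: "cov D' (lie_bracket A X Y) Z p = fvec p (dvec (X p) (\<lambda>r. dvec (Y r) z) - dvec (Y p)
      (\<lambda>r. dvec (X r) z) + \<omega> p w (z p))"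
    using form[OF p lbT Z] dvec_lb by (simp add: cov_def lb_def[symmetric] lb coords_fvec p z_def)
  have XE: "fvec p (x p) = X p" "fvec p (y p) = Y p"
    using Xp by (simp_all add: x_def y_def fvec_coords p)
  show ?thesis
    unfolding curvature_def second_derivative_fvec[OF X Y Z] second_derivative_fvec[OF Y X Z] 3
      x_def[symmetric] y_def[symmetric] z_def[symmetric] fvec_diff[symmetric]
    unfolding curv_def x_def[symmetric, THEN fun_cong] y_def[symmetric, THEN fun_cong]
        z_def[symmetric, THEN fun_cong] XE
    by (simp add: w_def bilinear_simps[OF bil[OF p]] algebra_simps)
qed

lemma curv_linear:
  assumes \<tau>: "bilinear \<tau>"
  shows "linear (\<lambda>x. curv \<omega> \<tau> p x y z)" "linear (\<lambda>y. curv \<omega> \<tau> p x y z)" "linear (\<lambda>z. curv \<omega> \<tau> p x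
      y z)"
proof -
  note T = fvec_tangent[OF p]
  have 1: "dvec (fvec p (a + b)) k = dvec (fvec p a) k + dvec (fvec p b) k" "dvec (fvec p (c *\<^sub>R
      a)) k = c *\<^sub>R dvec (fvec p a) k"
    for a b c and k :: "'m \<Rightarrow> 'e"
    by (simp_all add: dvec_def fvec_add fvec_scaleR scaleR_left_distrib sum.distrib
        scaleR_sum_right)
  have 2: "dvec (fvec p x) (\<lambda>r. \<omega> r (a + b) z) = dvec (fvec p x) (\<lambda>r. \<omega> r a z) + dvec (fvec p x)
      (\<lambda>r. \<omega> r b z)" for x a b z
    unfolding dvec_add[OF T smooth_vec_\<omega>[OF p] smooth_vec_\<omega>[OF p], symmetric]
    by (rule dvec_local[OF T]) (use bil_near in eventually_elim, simp add: bilinear_simps)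
  have 3: "dvec (fvec p x) (\<lambda>r. \<omega> r z (a + b)) = dvec (fvec p x) (\<lambda>r. \<omega> r z a) + dvec (fvec p x)
      (\<lambda>r. \<omega> r z b)" for x a b z
    unfolding dvec_add[OF T smooth_vec_\<omega>[OF p] smooth_vec_\<omega>[OF p], symmetric]
    by (rule dvec_local[OF T]) (use bil_near in eventually_elim, simp add: bilinear_simps)
  have 4: "dvec (fvec p x) (\<lambda>r. \<omega> r (c *\<^sub>R a) z) = c *\<^sub>R dvec (fvec p x) (\<lambda>r. \<omega> r a z)" for x a c z
    unfolding dvec_linear[OF T linear_scaleR smooth_vec_\<omega>[OF p], symmetric]
    by (rule dvec_local[OF T]) (use bil_near in eventually_elim, simp add: bilinear_simps)
  have 5: "dvec (fvec p x) (\<lambda>r. \<omega> r z (c *\<^sub>R a)) = c *\<^sub>R dvec (fvec p x) (\<lambda>r. \<omega> r z a)" for x a c z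
    unfolding dvec_linear[OF T linear_scaleR smooth_vec_\<omega>[OF p], symmetric]
    by (rule dvec_local[OF T]) (use bil_near in eventually_elim, simp add: bilinear_simps)
  show "linear (\<lambda>x. curv \<omega> \<tau> p x y z)" "linear (\<lambda>y. curv \<omega> \<tau> p x y z)" "linear (\<lambda>z. curv \<omega> \<tau> p x y
      z)"
    by (rule linearI; simp add: curv_def 1 2 3 4 5 bilinear_simps[OF bil[OF p]] bilinear_simps[OF
        \<tau>] algebra_simps)+
qed

end

lemma curv_change:
  assumes p: "p \<in> W" and f: "smooth_function A f"
    and LC: "levi_civita A h nabla" and LC': "levi_civita A (conformal_metric f h) nabla'"
  defines "\<tau> \<equiv> \<lambda>x y. chris nabla p x y - chris nabla p y x" and "\<Gamma> \<equiv> chris nabla p" and "u \<equiv> grad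
      f p"
    and "H \<equiv> \<lambda>x. dvec (fvec p x) (grad f) + chris nabla p x (grad f p)"
  shows "curv (\<lambda>q. gaud (chris nabla' q)) \<tau> p x y z = curv (\<lambda>q. gaud (chris nabla q)) \<tau> p x y z
    + curv_diff u (\<lambda>x. H x + gaud_shift \<Gamma> x u) (\<lambda>x y. gaud_shift \<Gamma> x y - gaud_shift \<Gamma> y x) x y z"
proof -
  define S where "S = (\<lambda>u x z. (u \<bullet> x) *\<^sub>R z + cskew u x z)"
  define du where "du = (\<lambda>x. dvec (fvec p x) (grad f))"
  note T = fvec_tangent[OF p]
  have LC0: "levi_civita A (conformal_metric (\<lambda>_. 0) h) nabla"
    using LC by (simp add: conformal_metric_0)
  note conn = LC_connection[OF smooth_function_0 LC0]
  have fs: "smooth_at A q f" for q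
    using f unfolding smooth_function_def by blast
  have \<Gamma>: "bilinear \<Gamma>"
    unfolding \<Gamma>_def by (rule bilinear_chris[OF conn p])
  have skew: "\<Gamma> x y \<bullet> z = - (y \<bullet> \<Gamma> x z)" for x y z
    using LC_metric[OF smooth_function_0 LC0 p, of x y z] by (simp add: \<Gamma>_def grad_zero[OF p])
  \<comment> \<open>Established on all of \<open>W\<close> rather than at \<open>p\<close>, because
    it is differentiated in the next step.\<close>
  have om': "gaud (chris nabla' q) x y = gaud (chris nabla q) x y + S (grad f q) x y" if "q \<in> W"
      for q x y
  proof -
    have "chris nabla' q = (\<lambda>x y. chris nabla q x y + (grad f q \<bullet> x) *\<^sub>R y + (grad f q \<bullet> y) *\<^sub>R x
        - (x \<bullet> y) *\<^sub>R grad f q)"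
      by (intro ext chris_conformal[OF f LC LC' that])
    then show ?thesis
      using gaud_conformal[OF bilinear_chris[OF conn that], of "grad f q" x y] by (simp add: S_def
          add.assoc)
  qed
  have S_lin: "linear (\<lambda>u. S u x z)" for x z
    unfolding S_def by (rule linearI) (simp_all add: cskew_simps inner_simps algebra_simps)
  have smooth_vec: "smooth_vec p (\<lambda>r. gaud (chris nabla r) x y)" for x y
    by (rule smooth_vec_gaud[OF smooth_vec_chris[OF conn p]])
  have grad: "smooth_vec p (grad f)"
    by (rule smooth_vec_grad[OF p fs])
  have pd': "dvec (fvec p x) (\<lambda>r. gaud (chris nabla' r) y z) = dvec (fvec p x) (\<lambda>r. gaud (chris
      nabla r) y z) + S (du x) y z" for x y z
  proof -
    have "dvec (fvec p x) (\<lambda>r. gaud (chris nabla' r) y z) = dvec (fvec p x) (\<lambda>r. gaud (chris nabla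
        r) y z + S (grad f r) y z)"
      by (rule dvec_local[OF T]) (rule eventually_mono[OF eventually_W[OF p]], rule om')
    also have "\<dots> = dvec (fvec p x) (\<lambda>r. gaud (chris nabla r) y z) + S (du x) y z"
      unfolding du_def dvec_add[OF T smooth_vec smooth_vec_linear[OF S_lin grad]] dvec_linear[OF T
          S_lin grad] ..
    finally show ?thesis .
  qed
  \<comment> \<open>Closedness of df: the antisymmetric part of the second derivatives of f is the
    bracket of frame fields applied to f.\<close>
  have hess: "du x \<bullet> y - du y \<bullet> x = u \<bullet> \<tau> x y" for x y
  proof -
    have "du x \<bullet> y = fvec p x (\<lambda>r. fvec r y f)" for x y
      by (simp add: du_def dvec_inner[OF T grad] grad_inner)
    then have "du x \<bullet> y - du y \<bullet> x = lie_bracket A (\<lambda>r. fvec r x) (\<lambda>r. fvec r y) p f"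
      using fs by (simp add: lie_bracket_def)
    then show ?thesis
      by (simp add: LC_torsion_fvec[OF smooth_function_0 LC0 p] u_def grad_inner \<tau>_def)
  qed
  have "curv (\<lambda>q. gaud (chris nabla' q)) \<tau> p x y z - curv (\<lambda>q. gaud (chris nabla q)) \<tau> p x y z
    = S (du x) y z - S (du y) x z + gaud \<Gamma> x (S u y z) + S u x (gaud \<Gamma> y z) + S u x (S u y z)
      - gaud \<Gamma> y (S u x z) - S u y (gaud \<Gamma> x z) - S u y (S u x z) - S u (\<tau> x y) z"
    unfolding curv_def pd' om'[OF p] \<Gamma>_def[symmetric] u_def[symmetric] bilinear_simps[OF
        bilinear_gaud[OF \<Gamma>]]
    by (simp add: S_def cskew_simps inner_simps algebra_simps)
  also have "\<dots> = curv_diff u (\<lambda>x. du x + gaud \<Gamma> x u) (\<lambda>x y. gaud \<Gamma> x y - gaud \<Gamma> y x - \<tau> x y) x y z"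
    by (rule curvature_change[OF gaud_skew[OF \<Gamma> skew] gaud_j[OF \<Gamma> skew] bilinear_gaud[OF \<Gamma>] _
        hess]) (simp add: S_def)
  also have "\<dots> = curv_diff u (\<lambda>x. H x + gaud_shift \<Gamma> x u) (\<lambda>x y. gaud_shift \<Gamma> x y - gaud_shift \<Gamma> y
      x) x y z"
    by (simp add: gaud_def H_def du_def \<tau>_def \<Gamma>_def[symmetric] u_def[symmetric] add.assoc
        algebra_simps curv_diff_def)
  finally show ?thesis by (simp add: algebra_simps)
qed

section \<open>Scalar curvatures as basis-free traces\<close>

lemma coords_cmult:
  assumes "q \<in> W" "v \<in> tangent_space A q"
  shows "coords q (\<lambda>g. c * v g) = c *\<^sub>R coords q v"
proof -
  have "(\<lambda>g. c * v g) = fvec q (c *\<^sub>R coords q v)"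
    using fvec_coords[OF assms] by (simp add: fun_eq_iff fvec_scaleR)
  then show ?thesis
    using coords_fvec[OF assms(1)] by simp
qed

context
  fixes f :: "'m \<Rightarrow> real" and nabla D' :: "'m connection" and p :: 'm and \<epsilon> :: "nat \<Rightarrow> 'm vfield"
  assumes p: "p \<in> W" and f: "smooth_function A f" and LC: "levi_civita A h nabla"
    and LC': "levi_civita A (conformal_metric f h) D'"
    and frame: "local_unitary_frame A n J (conformal_metric f h) p \<epsilon>"
begin

text \<open>The right sides contain no trace of the unitary frame \<open>\<epsilon>\<close>, so
  values computed in unrelated frames become comparable. Evaluating the metric gives one factor
  \<mu> = exp(2 f p); the factor on the left supplies the second one that the two contractions
  absorb.\<close>

lemma scal_inv:
  defines "R \<equiv> curv (\<lambda>q. gaud (chris D' q)) (\<lambda>x y. chris nabla p x y - chris nabla p y x) p"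
  shows "complex_of_real (exp (2 * f p)) * scal1 A n J (conformal_metric f h) D' \<epsilon> t p
      = ctrace1 (\<lambda>w z x y. complex_of_real (R x y z \<bullet> w))" (is ?A)
    and "complex_of_real (exp (2 * f p)) * scal2 A n J (conformal_metric f h) D' \<epsilon> t p
      = ctrace2 (\<lambda>w z x y. complex_of_real (R x y z \<bullet> w))" (is ?B)
proof -
  define D where "D = gauduchon A J (conformal_metric f h) D' t"
  define \<omega> where "\<omega> = (\<lambda>q. gaud (chris D' q))"
  define \<mu> where "\<mu> = exp (2 * f p)"
  define U where "U = (\<lambda>i. coords p (\<epsilon> i p))"
  define K where "K = (\<lambda>w z x y. complex_of_real (R x y z \<bullet> w))"
  have conn: "is_connection A D'" "is_connection A nabla"
    using LC LC' unfolding levi_civita_def by auto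
  have form: "D q v Y = fvec q (dvec v (\<lambda>r. coords r (Y r)) + \<omega> q (coords q v) (coords q (Y q)))"
    if "q \<in> W" "v \<in> tangent_space A q" "vfield_at A q Y" for q v Y
    unfolding D_def \<omega>_def by (rule gauduchon_fvec[OF conn(1) that])
  have bil: "bilinear (\<omega> q)" if "q \<in> W" for q
    unfolding \<omega>_def by (rule bilinear_gaud[OF bilinear_chris[OF conn(1) that]])
  have smooth_vec_\<omega>: "smooth_vec q (\<lambda>r. \<omega> r x y)" if "q \<in> W" for q x y
    unfolding \<omega>_def by (rule smooth_vec_gaud[OF smooth_vec_chris[OF conn(1) that]])
  have \<tau>: "bilinear (\<lambda>x y. chris nabla p x y - chris nabla p y x)"
    by (rule bilinearI) (simp_all add: bilinear_simps[OF bilinear_chris[OF conn(2) p]]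
        algebra_simps)
  note R_lin = curv_linear[of p D \<omega> nabla, OF p form bil smooth_vec_\<omega> LC \<tau>, folded R_def[folded
      \<omega>_def]]
  have vf: "vfield_at A p (\<epsilon> i)" if "i < 2 * n" for i
    using frame that unfolding local_unitary_frame_def by blast
  have T: "\<epsilon> i p \<in> tangent_space A p" if "i < 2 * n" for i
    using vf[OF that] by (rule vfield_at_tangent)
  from frame obtain V where "p \<in> V" and "\<forall>q\<in>V.
      (\<forall>i<2 * n. \<forall>k<2 * n. conformal_metric f h q (\<epsilon> i q) (\<epsilon> k q) = (if i = k then 1 else 0)) \<and>
      (\<forall>i<n. \<epsilon> (n + i) q = J q (\<epsilon> i q)) \<and>
      (\<forall>v\<in>tangent_space A q. \<exists>c. v = (\<lambda>g. \<Sum>i<2 * n. c i * \<epsilon> i q g))"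
    unfolding local_unitary_frame_def by blast
  then have V: "\<forall>i<2 * n. \<forall>k<2 * n. conformal_metric f h p (\<epsilon> i p) (\<epsilon> k p) = (if i = k then 1 else
      0)"
      "\<forall>i<n. \<epsilon> (n + i) p = J p (\<epsilon> i p)"
      "\<forall>v\<in>tangent_space A p. \<exists>c. v = (\<lambda>g. \<Sum>i<2 * n. c i * \<epsilon> i p g)"
    by simp_all
  have ort: "\<mu> * (U i \<bullet> U k) = (if i = k then 1 else 0)" if "i < 2 * n" "k < 2 * n" for i k
    using V(1) that h_coords[OF p T T] by (simp add: conformal_metric_def U_def \<mu>_def)
  have \<mu>: "\<mu> > 0"
    by (simp add: \<mu>_def)
  \<comment> \<open>The frame spans, and orthonormality for \<mu> times the inner product identifies
    the coefficients as \<mu> \<langle>x, U k\<rangle>.\<close>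
  have U: "x = (\<Sum>i<2 * n. (\<mu> * (x \<bullet> U i)) *\<^sub>R U i)" for x
  proof -
    obtain c where c: "fvec p x = (\<lambda>g. \<Sum>i<2 * n. c i * \<epsilon> i p g)"
      using V(3) fvec_tangent[OF p] by blast
    also have "\<dots> = fvec p (\<Sum>i<2 * n. c i *\<^sub>R U i)"
      using fvec_coords[OF p T] by (simp add: fun_eq_iff fvec_sum fvec_scaleR U_def)
    finally have x: "x = (\<Sum>i<2 * n. c i *\<^sub>R U i)"
      using coords_fvec[OF p] by metis
    have "\<mu> * (x \<bullet> U k) = c k" if k: "k < 2 * n" for k
    proof -
      have "\<mu> * (x \<bullet> U k) = (\<Sum>i<2 * n. c i * (\<mu> * (U i \<bullet> U k)))"
        by (subst x) (simp add: inner_sum_left sum_distrib_left mult_ac)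
      also have "\<dots> = (\<Sum>i<2 * n. c i * (if i = k then 1 else 0))"
        using ort k by (intro sum.cong) auto
      finally show ?thesis
        using k by (simp add: if_distrib[of "\<lambda>x. _ * x"] cong: if_cong)
    qed
    then show ?thesis
      using x by simp
  qed
  have jU: "U (n + i) = j (U i)" if "i < n" for i
    using V(2) that coords_J[OF p T] by (simp add: U_def)
  have curv: "conformal_metric f h p (curvature A D X Y Z p) (Y' p) = \<mu> * (R (coords p (X p))
      (coords p (Y p)) (coords p (Z p)) \<bullet> coords p (Y' p))"
    if "vfield_at A p X" "vfield_at A p Y" "vfield_at A p Z" "vfield_at A p Y'" for X Y Z Y'
    using curvature_fvec[of p D \<omega> nabla, OF p form bil smooth_vec_\<omega> LC that(1-3)] h_coords[OF p
        fvec_tangent[OF p] vfield_at_tangent[OF that(4)]]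
    by (simp add: conformal_metric_def \<mu>_def R_def \<omega>_def coords_fvec[OF p])
  have curv4: "curv4 A (conformal_metric f h) D Wc Zc Xc Yc p = complex_of_real \<mu> *
      cext (\<lambda>w. cext (\<lambda>z. cext (\<lambda>x. cext (\<lambda>y. K w z x y) (coords p (fst Yc p), coords p (snd Yc p)))
        (coords p (fst Xc p), coords p (snd Xc p))) (coords p (fst Zc p), coords p (snd Zc p)))
            (coords p (fst Wc p), coords p (snd Wc p))"
    if "\<forall>C\<in>{Wc, Zc, Xc, Yc}. vfield_at A p (fst C) \<and> vfield_at A p (snd C)" for Wc Zc Xc Yc
    using that unfolding curv4_def complexify_def cext_def by (simp add: curv K_def algebra_simps)
  define u where "u = unitary_field n \<epsilon>"
  have u_vf: "vfield_at A p (fst (u i))" "vfield_at A p (snd (u i))"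
    "vfield_at A p (fst (conj_field (u i)))" "vfield_at A p (snd (conj_field (u i)))" if "i < n"
        for i
    using vfield_at_cmult[OF vf, of i "1 / sqrt 2"] vfield_at_cmult[OF vf, of "n + i" "- (1 / sqrt
        2)"]
      vfield_at_cmult[OF vf, of "n + i" "1 / sqrt 2"] that
    by (simp_all add: u_def unitary_field_def conj_field_def)
  have u_coords: "(coords p (fst (u i) p), coords p (snd (u i) p)) = uvec U i"
    "(coords p (fst (conj_field (u i)) p), coords p (snd (conj_field (u i)) p)) = uvec_bar U i" if
        "i < n" for i
    using coords_cmult[OF p T, of i "1 / sqrt 2"] coords_cmult[OF p T, of "n + i" "- (1 / sqrt 2)"]
      coords_cmult[OF p T, of "n + i" "1 / sqrt 2"] that
    by (simp_all add: u_def unitary_field_def conj_field_def uvec_def uvec_bar_def U_def)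
  have K_lin: "linear (\<lambda>w. K w z x y)" "linear (\<lambda>z. K w z x y)" "linear (\<lambda>x. K w z x y)" "linear
      (\<lambda>y. K w z x y)" for w z x y
    using R_lin[THEN linear_add] R_lin[THEN linear_scale]
    by (auto intro!: linearI simp: K_def inner_simps scaleR_conv_of_real)
  have "scal1 A n J (conformal_metric f h) D' \<epsilon> t p = (\<Sum>i<n. \<Sum>k<n. complex_of_real \<mu> *
      cext (\<lambda>w. cext (\<lambda>z. cext (\<lambda>x. cext (\<lambda>y. K w z x y) (uvec_bar U k)) (uvec U k)) (uvec U i))
          (uvec_bar U i))"
    unfolding scal1_def Let_def D_def[symmetric] u_def[symmetric]
    by (intro sum.cong refl, subst curv4) (use u_vf u_coords in auto)
  then show ?A
    using sum_curv1[OF \<mu> U jU K_lin]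
    by (simp add: K_def[symmetric] \<mu>_def[symmetric] sum_distrib_left power2_eq_square mult.assoc)
  have "scal2 A n J (conformal_metric f h) D' \<epsilon> t p = (\<Sum>i<n. \<Sum>k<n. complex_of_real \<mu> *
      cext (\<lambda>w. cext (\<lambda>z. cext (\<lambda>x. cext (\<lambda>y. K w z x y) (uvec_bar U k)) (uvec U i)) (uvec U k))
          (uvec_bar U i))"
    unfolding scal2_def Let_def D_def[symmetric] u_def[symmetric]
    by (intro sum.cong refl, subst curv4) (use u_vf u_coords in auto)
  then show ?B
    using sum_curv2[OF \<mu> U jU K_lin]
    by (simp add: K_def[symmetric] \<mu>_def[symmetric] sum_distrib_left power2_eq_square mult.assoc)
qed

end

section \<open>Comparison of the scalar curvatures; Laplacian and Lee form\<close>

text \<open>The Levi-Civita derivative of grad f in direction x, so that minus its trace is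
  \<Delta>f.\<close>

definition hess :: "'m connection \<Rightarrow> ('m \<Rightarrow> real) \<Rightarrow> 'm \<Rightarrow> 'e \<Rightarrow> 'e" where
  "hess nabla f p x = dvec (fvec p x) (grad f) + chris nabla p x (grad f p)"

lemma ext_deriv_zero_form: "ext_deriv A (zero_form g) [X] q = X q g"
  by (simp add: ext_deriv_def zero_form_def)

lemma scal_change:
  assumes p: "p \<in> W" and f: "smooth_function A f"
    and LC: "levi_civita A h nabla" and LC': "levi_civita A (conformal_metric f h) nabla'"
    and frame: "local_unitary_frame A n J h p \<epsilon>"
    and frame': "local_unitary_frame A n J (conformal_metric f h) p \<epsilon>'"
  defines "lap \<equiv> - (\<Sum>a\<in>Basis. hess nabla f p a \<bullet> a)" and "\<alpha> \<equiv> lee_vec (chris nabla p) \<bullet> j (grad f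
      p)"
  shows "complex_of_real (exp (2 * f p)) * scal1 A n J (conformal_metric f h) nabla' \<epsilon>' t p
      = scal1 A n J h nabla \<epsilon> t p + complex_of_real ((real n * t - t + 1) * (lap + \<alpha>))"
    and "complex_of_real (exp (2 * f p)) * scal2 A n J (conformal_metric f h) nabla' \<epsilon>' t p
      = scal2 A n J h nabla \<epsilon> t p + complex_of_real ((real n * (1 - t) + t) * lap
        + (1 - t)\<^sup>2 * (1 - (real n)\<^sup>2) / 2 * (grad f p \<bullet> grad f p)
        + (real n * (1 - t) + t - (real n + 1) * (1 - t)\<^sup>2 / 2) * \<alpha>)"
proof -
  define \<tau> where "\<tau> = (\<lambda>x y. chris nabla p x y - chris nabla p y x)"
  define \<Gamma> u H where "\<Gamma> = chris nabla p" and "u = grad f p" and "H = hess nabla f p"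
  define D T where "D = (\<lambda>x. H x + gaud_shift \<Gamma> x u)" and "T = (\<lambda>x y. gaud_shift \<Gamma> x y -
      gaud_shift \<Gamma> y x)"
  have LC0: "levi_civita A (conformal_metric (\<lambda>_. 0) h) nabla"
    using LC by (simp add: conformal_metric_0)
  have frame0: "local_unitary_frame A n J (conformal_metric (\<lambda>_. 0) h) p \<epsilon>"
    using frame by (simp add: conformal_metric_0)
  note s0 = scal_inv[OF p smooth_function_0 LC LC0 frame0, unfolded conformal_metric_0, folded
      \<tau>_def]
  note s' = scal_inv[OF p f LC LC' frame', folded \<tau>_def]
  have R: "curv (\<lambda>q. gaud (chris nabla' q)) \<tau> p x y z = curv (\<lambda>q. gaud (chris nabla q)) \<tau> p x y z
      + curv_diff u D T x y z" for x y z
    using curv_change[OF p f LC LC', of x y z] by (simp add: \<tau>_def \<Gamma>_def u_def H_def D_def T_def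
        hess_def)
  have \<Gamma>: "bilinear \<Gamma>"
    unfolding \<Gamma>_def by (rule bilinear_chris[OF _ p]) (use LC in \<open>simp add: levi_civita_def\<close>)
  have skew: "\<Gamma> x y \<bullet> z = - (y \<bullet> \<Gamma> x z)" for x y z
    using LC_metric[OF smooth_function_0 LC0 p, of x y z] by (simp add: \<Gamma>_def grad_zero[OF p])
  have H: "linear H"
    unfolding H_def hess_def \<Gamma>_def[symmetric]
    by (rule linearI) (simp_all add: dvec_def fvec_add fvec_scaleR scaleR_left_distrib sum.distrib
        scaleR_sum_right
        bilinear_simps[OF \<Gamma>] algebra_simps)
  have D: "linear D" and T: "bilinear T"
    unfolding D_def T_def
    by (auto intro!: linearI bilinearI simp: linear_add[OF H] linear_scale[OF H]
        bilinear_simps[OF bilinear_gaud_shift[OF \<Gamma>]] algebra_simps)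
  have alt: "curv_diff u D T x y z = - curv_diff u D T y x z" for x y z
    using cskew_simps(9)[of u "T x y" z] by (simp add: curv_diff_def T_def cskew_simps)
  have lin: "linear (\<lambda>x. curv_diff u D T x y z)" "linear (\<lambda>y. curv_diff u D T x y z)" "linear (\<lambda>z.
      curv_diff u D T x y z)" for x y z
    unfolding curv_diff_def
    by (rule linearI; simp add: cskew_simps linear_add[OF D] linear_scale[OF D] bilinear_simps[OF
        T] algebra_simps)+
  \<comment> \<open>Only the difference tensor is reduced to real traces; the two curvatures stay
    inside \<open>ctrace1\<close> and \<open>ctrace2\<close>.\<close>
  note inv = inv_skew[of "curv_diff u D T", OF lin curv_diff_skew curv_diff_j alt]
  have 1: "complex_of_real (exp (2 * f p)) * scal1 A n J (conformal_metric f h) nabla' \<epsilon>' t p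
      = scal1 A n J h nabla \<epsilon> t p + of_real (1/4 * (\<Sum>a\<in>Basis. \<Sum>b\<in>Basis. curv_diff u D T b (j b) (j
          a) \<bullet> a))"
    using s0(1) unfolding s'(1) R inner_add_left of_real_add ctrace1_add inv(1) by simp
  show "complex_of_real (exp (2 * f p)) * scal1 A n J (conformal_metric f h) nabla' \<epsilon>' t p
      = scal1 A n J h nabla \<epsilon> t p + complex_of_real ((real n * t - t + 1) * (lap + \<alpha>))"
    unfolding 1 trace1[OF \<Gamma> skew H D_def T_def]
    by (simp add: lap_def \<alpha>_def H_def \<Gamma>_def u_def)
  have 2: "complex_of_real (exp (2 * f p)) * scal2 A n J (conformal_metric f h) nabla' \<epsilon>' t p
      = scal2 A n J h nabla \<epsilon> t p + of_real (1/2 * (\<Sum>a\<in>Basis. \<Sum>b\<in>Basis. curv_diff u D T a b b \<bullet> a))"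
    using s0(2) unfolding s'(2) R inner_add_left of_real_add ctrace2_add inv(2) by simp
  show "complex_of_real (exp (2 * f p)) * scal2 A n J (conformal_metric f h) nabla' \<epsilon>' t p
      = scal2 A n J h nabla \<epsilon> t p + complex_of_real ((real n * (1 - t) + t) * lap
        + (1 - t)\<^sup>2 * (1 - (real n)\<^sup>2) / 2 * (grad f p \<bullet> grad f p)
        + (real n * (1 - t) + t - (real n + 1) * (1 - t)\<^sup>2 / 2) * \<alpha>)"
    unfolding 2 trace2[OF \<Gamma> skew H D_def T_def]
    by (simp add: lap_def \<alpha>_def H_def \<Gamma>_def u_def)
qed

context
  fixes nabla :: "'m connection" and p :: 'm
  assumes p: "p \<in> W" and LC: "levi_civita A h nabla"
begin

lemma nabla_F:
  assumes "b \<in> Basis" "c \<in> Basis"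
  shows "nabla p (F b p) (F c) = fvec p (chris nabla p b c)"
proof -
  have conn: "is_connection A nabla"
    using LC by (simp add: levi_civita_def)
  have "nabla p (fvec p b) (\<lambda>r. fvec r c) = fvec p (chris nabla p b c)"
    using fvec_chris[OF conn p fvec_tangent[OF p]] coords_fvec[OF p] by simp
  moreover have "(\<lambda>r. fvec r c) = F c"
    using assms by (simp add: fun_eq_iff fvec_Basis)
  ultimately show ?thesis
    using assms by (simp add: fvec_Basis)
qed

text \<open>Each summand is b(b f) - (\<nabla>_b b) f, and skewness of the coefficients moves the
  correction term onto the gradient.\<close>

lemma laplacian_F:
  assumes f: "smooth_function A f"
  shows "(\<Sum>b\<in>Basis. cov_form nabla (F b) (ext_deriv A (zero_form f)) [F b] p) = (\<Sum>b\<in>Basis. hess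
      nabla f p b \<bullet> b)"
proof (rule sum.cong[OF refl])
  fix b :: 'e assume b: "b \<in> Basis"
  have fs: "smooth_at A p f"
    using f unfolding smooth_function_def by blast
  have LC0: "levi_civita A (conformal_metric (\<lambda>_. 0) h) nabla"
    using LC by (simp add: conformal_metric_0)
  have "cov_form nabla (F b) (ext_deriv A (zero_form f)) [F b] p
    = F b p (\<lambda>r. F b r f) - nabla p (F b p) (F b) f"
    by (simp add: cov_form_def ext_deriv_zero_form[abs_def] cov_def)
  also have "F b p (\<lambda>r. F b r f) = dvec (fvec p b) (grad f) \<bullet> b"
    using dvec_inner[OF fvec_tangent[OF p] smooth_vec_grad[OF p fs], of b b] b by (simp add:
        grad_inner fvec_Basis)
  also have "nabla p (F b p) (F b) f = grad f p \<bullet> chris nabla p b b"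
    by (simp add: nabla_F b grad_inner)
  also have "dvec (fvec p b) (grad f) \<bullet> b - grad f p \<bullet> chris nabla p b b = hess nabla f p b \<bullet> b"
    using LC_metric[OF smooth_function_0 LC0 p, of b b "grad f p"]
    by (simp add: hess_def inner_simps grad_zero[OF p] inner_commute)
  finally show "cov_form nabla (F b) (ext_deriv A (zero_form f)) [F b] p = hess nabla f p b \<bullet> b" .
qed

text \<open>The minus signs in J\<alpha> = -\<alpha> \<circ> J and in the codifferential cancel, so
  this sum is the Lee form on the frame vector \<open>F c\<close>.\<close>

lemma lee_F:
  assumes c: "c \<in> Basis"
  shows "(\<Sum>b\<in>Basis. cov_form nabla (F b) (fundamental_form J h) [F b, \<lambda>q. J q (F c q)] p) =
      lee_vec (chris nabla p) \<bullet> j c"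
proof -
  have LC0: "levi_civita A (conformal_metric (\<lambda>_. 0) h) nabla"
    using LC by (simp add: conformal_metric_0)
  have conn: "is_connection A nabla"
    using LC by (simp add: levi_civita_def)
  have bil: "bilinear (chris nabla p)"
    by (rule bilinear_chris[OF conn p])
  have skew: "chris nabla p x y \<bullet> z = - (y \<bullet> chris nabla p x z)" for x y z
    using LC_metric[OF smooth_function_0 LC0 p, of x y z] by (simp add: grad_zero[OF p])
  have JF: "J q (F b q) = fvec q (j b)" if "q \<in> W" "b \<in> Basis" for q b
    using J_fvec[OF that(1), of b] that(2) by (simp add: fvec_Basis)
  have "cov_form nabla (F b) (fundamental_form J h) [F b, \<lambda>q. J q (F c q)] p = nabJ (chris nabla
      p) b b \<bullet> j c"
    if b: "b \<in> Basis" for b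
  proof -
    have Fb: "F b p = fvec p b" "F b p \<in> tangent_space A p"
      using b fvec_tangent[OF p, of b] by (simp_all add: fvec_Basis)
    \<comment> \<open>The fundamental form is constant on these frame fields, so only the two
      connection terms remain, and they combine to \<nabla>J by skewness.\<close>
    have 1: "F b p (\<lambda>r. h r (J r (F b r)) (J r (F c r))) = 0"
    proof -
      have "F b p (\<lambda>r. h r (J r (F b r)) (J r (F c r))) = F b p (\<lambda>r. j b \<bullet> j c)"
        by (rule tangent_local[OF Fb(2)])
          (rule eventually_mono[OF eventually_W[OF p]], simp add: JF b c h_fvec)
      then show ?thesis by (simp add: tangent_const[OF Fb(2)])
    qed
    have 2: "nabla p (F b p) (\<lambda>q. J q (F c q)) = fvec p (chris nabla p b (j c))"
      using D_fvec[OF conn p Fb(2) smooth_vec_const, of "\<lambda>q. J q (F c q)" "j c"]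
          eventually_mono[OF eventually_W[OF p], of "\<lambda>q. J q (F c q) = fvec q (j c)"]
      by (simp add: JF c dvec_const[OF fvec_tangent[OF p]] Fb(1) coords_fvec[OF p])
    show ?thesis
      by (simp add: cov_form_def fundamental_form_def[abs_def] cov_def 1 2 lessThan_Suc nabla_F b
          c J_fvec[OF p] JF[OF p] h_fvec[OF p]
          nabJ_def inner_simps skew[of b "j b"])
  qed
  then show ?thesis
    by (simp add: lee_vec_def inner_sum_left)
qed

end

end

section \<open>The conformal change formulas\<close>

text \<open>The numbered frame is carried to \<open>Basis\<close> along \<beta>, and
  \<open>j\<close> is then forced: \<beta> i goes to \<beta> (n + i), which goes to -\<beta>
  i.\<close>

lemma adapted_frame_exists:
  fixes A :: "('m::{t2_space,second_countable_topology}, 'e::euclidean_space) atlas"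
  assumes M: "almost_hermitian_manifold A n J h" and e: "local_unitary_frame A n J h p e"
    and \<beta>: "bij_betw \<beta> {..<2 * n} (Basis :: 'e set)"
  obtains j W where "p \<in> W" "adapted_frame A j n J h (\<lambda>b. e (inv_into {..<2 * n} \<beta> b)) W"
proof -
  from M have atlas: "smooth_atlas A" and dim: "DIM('e) = 2 * n"
    and acs: "almost_complex_structure A J" and met: "riemannian_metric A h"
    by (auto simp: almost_hermitian_manifold_def)
  interpret smooth_manifold A
    by (rule smooth_manifold.intro[OF atlas])
  define \<iota> where "\<iota> = inv_into {..<2 * n} \<beta>"
  \<comment> \<open>The subtraction occurs only when n \<le> \<iota> b, so it does not
    truncate.\<close>
  define jb where "jb = (\<lambda>b. if \<iota> b < n then \<beta> (n + \<iota> b) else - \<beta> (\<iota> b - n))"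
  define j where "j = (\<lambda>x :: 'e. \<Sum>b\<in>Basis. (x \<bullet> b) *\<^sub>R jb b)"
  have \<iota>: "\<iota> b < 2 * n" "\<beta> (\<iota> b) = b" if "b \<in> Basis" for b
    using bij_betwE[OF bij_betw_inv_into[OF \<beta>]] that bij_betw_inv_into_right[OF \<beta> that] by (auto
        simp: \<iota>_def)
  have \<beta>B: "\<beta> i \<in> Basis" "\<iota> (\<beta> i) = i" if "i < 2 * n" for i
    using bij_betwE[OF \<beta>] that bij_betw_inv_into_left[OF \<beta>, of i] by (auto simp: \<iota>_def)
  have \<beta>_inner: "\<beta> i \<bullet> \<beta> k = (if i = k then 1 else 0)" if "i < 2 * n" "k < 2 * n" for i k
    using that \<beta>B inner_Basis[of "\<beta> i" "\<beta> k"] by (metis (full_types))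
  have lin: "linear j"
    unfolding j_def by (rule linearI) (simp_all add: inner_simps scaleR_left_distrib sum.distrib
        scaleR_sum_right)
  have jB: "j b = jb b" if "b \<in> Basis" for b
    using that by (simp add: j_def inner_Basis if_distrib[of "\<lambda>x. x *\<^sub>R _"] cong: if_cong)
  have jlow: "j (\<beta> i) = \<beta> (n + i)" and jhigh: "j (\<beta> (n + i)) = - \<beta> i" if "i < n" for i
    using that by (simp_all add: jB jb_def \<beta>B)
  have Bcases: "\<exists>i<n. b = \<beta> i \<or> b = \<beta> (n + i)" if "b \<in> Basis" for b
  proof (cases "\<iota> b < n")
    case True
    then show ?thesis using \<iota>[OF that] by metis
  next
    case False
    then have "\<iota> b - n < n" "n + (\<iota> b - n) = \<iota> b"
      using \<iota>[OF that] by auto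
    then show ?thesis using \<iota>[OF that] by metis
  qed
  have jjB: "j (j b) = - b" if "b \<in> Basis" for b
    using Bcases[OF that] by (auto simp: jlow jhigh linear_neg[OF lin])
  have isoB: "j b \<bullet> j c = b \<bullet> c" if "b \<in> Basis" "c \<in> Basis" for b c
    using Bcases[OF that(1)] Bcases[OF that(2)] by (auto simp: jlow jhigh \<beta>_inner)
  have "hermitian_space j n"
  proof
    fix x y :: 'e
    have "j (j x) = (\<Sum>b\<in>Basis. (x \<bullet> b) *\<^sub>R j (j b))"
      using sum_Basis_contract[OF linear_compose[OF lin lin], of x] by simp
    then show "j (j x) = - x"
      by (simp add: jjB sum_negf euclidean_representation)
    have l: "linear (\<lambda>x. j x \<bullet> z)" "linear (\<lambda>y. z \<bullet> j y)" for z
      by (auto intro!: linearI simp: linear_add[OF lin] linear_scale[OF lin] inner_simps)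
    have "j x \<bullet> j y = (\<Sum>b\<in>Basis. (x \<bullet> b) * (\<Sum>c\<in>Basis. (y \<bullet> c) * (j b \<bullet> j c)))"
      by (simp only: sum_Basis_contract_real[OF l(2)] sum_Basis_contract_real[OF l(1)])
    also have "\<dots> = (\<Sum>b\<in>Basis. (x \<bullet> b) * (\<Sum>c\<in>Basis. (y \<bullet> c) * (b \<bullet> c)))"
      by (simp add: isoB)
    also have "\<dots> = x \<bullet> y"
      by (simp only: euclidean_inner[symmetric])
    finally show "j x \<bullet> j y = x \<bullet> y" .
  qed (simp_all add: linear_add[OF lin] linear_scale[OF lin] dim)
  \<comment> \<open>Smoothness of the frame is given at p alone; the neighbourhood is shrunk until
    it holds at every point together with the other frame properties.\<close>
  moreover obtain W where W: "open W" "p \<in> W"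
    "\<And>q. q \<in> W \<Longrightarrow> (\<forall>i<2 * n. vfield_at A q (e i)) \<and>
      (\<forall>i<2 * n. \<forall>j<2 * n. h q (e i q) (e j q) = (if i = j then 1 else 0)) \<and>
        (\<forall>i<n. e (n + i) q = J q (e i q)) \<and>
        (\<forall>v\<in>tangent_space A q. \<exists>c. v = (\<lambda>g. \<Sum>i<2 * n. c i * e i q g))"
  proof -
    have "eventually (\<lambda>q. \<forall>i\<in>{..<2 * n}. vfield_at A q (e i)) (nhds p)"
      using e by (intro eventually_ball_finite) (auto simp: local_unitary_frame_def intro:
          vfield_at_eventually)
    moreover have "eventually (\<lambda>q. 
        (\<forall>i<2 * n. \<forall>j<2 * n. h q (e i q) (e j q) = (if i = j then 1 else 0)) \<and>
        (\<forall>i<n. e (n + i) q = J q (e i q)) \<and>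
        (\<forall>v\<in>tangent_space A q. \<exists>c. v = (\<lambda>g. \<Sum>i<2 * n. c i * e i q g))) (nhds p)"
      using e unfolding local_unitary_frame_def eventually_nhds by blast
    ultimately have "eventually (\<lambda>q. (\<forall>i<2 * n. vfield_at A q (e i)) \<and>
      (\<forall>i<2 * n. \<forall>j<2 * n. h q (e i q) (e j q) = (if i = j then 1 else 0)) \<and>
        (\<forall>i<n. e (n + i) q = J q (e i q)) \<and>
        (\<forall>v\<in>tangent_space A q. \<exists>c. v = (\<lambda>g. \<Sum>i<2 * n. c i * e i q g))) (nhds p)"
      by eventually_elim auto
    then obtain W where "open W" "p \<in> W" "\<forall>q\<in>W. (\<forall>i<2 * n. vfield_at A q (e i)) \<and>
      (\<forall>i<2 * n. \<forall>j<2 * n. h q (e i q) (e j q) = (if i = j then 1 else 0)) \<and>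
        (\<forall>i<n. e (n + i) q = J q (e i q)) \<and>
        (\<forall>v\<in>tangent_space A q. \<exists>c. v = (\<lambda>g. \<Sum>i<2 * n. c i * e i q g))"
      unfolding eventually_nhds by (elim exE conjE)
    then show ?thesis
      by - (rule that, assumption, assumption, erule (1) bspec)
  qed
  moreover have "adapted_frame_axioms A j J h (\<lambda>b. e (\<iota> b)) W"
  proof
    fix q b c assume q: "q \<in> W" and b: "b \<in> (Basis :: 'e set)"
    show "vfield_at A q (e (\<iota> b))"
      using W(3)[OF q] \<iota>(1)[OF b] by blast
    show "h q (e (\<iota> b) q) (e (\<iota> c) q) = (if b = c then 1 else 0)" if c: "c \<in> Basis"
    proof -
      have "\<iota> b = \<iota> c \<longleftrightarrow> b = c"
        using \<iota>(2) b c by metis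
      then show ?thesis
        using W(3)[OF q] \<iota>(1)[OF b] \<iota>(1)[OF c] by simp
    qed
    have F: "(\<lambda>g. \<Sum>c\<in>Basis. (\<beta> i \<bullet> c) * e (\<iota> c) q g) = e i q" if "i < 2 * n" for i
      using that \<beta>B by (simp add: fun_eq_iff inner_Basis if_distrib[of "\<lambda>x. x * _"] cong: if_cong)
    have JJ: "J q (e (n + i) q) = (\<lambda>g. - e i q g)" if "i < n" for i
    proof -
      have "e i q \<in> tangent_space A q"
        using W(3)[OF q] that by (intro vfield_at_tangent) auto
      then have "J q (J q (e i q)) = (\<lambda>g. - e i q g)"
        using acs unfolding almost_complex_structure_def by blast
      then show ?thesis
        using W(3)[OF q] that by simp
    qed
    obtain i where i: "i < n" "b = \<beta> i \<or> b = \<beta> (n + i)"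
      using Bcases[OF b] by blast
    then show "J q (e (\<iota> b) q) = (\<lambda>g. \<Sum>c\<in>Basis. (j b \<bullet> c) * e (\<iota> c) q g)"
    proof (elim disjE)
      assume "b = \<beta> i"
      then show ?thesis
        using F[of "n + i"] W(3)[OF q] i(1) by (simp add: jlow \<beta>B)
    next
      assume "b = \<beta> (n + i)"
      then show ?thesis
        using F[of i] JJ[OF i(1)] i(1) by (simp add: jhigh \<beta>B sum_negf fun_eq_iff)
    qed
  next
    fix q v assume q: "q \<in> W" and v: "v \<in> tangent_space A q"
    then obtain c where "v = (\<lambda>g. \<Sum>i<2 * n. c i * e i q g)"
      using W(3)[OF q] by blast
    also have "\<dots> = (\<lambda>g. \<Sum>b\<in>Basis. c (\<iota> b) * e (\<iota> b) q g)"
      using sum.reindex_bij_betw[OF bij_betw_inv_into[OF \<beta>], of "\<lambda>i. c i * e i q g" for g] by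
          (simp add: \<iota>_def)
    finally show "\<exists>c. v = (\<lambda>g. \<Sum>b\<in>Basis. c b * e (\<iota> b) q g)"
      by (intro exI[of _ "\<lambda>b. c (\<iota> b)"]) simp
  qed (use acs met W in auto)
  ultimately have "adapted_frame A j n J h (\<lambda>b. e (\<iota> b)) W"
    by (intro adapted_frame.intro smooth_manifold_axioms)
  then show ?thesis
    using that[of W j] W(2) by (simp add: \<iota>_def)
qed

theorem proposition2p1:
  fixes A :: "('m::{t2_space,second_countable_topology}, 'e::euclidean_space) atlas"
    and n :: nat and J :: "'m endo" and h :: "'m metric" and f :: "'m \<Rightarrow> real" and t :: real
    and nabla nabla_hat :: "'m connection" and p :: 'm and e e_hat :: "nat \<Rightarrow> 'm vfield"
  defines "h_hat \<equiv> conformal_metric f h"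
    and "df \<equiv> ext_deriv A (zero_form f)"
    and "\<Delta>f \<equiv> hodge_laplacian A n nabla e (zero_form f) [] p"
    and "\<alpha>\<^sub>F \<equiv> lee_form n J h nabla e"
  assumes "almost_hermitian_manifold A n J h"
    and "smooth_function A f"
    and "levi_civita A h nabla"
    and "levi_civita A h_hat nabla_hat"
    and "local_unitary_frame A n J h p e"
    and "local_unitary_frame A n J h_hat p e_hat"
  shows "complex_of_real (exp (2 * f p)) * scal1 A n J h_hat nabla_hat e_hat t p
         = scal1 A n J h nabla e t p
           + complex_of_real ((real n * t - t + 1) * (\<Delta>f + inner1 n e \<alpha>\<^sub>F df p))
       \<and> complex_of_real (exp (2 * f p)) * scal2 A n J h_hat nabla_hat e_hat t p
         = scal2 A n J h nabla e t p
           + complex_of_real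
              ((real n * (1 - t) + t) * \<Delta>f
               + (1 - t)\<^sup>2 * (1 - (real n)\<^sup>2) / 2 * inner1 n e df df p
               + (real n * (1 - t) + t - (real n + 1) * (1 - t)\<^sup>2 / 2) * inner1 n e \<alpha>\<^sub>F df p)"
proof -
  have "DIM('e) = 2 * n"
    using assms(5) by (simp add: almost_hermitian_manifold_def)
  moreover obtain \<beta> where "bij_betw \<beta> {0..<DIM('e)} (Basis :: 'e set)"
    using ex_bij_betw_nat_finite finite_Basis by blast
  ultimately have \<beta>: "bij_betw \<beta> {..<2 * n} (Basis :: 'e set)"
    by (simp add: lessThan_atLeast0)
  define F where "F = (\<lambda>b. e (inv_into {..<2 * n} \<beta> b))"
  obtain j W where p: "p \<in> W" and "adapted_frame A j n J h F W"
    using adapted_frame_exists[OF assms(5,9) \<beta>] unfolding F_def by blast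
  then interpret adapted_frame A j n t J h F W by simp
  \<comment> \<open>Turns the sums over the numbered frame in the codifferential and the inner
    product into sums over \<open>Basis\<close>.\<close>
  have reindex: "(\<Sum>i<2 * n. \<phi> (e i)) = (\<Sum>b\<in>Basis. \<phi> (F b))" for \<phi> :: "'m vfield \<Rightarrow> real"
    using sum.reindex_bij_betw[OF bij_betw_inv_into[OF \<beta>], of "\<lambda>i. \<phi> (e i)"] by (simp add: F_def)
  let ?\<alpha> = "lee_vec (chris nabla p)"
  \<comment> \<open>The sign is the one in the codifferential; the summand d\<delta> is an empty sum
    on the empty list.\<close>
  have lap: "\<Delta>f = - (\<Sum>b\<in>Basis. hess nabla f p b \<bullet> b)"
    using laplacian_F[OF p assms(7,6)] reindex[of "\<lambda>X. cov_form nabla X df [X] p"]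
    by (simp add: \<Delta>f_def hodge_laplacian_def codiff_def df_def) (simp add: ext_deriv_def)
  have df: "df [F b] p = grad f p \<bullet> b" if "b \<in> Basis" for b
    using that by (simp add: df_def ext_deriv_zero_form grad_inner fvec_Basis)
  have lee: "\<alpha>\<^sub>F [F c] p = ?\<alpha> \<bullet> j c" if "c \<in> Basis" for c
    using lee_F[OF p assms(7) that]
      reindex[of "\<lambda>X. cov_form nabla X (fundamental_form J h) [X, \<lambda>q. J q (F c q)] p"]
    by (simp add: \<alpha>\<^sub>F_def lee_form_def J_form_def codiff_def)
  have 1: "inner1 n e df df p = grad f p \<bullet> grad f p"
    using reindex[of "\<lambda>X. df [X] p * df [X] p"] by (simp add: inner1_def df euclidean_inner[of
        "grad f p" "grad f p"])
  have "linear (\<lambda>x. ?\<alpha> \<bullet> j x)"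
    by (rule linearI) (simp_all add: j_simps inner_simps)
  from sum_Basis_contract_real[OF this, of "grad f p"]
  have 2: "inner1 n e \<alpha>\<^sub>F df p = ?\<alpha> \<bullet> j (grad f p)"
    using reindex[of "\<lambda>X. \<alpha>\<^sub>F [X] p * df [X] p"] by (simp add: inner1_def df lee mult.commute)
  \<comment> \<open>The frame \<open>e\<close> underlies the adapted frame, while
    \<open>e_hat\<close> enters only through the basis-free traces and so requires no relation to
    \<open>e\<close>.\<close>
  show ?thesis
    using scal_change[OF p assms(6,7,8)[unfolded h_hat_def] assms(9) assms(10)[unfolded h_hat_def]]
    unfolding h_hat_def lap 1 2 by simp
qed

end
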